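(* Let $\{\xi_x : x\in\mathbb Z\}$ be a sequence of strictly positive numbers such that, for some $0<\gamma<\infty$, $$\lim_{K\to\infty}\frac1K\sum_{x=1}^{K}\xi_x^{-1}=\gamma,\qquad \lim_{K\to\infty}\frac1K\sum_{x=-K}^{-1}\xi_x^{-1}=\gamma .$$ Fix a profile $\rho_0:\mathbb R\to[0,1]$. Then, under $\mathbb P^N_{\nu^N_{\rho_0(\cdot)}}$, $\pi^N_t$ converges in probability to the weak solution of the heat equation $\partial_t\rho=\gamma^{-1}\Delta\rho$, $\rho(0,\cdot)=\rho_0(\cdot)$: for every continuous function $G:\mathbb R\to\mathbb R$ with compact support, every $t\ge0$ and every $\delta>0$, $$\lim_{N\to\infty}\mathbb P^N_{\nu^N_{\rho_0(\cdot)}}\Big[\,\big|\langle\pi^N_t,G\rangle-\langle\rho_t,G\rangle\big|>\delta\Big]=0,$$ where $\rho(t,u)$ is the weak solution of this heat equation.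
   Context: State space: $\mathcal X=\{0,1\}^{\mathbb Z}$; $\eta(x)=1$ means that site $x$ is occupied by a particle in the configuration $\eta\in\mathcal X$, $\eta(x)=0$ that it is empty. For a sequence $\xi=\{\xi_x\}$ of strictly positive numbers and $N\ge1$, $\{\eta_t:t\ge0\}$ is the Markov process on $\mathcal X$ (symmetric nearest-neighbor simple exclusion process with bond disorder $\xi$, speeded up by $N^2$) whose generator acts on cylinder functions $f$ as $$(L_{\xi,N}f)(\eta)=N^2\sum_{x\in\mathbb Z}\xi_x\{f(\sigma^{x,x+1}\eta)-f(\eta)\},$$ where $\sigma^{x,x+1}\eta$ is obtained from $\eta$ by exchanging the values $\eta(x)$ and $\eta(x+1)$. $\nu^N_{\rho_0(\cdot)}$ is the product measure on $\mathcal X$ with marginals $\nu^N_{\rho_0(\cdot)}\{\eta(x)=1\}=\rho_0(x/N)$. For a measure $\mu$ on $\mathcal X$, $\mathbb P^N_\mu$ is the probability on the path space $D(\mathbb R_+,\mathcal X)$ induced by the process $\eta_t$ started from $\mu$. The empirical measure is $\pi^N_t(du)=\frac1N\sum_{x\in\mathbb Z}\eta_t(x)\,\delta_{x/N}(du)$, and $\langle\pi^N_t,G\rangle=\frac1N\sum_{x}G(x/N)\eta_t(x)$. For a function $\rho$, $\langle\rho,H\rangle=\int_{\mathbb R}H(u)\rho(u)\,du$. A bounded function $\rho:\mathbb R_+\times\mathbb R\to[0,1]$ is a weak solution of $\partial_t\rho=\gamma^{-1}\Delta\rho$, $\rho(0,\cdot)=\rho_0$, if $\langle\rho_t,G\rangle=\langle\rho_0,G\rangle+\int_0^t\langle\rho_s,\gamma^{-1}\Delta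 G\rangle\,ds$ for all $t\ge0$ and all twice continuously differentiable $G:\mathbb R\to\mathbb R$ with compact support (here $\rho_t=\rho(t,\cdot)$ and $\Delta$ is the Laplacian, $\Delta G=G''$). For any bounded profile $\rho_0:\mathbb R\to[0,1]$ there is a unique weak solution.
   Formalization: The profile ρ₀ is additionally assumed continuous at Lebesgue-almost every point; for arbitrary profiles the claim fails, e.g. for ρ₀ the indicator of the rationals, where all sites are occupied but the weak solution is 0. *)

theory Defs
  imports "HOL-Probability.Probability"
begin

section \<open>Configurations\<close>

text \<open>The state space \<open>{0,1}\<^sup>\<int>\<close>: \<^term>\<open>\<eta> x\<close> holds iff site \<open>x\<close> is occupied.  The topology
  on this function type is the product of the discrete topologies, and
  \<open>config_space\<close> carries the product \<open>\<sigma>\<close>-algebra.\<close>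

type_synonym config = "int \<Rightarrow> bool"

definition config_space :: "config measure" where
  "config_space = (\<Pi>\<^sub>M x\<in>UNIV. count_space UNIV)"

definition exchange :: "int \<Rightarrow> config \<Rightarrow> config" where
  "exchange x \<eta> = \<eta>(x := \<eta> (x + 1), x + 1 := \<eta> x)"

definition cylinder :: "(config \<Rightarrow> real) \<Rightarrow> bool" where
  "cylinder f \<longleftrightarrow> (\<exists>A. finite A \<and> (\<forall>\<eta> \<zeta>. (\<forall>x\<in>A. \<eta> x = \<zeta> x) \<longrightarrow> f \<eta> = f \<zeta>))"

definition exclusion_generator ::
    "(int \<Rightarrow> real) \<Rightarrow> nat \<Rightarrow> (config \<Rightarrow> real) \<Rightarrow> config \<Rightarrow> real" where
  \<comment> \<open>only finitely many summands are nonzero when \<open>f\<close> is a cylinder function\<close>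
  "exclusion_generator \<xi> N f \<eta> =
     (real N)\<^sup>2 * (\<Sum>\<^sub>\<infinity>x\<in>UNIV. \<xi> x * (f (exchange x \<eta>) - f \<eta>))"

definition profile_measure :: "nat \<Rightarrow> (real \<Rightarrow> real) \<Rightarrow> config measure" where
  "profile_measure N \<rho>0 =
     (\<Pi>\<^sub>M x\<in>UNIV. measure_pmf (bernoulli_pmf (\<rho>0 (real_of_int x / real N))))"


section \<open>The Markov process\<close>

definition markov_semigroup :: "(real \<Rightarrow> config \<Rightarrow> config measure) \<Rightarrow> bool" where
  "markov_semigroup S \<longleftrightarrow>
     (\<forall>t\<ge>0. S t \<in> config_space \<rightarrow>\<^sub>M prob_algebra config_space) \<and>
     (\<forall>\<eta>. S 0 \<eta> = return config_space \<eta>) \<and>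
     (\<forall>s\<ge>0. \<forall>t\<ge>0. \<forall>\<eta>. S (s + t) \<eta> = S s \<eta> \<bind> S t)"

text \<open>The generator of the semigroup (the derivative at time \<open>0\<close> in the supremum norm) is
  defined on every cylinder function and is given there by \<open>L\<close>.\<close>

definition generator_on_cylinders ::
    "(real \<Rightarrow> config \<Rightarrow> config measure) \<Rightarrow> ((config \<Rightarrow> real) \<Rightarrow> config \<Rightarrow> real) \<Rightarrow> bool" where
  "generator_on_cylinders S L \<longleftrightarrow>
     (\<forall>f. cylinder f \<longrightarrow>
        uniform_limit UNIV (\<lambda>h \<eta>. ((LINT \<zeta>|S h \<eta>. f \<zeta>) - f \<eta>) / h) (L f) (at_right 0))"

text \<open>The path space \<open>D(\<real>\<^sub>+, {0,1}\<^sup>\<int>)\<close>.  Paths are extensional functions on \<open>[0,\<infinity>)\<close>; the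
  \<open>\<sigma>\<close>-algebra is the one generated by the evaluations, which is the Borel \<open>\<sigma>\<close>-algebra
  of the Skorokhod topology.\<close>

definition cadlag :: "(real \<Rightarrow> config) \<Rightarrow> bool" where
  "cadlag \<omega> \<longleftrightarrow>
     (\<forall>t\<ge>0. (\<omega> \<longlongrightarrow> \<omega> t) (at_right t)) \<and> (\<forall>t>0. \<exists>\<zeta>. (\<omega> \<longlongrightarrow> \<zeta>) (at_left t))"

definition path_space :: "(real \<Rightarrow> config) measure" where
  "path_space = restrict_space (\<Pi>\<^sub>M t\<in>{0..}. config_space) {\<omega>. cadlag \<omega>}"

definition past :: "real \<Rightarrow> (real \<Rightarrow> config) measure" where
  "past s = vimage_algebra (space path_space) (\<lambda>\<omega>. restrict \<omega> {0..s})
              (\<Pi>\<^sub>M t\<in>{0..s}. config_space)"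

definition markov_law ::
    "(real \<Rightarrow> config \<Rightarrow> config measure) \<Rightarrow> config measure \<Rightarrow> (real \<Rightarrow> config) measure \<Rightarrow> bool" where
  "markov_law S \<mu> P \<longleftrightarrow>
     prob_space P \<and> sets P = sets path_space \<and>
     distr P config_space (\<lambda>\<omega>. \<omega> 0) = \<mu> \<and>
     (\<forall>s\<ge>0. \<forall>t\<ge>0. \<forall>A\<in>sets config_space.
        AE \<omega> in P. real_cond_exp P (past s) (\<lambda>\<omega>. indicator A (\<omega> (s + t))) \<omega>
                    = measure (S t (\<omega> s)) A)"

text \<open>\<open>P\<close> is the law on path space of the exclusion process with bond disorder \<open>\<xi>\<close>,
  speeded up by \<open>N\<^sup>2\<close> and started from \<open>\<mu>\<close>.\<close>

definition exclusion_law ::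
    "(int \<Rightarrow> real) \<Rightarrow> nat \<Rightarrow> config measure \<Rightarrow> (real \<Rightarrow> config) measure \<Rightarrow> bool" where
  "exclusion_law \<xi> N \<mu> P \<longleftrightarrow>
     (\<exists>S. markov_semigroup S \<and> generator_on_cylinders S (exclusion_generator \<xi> N) \<and>
          markov_law S \<mu> P)"


section \<open>Empirical measure and heat equation\<close>

definition empirical_measure :: "nat \<Rightarrow> config \<Rightarrow> real measure" where
  "empirical_measure N \<eta> =
     distr (density (count_space UNIV) (\<lambda>x::int. ennreal (of_bool (\<eta> x) / real N)))
       borel (\<lambda>x. real_of_int x / real N)"

definition compactly_supported :: "(real \<Rightarrow> real) \<Rightarrow> bool" where
  "compactly_supported G \<longleftrightarrow> compact (closure {u. G u \<noteq> 0})"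

lemma integral_empirical_measure:
  assumes "N \<ge> 1" "continuous_on UNIV G" "compactly_supported G"
  shows "(LINT u|empirical_measure N \<eta>. G u)
           = (1 / real N) * (\<Sum>\<^sub>\<infinity>x\<in>UNIV. G (real_of_int x / real N) * of_bool (\<eta> x))"
proof -
  let ?h = "\<lambda>x::int. G (real_of_int x / real N) * of_bool (\<eta> x)"
  have G: "G \<in> borel_measurable borel"
    using assms(2) by (rule borel_measurable_continuous_onI)
  have "bounded {u. G u \<noteq> 0}"
    using assms(3) bounded_subset closure_subset compact_imp_bounded
    unfolding compactly_supported_def by metis
  then obtain B where B: "\<And>u. G u \<noteq> 0 \<Longrightarrow> \<bar>u\<bar> \<le> B"
    by (auto simp: bounded_iff)
  have "finite {x::int. \<bar>real_of_int x / real N\<bar> \<le> B}"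
  proof (rule finite_subset)
    show "{x::int. \<bar>real_of_int x / real N\<bar> \<le> B} \<subseteq> {- \<lceil>B * real N\<rceil>..\<lceil>B * real N\<rceil>}"
    proof
      fix x :: int assume "x \<in> {x. \<bar>real_of_int x / real N\<bar> \<le> B}"
      then have "\<bar>real_of_int x\<bar> \<le> B * real N"
        using assms(1) by (simp add: abs_divide pos_divide_le_eq)
      then show "x \<in> {- \<lceil>B * real N\<rceil>..\<lceil>B * real N\<rceil>}"
        by (simp add: abs_le_iff) linarith
    qed
  qed simp
  then have fin: "finite {x. ?h x \<noteq> 0}"
    by (rule finite_subset[rotated]) (use B[of "real_of_int _ / real N"] in \<open>auto simp del: abs_divide\<close>)
  have fin': "finite {x. (of_bool (\<eta> x) / real N) *\<^sub>R G (real_of_int x / real N) \<noteq> 0}"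
    using fin by (rule finite_subset[rotated]) auto
  have "(LINT u|empirical_measure N \<eta>. G u)
      = (LINT x|count_space UNIV. (of_bool (\<eta> x) / real N) *\<^sub>R G (real_of_int x / real N))"
    unfolding empirical_measure_def using G
    by (subst integral_distr, simp, simp, subst integral_density) auto
  also have "\<dots> = (\<Sum>x | ?h x \<noteq> 0. (of_bool (\<eta> x) / real N) *\<^sub>R G (real_of_int x / real N))"
    by (subst lebesgue_integral_count_space_finite_support)
      (use fin fin' assms(1) in \<open>auto intro!: sum.cong\<close>)
  also have "\<dots> = (1 / real N) * (\<Sum>x | ?h x \<noteq> 0. ?h x)"
    by (simp add: sum_distrib_left mult_ac)
  also have "(\<Sum>x | ?h x \<noteq> 0. ?h x) = (\<Sum>\<^sub>\<infinity>x\<in>UNIV. ?h x)"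
    unfolding infsum_finite[OF fin, symmetric] by (rule infsum_cong_neutral) auto
  finally show ?thesis .
qed

definition pairing :: "(real \<Rightarrow> real) \<Rightarrow> (real \<Rightarrow> real) \<Rightarrow> real" where
  "pairing \<rho> H = (LINT u|lebesgue. H u * \<rho> u)"

text \<open>Weak solutions of \<open>\<partial>\<^sub>t\<rho> = \<gamma>\<^sup>-\<^sup>1\<Delta>\<rho>\<close>, \<open>\<rho>(0,\<cdot>) = \<rho>0\<close>, with values in \<open>[0,1]\<close>; only
  times \<open>t \<ge> 0\<close> are relevant.  The two measurability conditions say exactly that the integrals
  in the defining identity exist.  The test function \<open>G\<close> is given along with its first and
  second derivatives \<open>G'\<close>, \<open>G''\<close>.\<close>

definition weak_heat_solution ::
    "real \<Rightarrow> (real \<Rightarrow> real) \<Rightarrow> (real \<Rightarrow> real \<Rightarrow> real) \<Rightarrow> bool" where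
  "weak_heat_solution \<gamma> \<rho>0 \<rho> \<longleftrightarrow>
     (\<forall>t\<ge>0. \<forall>u. \<rho> t u \<in> {0..1}) \<and>
     (\<forall>t\<ge>0. \<rho> t \<in> borel_measurable lebesgue) \<and>
     (\<forall>G G' G''.
        (\<forall>u. (G has_real_derivative G' u) (at u)) \<and>
        (\<forall>u. (G' has_real_derivative G'' u) (at u)) \<and>
        continuous_on UNIV G'' \<and> compactly_supported G \<longrightarrow>
        (\<forall>t\<ge>0.
           set_integrable lebesgue {0..t} (\<lambda>s. pairing (\<rho> s) (\<lambda>u. inverse \<gamma> * G'' u)) \<and>
           pairing (\<rho> t) G = pairing \<rho>0 G +
             (LINT s:{0..t}|lebesgue. pairing (\<rho> s) (\<lambda>u. inverse \<gamma> * G'' u))))"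

end

theory Submission
  imports Defs
begin

text \<open>Only one-time marginals of the process are needed.  The heat semigroup acting on a test function
  \<open>f\<close> is replaced by iterates of the average \<open>A f(u) = (f(u + d) + f(u - d))/2\<close>, one iterate per time
  \<open>\<tau> = \<gamma> d\<^sup>2/2\<close>: this keeps smoothness bounds and compact supports, and \<open>A f\<close> agrees with \<open>f + \<tau> \<gamma>\<^sup>-\<^sup>1 f''\<close> up
  to \<open>O(d\<^sup>4)\<close>.  The supports grow to length \<open>O(1/d)\<close>, so after \<open>t/\<tau>\<close> steps the total error is still \<open>O(d)\<close>.
  For the weak solution this yields \<open>\<langle>\<rho>\<^sub>t, f\<rangle> \<approx> \<langle>\<rho>\<^sub>0, A\<^sup>k f\<rangle>\<close>.  For the particle system, the time derivative of
  the second moment of \<open>\<langle>\<pi>\<^sub>s, f\<^sub>s\<rangle> - z\<close> is controlled by the generator, applied not to \<open>f\<close> but to a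
  corrected test function whose discrete gradient is \<open>f'\<close> divided by \<open>\<gamma> \<xi>\<^sub>x\<close>; the averaging hypotheses
  on \<open>\<xi>\<^sub>x\<^sup>-\<^sup>1\<close> make the correction uniformly small and the quadratic variation \<open>O(1/N)\<close>.  Hence the second
  moment with \<open>z = \<langle>\<rho>\<^sub>0, A\<^sup>k f\<rangle>\<close> is small at time \<open>t\<close> because it is small at time \<open>0\<close>.\<close>

section \<open>One-time marginals of the exclusion process\<close>

text \<open>The numbers \<xi>_x are merely positive, with averages known for their inverses: single
  conductances may be arbitrarily large or small, and the generator applied to a smooth profile need
  not converge. Currents are the regular quantity. A function with flux f'/\<gamma> through every
  bond has increments proportional to f'/(\<gamma> \<xi>_x), and the averaging hypotheses make these
  add up to f on the macroscopic scale; the effective diffusivity is therefore the harmonic mean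
  \<gamma>^-1 of the conductances. The equation for a single linear statistic closes: for symmetric
  exclusion the generator maps linear functions of \<eta> to linear functions, so the interaction is
  felt only in the quadratic variation. That term is N^-2 times a sum of O(N) inverse conductances
  with bounded weights, hence O(1/N). The generator is known only as a derivative from the right, so
  the Gronwall argument runs on one-sided derivatives. The profile enters at time 0 only, through
  its values at lattice points; its almost everywhere continuity turns sums of these values into
  integrals.\<close>

lemma space_config_space [simp]: "space config_space = UNIV"
  by (simp add: config_space_def space_PiM)

lemma measurable_site [measurable]: "(\<lambda>\<eta>. \<eta> x) \<in> config_space \<rightarrow>\<^sub>M count_space UNIV"
  unfolding config_space_def by measurable

lemma measurable_eval_path:
  assumes "s \<ge> 0"
  shows "(\<lambda>\<omega>. \<omega> s) \<in> path_space \<rightarrow>\<^sub>M config_space"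
  unfolding path_space_def using assms by (intro measurable_restrict_space1) simp

lemma past_subalgebra:
  assumes "s \<ge> 0" "sets P = sets path_space"
  shows "subalgebra P (past s)"
proof -
  have sp: "space P = space path_space"
    using assms(2) by (rule sets_eq_imp_space_eq)
  have r: "(\<lambda>\<omega>. restrict \<omega> {0..s}) \<in> path_space \<rightarrow>\<^sub>M (\<Pi>\<^sub>M t\<in>{0..s}. config_space)"
    unfolding path_space_def
    by (intro measurable_restrict_space1 measurable_restrict_subset) auto
  have "sets (past s) \<subseteq> sets path_space"
    unfolding past_def by (intro sets_image_in_sets r) simp
  then show ?thesis
    by (simp add: subalgebra_def sp assms(2) past_def)
qed

section \<open>Cylinder functions: boundedness, measurability and closure properties\<close>

lemma cylinder_finite_range:
  assumes "cylinder f"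
  shows "finite (range f)"
proof -
  obtain A where A: "finite A" "\<And>\<eta> \<zeta>. (\<forall>x\<in>A. \<eta> x = \<zeta> x) \<Longrightarrow> f \<eta> = f \<zeta>"
    using assms unfolding cylinder_def by blast
  have "f \<eta> \<in> (\<lambda>B. f (\<lambda>x. x \<in> B)) ` Pow A" for \<eta>
    by (rule image_eqI[where x = "{x\<in>A. \<eta> x}"]) (auto intro: A(2))
  then have "range f \<subseteq> (\<lambda>B. f (\<lambda>x. x \<in> B)) ` Pow A" by blast
  then show ?thesis by (rule finite_subset) (simp add: A(1))
qed

lemma cylinder_bounded:
  assumes "cylinder f"
  obtains C where "C \<ge> 0" "\<And>\<eta>. \<bar>f \<eta>\<bar> \<le> C"
proof -
  have fin: "finite (insert 0 (abs ` range f))" using cylinder_finite_range[OF assms] by simp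
  then show thesis
    by (intro that[of "Max (insert 0 (abs ` range f))"] Max_ge[OF fin]) auto
qed

text \<open>\<open>f\<close> is expanded over the occupation patterns \<open>B\<close> of the sites
  in \<open>A\<close>; the indicator of a pattern is a finite product of site indicators, so
  measurability reduces to the coordinates of the product space.\<close>

lemma cylinder_measurable:
  assumes "cylinder f"
  shows "f \<in> borel_measurable config_space"
proof -
  obtain A where A: "finite A" "\<And>\<eta> \<zeta>. (\<forall>x\<in>A. \<eta> x = \<zeta> x) \<Longrightarrow> f \<eta> = f \<zeta>"
    using assms unfolding cylinder_def by blast
  have eq: "f \<eta> = (\<Sum>B\<in>Pow A. f (\<lambda>x. x \<in> B) * of_bool (\<forall>x\<in>A. \<eta> x = (x \<in> B)))" for \<eta>
  proof -
    have "(\<Sum>B\<in>Pow A. f (\<lambda>x. x \<in> B) * of_bool (\<forall>x\<in>A. \<eta> x = (x \<in> B)))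
        = (\<Sum>B\<in>Pow A. if B = {x\<in>A. \<eta> x} then f (\<lambda>x. x \<in> B) else 0)"
      by (intro sum.cong) (auto simp: of_bool_def)
    also have "\<dots> = f (\<lambda>x. x \<in> {x\<in>A. \<eta> x})"
      using A(1) by (subst sum.delta) auto
    also have "\<dots> = f \<eta>" by (rule A(2)) auto
    finally show ?thesis by simp
  qed
  have bool: "of_bool (\<forall>x\<in>A. \<eta> x = (x \<in> B)) = (\<Prod>x\<in>A. of_bool (\<eta> x = (x \<in> B)) :: real)" for \<eta> B
    using A(1) by (induction A rule: finite_induct) auto
  have site: "(\<lambda>\<eta>. of_bool (\<eta> x = b) :: real) \<in> borel_measurable config_space" for x b
    by (rule measurable_compose[OF measurable_site, where g = "\<lambda>a. of_bool (a = b)"]) simp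
  have "(\<lambda>\<eta>. \<Sum>B\<in>Pow A. f (\<lambda>x. x \<in> B) * of_bool (\<forall>x\<in>A. \<eta> x = (x \<in> B)))
          \<in> borel_measurable config_space"
    unfolding bool by (intro borel_measurable_sum borel_measurable_times borel_measurable_prod site) simp
  then show ?thesis unfolding eq[symmetric] .
qed

lemma cylinder_const: "cylinder (\<lambda>_. c)"
  unfolding cylinder_def by auto

lemma cylinder_site: "cylinder (\<lambda>\<eta>. of_bool (\<eta> x))"
  unfolding cylinder_def by (intro exI[of _ "{x}"]) auto

lemma cylinder_comp2:
  assumes "cylinder f" "cylinder g"
  shows "cylinder (\<lambda>\<eta>. h (f \<eta>) (g \<eta>))"
proof -
  obtain A where A: "finite A" "\<And>\<eta> \<zeta>. (\<forall>x\<in>A. \<eta> x = \<zeta> x) \<Longrightarrow> f \<eta> = f \<zeta>"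
    using assms unfolding cylinder_def by blast
  obtain B where B: "finite B" "\<And>\<eta> \<zeta>. (\<forall>x\<in>B. \<eta> x = \<zeta> x) \<Longrightarrow> g \<eta> = g \<zeta>"
    using assms unfolding cylinder_def by blast
  have "h (f \<eta>) (g \<eta>) = h (f \<zeta>) (g \<zeta>)" if "\<forall>x\<in>A \<union> B. \<eta> x = \<zeta> x" for \<eta> \<zeta>
    using A(2)[of \<eta> \<zeta>] B(2)[of \<eta> \<zeta>] that by auto
  then show ?thesis unfolding cylinder_def using A(1) B(1) by (intro exI[of _ "A \<union> B"]) blast
qed

lemmas cylinder_plus = cylinder_comp2[where h = "(+)"]
  and cylinder_minus = cylinder_comp2[where h = "(-)"]
  and cylinder_times = cylinder_comp2[where h = "(*)"]

lemma cylinder_sum: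
  assumes "\<And>i. i \<in> I \<Longrightarrow> cylinder (f i)"
  shows "cylinder (\<lambda>\<eta>. \<Sum>i\<in>I. f i \<eta>)"
  using assms
  by (induction I rule: infinite_finite_induct) (auto intro: cylinder_const cylinder_plus)

lemma cylinder_exchange:
  assumes "cylinder f"
  shows "cylinder (\<lambda>\<eta>. f (exchange x \<eta>))"
proof -
  obtain A where A: "finite A" "\<And>\<eta> \<zeta>. (\<forall>x\<in>A. \<eta> x = \<zeta> x) \<Longrightarrow> f \<eta> = f \<zeta>"
    using assms unfolding cylinder_def by blast
  have "f (exchange x \<eta>) = f (exchange x \<zeta>)" if "\<forall>y\<in>A \<union> {x, x + 1}. \<eta> y = \<zeta> y" for \<eta> \<zeta>
    using that by (intro A(2)) (auto simp: exchange_def)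
  then show ?thesis
    unfolding cylinder_def using A(1) by (intro exI[of _ "A \<union> {x, x + 1}"]) blast
qed

text \<open>\<open>exclusion_law\<close> asserts only that some semigroup exists. Fixing one here
  lets the later estimates quantify over all admissible choices, with thresholds on \<open>N\<close>
  that do not depend on the choice.\<close>

locale exclusion_process = prob_space P
  for P :: "(real \<Rightarrow> config) measure" +
  fixes \<xi> :: "int \<Rightarrow> real" and N :: nat and S :: "real \<Rightarrow> config \<Rightarrow> config measure"
    and \<mu> :: "config measure"
  assumes semigroup: "markov_semigroup S"
    and generator: "generator_on_cylinders S (exclusion_generator \<xi> N)"
    and law: "markov_law S \<mu> P"
begin

lemma sets_P [measurable_cong]: "sets P = sets path_space"
  using law unfolding markov_law_def by auto

lemma measurable_eval: "s \<ge> 0 \<Longrightarrow> (\<lambda>\<omega>. \<omega> s) \<in> P \<rightarrow>\<^sub>M config_space"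
  using measurable_eval_path measurable_cong_sets[OF sets_P refl] by blast

section \<open>Evolution of one-time laws and expectations\<close>

definition marginal :: "real \<Rightarrow> config measure" where
  "marginal s = distr P config_space (\<lambda>\<omega>. \<omega> s)"

lemma sets_marginal [simp, measurable_cong]: "sets (marginal s) = sets config_space"
  by (simp add: marginal_def)

lemma space_marginal [simp]: "space (marginal s) = UNIV"
  by (simp add: marginal_def)

lemma prob_space_marginal: "s \<ge> 0 \<Longrightarrow> prob_space (marginal s)"
  unfolding marginal_def by (intro prob_space_distr measurable_eval)

lemma kernel: "h \<ge> 0 \<Longrightarrow> S h \<in> config_space \<rightarrow>\<^sub>M prob_algebra config_space"
  using semigroup unfolding markov_semigroup_def by auto

lemma kernel_subprob: "h \<ge> 0 \<Longrightarrow> S h \<in> marginal s \<rightarrow>\<^sub>M subprob_algebra config_space"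
  using measurable_prob_algebraD[OF kernel] by (simp cong: measurable_cong_sets)

lemma kernel_prob: "h \<ge> 0 \<Longrightarrow> prob_space (S h \<eta>)" "h \<ge> 0 \<Longrightarrow> sets (S h \<eta>) = sets config_space"
  using measurable_space[OF kernel, of h \<eta>] by (auto simp: space_prob_algebra)

text \<open>Integrating the Markov property over \<open>P\<close> removes the conditioning on the
  past; what remains is that one-time laws evolve by the kernels. The Markov property enters the
  argument through this identity.\<close>

lemma marginal_add:
  assumes "s \<ge> 0" "h \<ge> 0"
  shows "marginal (s + h) = marginal s \<bind> S h"
proof (rule measure_eqI)
  interpret M: prob_space "marginal s" by (rule prob_space_marginal) fact
  have sets_bind: "sets (marginal s \<bind> S h) = sets config_space"
    by (rule sets_bind) (use kernel_prob(2) assms in auto)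
  then show "sets (marginal (s + h)) = sets (marginal s \<bind> S h)" by simp
  interpret B: prob_space "marginal s \<bind> S h"
    using kernel_prob(1)[OF assms(2)] kernel_subprob[OF assms(2)]
    by (intro M.prob_space_bind) auto
  interpret M': prob_space "marginal (s + h)" by (rule prob_space_marginal) (use assms in simp)
  fix A assume "A \<in> sets (marginal (s + h))"
  then have A: "A \<in> sets config_space" by simp
  interpret sf: sigma_finite_subalgebra P "past s"
    using past_subalgebra[OF assms(1) sets_P] finite_measure_axioms
    by (intro finite_measure_subalgebra_is_sigma_finite finite_measure_subalgebra.intro
        finite_measure_subalgebra_axioms.intro)
  have iA: "integrable P (\<lambda>\<omega>. indicat_real A (\<omega> (s + h)))"
    using measurable_compose[OF measurable_eval[of "s + h"] borel_measurable_indicator[OF A]] assms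
    by (intro integrable_const_bound[where B = 1]) auto
  have mS: "(\<lambda>\<eta>. measure (S h \<eta>) A) \<in> borel_measurable config_space"
    by (rule measurable_compose[where N = "subprob_algebra config_space"])
      (use measurable_prob_algebraD[OF kernel[OF assms(2)]] measurable_measure_subprob_algebra[OF A] in auto)
  have "measure (marginal (s + h)) A = (\<integral>\<omega>. indicator A (\<omega> (s + h)) \<partial>P)"
  proof -
    have "measure (marginal (s + h)) A = (\<integral>\<eta>. indicator A \<eta> \<partial>marginal (s + h))"
      using A by simp
    also have "\<dots> = (\<integral>\<omega>. indicator A (\<omega> (s + h)) \<partial>P)"
      unfolding marginal_def using A measurable_eval[of "s + h"] assms
      by (intro integral_distr) auto
    finally show ?thesis .
  qed
  also have "\<dots> = (\<integral>\<omega>. real_cond_exp P (past s) (\<lambda>\<omega>. indicator A (\<omega> (s + h))) \<omega> \<partial>P)"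
    using sf.real_cond_exp_int(2)[OF iA] by simp
  also have "\<dots> = (\<integral>\<omega>. measure (S h (\<omega> s)) A \<partial>P)"
    using law A assms measurable_compose[OF measurable_eval[OF assms(1)] mS]
    unfolding markov_law_def by (intro integral_cong_AE) auto
  also have "\<dots> = (\<integral>\<eta>. measure (S h \<eta>) A \<partial>marginal s)"
    unfolding marginal_def using mS measurable_eval[OF assms(1)] by (subst integral_distr) auto
  also have "\<dots> = measure (marginal s \<bind> S h) A"
    using M.measure_bind[OF kernel_subprob[OF assms(2)] A] by simp
  finally show "emeasure (marginal (s + h)) A = emeasure (marginal s \<bind> S h) A"
    by (simp add: M'.emeasure_eq_measure B.emeasure_eq_measure)
qed

definition mean :: "(config \<Rightarrow> real) \<Rightarrow> real \<Rightarrow> real" where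
  "mean f s = (LINT \<eta>|marginal s. f \<eta>)"

lemma mean_eq: "s \<ge> 0 \<Longrightarrow> cylinder f \<Longrightarrow> mean f s = (\<integral>\<omega>. f (\<omega> s) \<partial>P)"
  unfolding mean_def marginal_def using measurable_eval cylinder_measurable
  by (subst integral_distr) auto

lemma integrable_cylinder:
  assumes "s \<ge> 0" "cylinder f"
  shows "integrable (marginal s) f"
proof -
  interpret M: prob_space "marginal s" by (rule prob_space_marginal) fact
  obtain C where "C \<ge> 0" "\<And>\<eta>. \<bar>f \<eta>\<bar> \<le> C" using cylinder_bounded[OF assms(2)] by auto
  then show ?thesis
    using cylinder_measurable[OF assms(2)]
    by (intro M.integrable_const_bound[where B = C]) (auto cong: measurable_cong_sets)
qed

lemma mean_increment:
  assumes "s \<ge> 0" "h \<ge> 0" "cylinder f"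
  shows "mean f (s + h) - mean f s = (LINT \<eta>|marginal s. (LINT \<zeta>|S h \<eta>. f \<zeta>) - f \<eta>)"
    and "integrable (marginal s) (\<lambda>\<eta>. LINT \<zeta>|S h \<eta>. f \<zeta>)"
proof -
  interpret M: prob_space "marginal s" by (rule prob_space_marginal) fact
  obtain C where C: "C \<ge> 0" "\<And>\<eta>. \<bar>f \<eta>\<bar> \<le> C" using cylinder_bounded[OF assms(3)] by auto
  note mf = cylinder_measurable[OF assms(3)]
  have m: "(\<lambda>\<eta>. LINT \<zeta>|S h \<eta>. f \<zeta>) \<in> borel_measurable (marginal s)"
    using measurable_compose[OF kernel_subprob[OF assms(2)] integral_measurable_subprob_algebra[OF mf]] .
  have bd: "\<bar>LINT \<zeta>|S h \<eta>. f \<zeta>\<bar> \<le> C" for \<eta>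
  proof -
    interpret K: prob_space "S h \<eta>" by (rule kernel_prob) fact
    have "\<bar>LINT \<zeta>|S h \<eta>. f \<zeta>\<bar> \<le> (LINT \<zeta>|S h \<eta>. \<bar>f \<zeta>\<bar>)" by (rule integral_abs_bound)
    also have "\<dots> \<le> (LINT \<zeta>|S h \<eta>. C)"
      using C mf kernel_prob(2)[OF assms(2), of \<eta>]
      by (intro integral_mono K.integrable_const_bound[where B = C]) (auto cong: measurable_cong_sets)
    finally show ?thesis by (simp add: K.prob_space)
  qed
  show i: "integrable (marginal s) (\<lambda>\<eta>. LINT \<zeta>|S h \<eta>. f \<zeta>)"
    using bd m by (intro M.integrable_const_bound[where B = C]) auto
  have "mean f (s + h) = (LINT \<eta>|marginal s. (LINT \<zeta>|S h \<eta>. f \<zeta>))"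
    unfolding mean_def marginal_add[OF assms(1,2)]
    by (rule integral_bind[where K = config_space and B = C and B' = 1])
      (use mf kernel_subprob[OF assms(2)] C kernel_prob(1)[OF assms(2)] in
        \<open>auto simp: prob_space.emeasure_space_1 M.finite_measure_axioms\<close>)
  then show "mean f (s + h) - mean f s = (LINT \<eta>|marginal s. (LINT \<zeta>|S h \<eta>. f \<zeta>) - f \<eta>)"
    using i integrable_cylinder[OF assms(1,3)] by (simp add: mean_def)
qed

lemma mean_abs_bound:
  fixes k :: "config \<Rightarrow> real"
  assumes "s \<ge> 0" "\<And>\<eta>. \<bar>k \<eta>\<bar> \<le> C" "integrable (marginal s) k"
  shows "\<bar>LINT \<eta>|marginal s. k \<eta>\<bar> \<le> C"
proof -
  interpret M: prob_space "marginal s" by (rule prob_space_marginal) fact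
  have "\<bar>LINT \<eta>|marginal s. k \<eta>\<bar> \<le> (LINT \<eta>|marginal s. \<bar>k \<eta>\<bar>)" by (rule integral_abs_bound)
  also have "\<dots> \<le> (LINT \<eta>|marginal s. C)" using assms by (intro integral_mono) auto
  finally show ?thesis by (simp add: M.prob_space[simplified])
qed

text \<open>The difference quotients defining the generator converge uniformly over configurations,
  so they may be integrated against the law at time \<open>s\<close>, whatever it is. Only
  increments \<open>h > 0\<close> are available, hence the derivative from the right.\<close>

lemma mean_right_derivative:
  assumes "s \<ge> 0" "cylinder f" "cylinder (exclusion_generator \<xi> N f)"
  shows "(mean f has_real_derivative mean (exclusion_generator \<xi> N f) s) (at_right s)"
proof -
  let ?L = "exclusion_generator \<xi> N f"
  have ul: "uniform_limit UNIV (\<lambda>h \<eta>. ((LINT \<zeta>|S h \<eta>. f \<zeta>) - f \<eta>) / h) ?L (at_right 0)"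
    using generator assms(2) unfolding generator_on_cylinders_def by auto
  have "((\<lambda>h. (mean f (s + h) - mean f s) / h) \<longlongrightarrow> mean ?L s) (at_right 0)"
  proof (rule tendstoI)
    fix e :: real assume "e > 0"
    then have "\<forall>\<^sub>F h in at_right 0. \<forall>\<eta>\<in>UNIV. dist (((LINT \<zeta>|S h \<eta>. f \<zeta>) - f \<eta>) / h) (?L \<eta>) < e/2"
      using ul unfolding uniform_limit_iff by (meson half_gt_zero)
    moreover have "\<forall>\<^sub>F h in at_right 0. h > (0::real)" by (rule eventually_at_right_less)
    ultimately show "\<forall>\<^sub>F h in at_right 0. dist ((mean f (s + h) - mean f s) / h) (mean ?L s) < e"
    proof eventually_elim
      case (elim h)
      let ?k = "\<lambda>\<eta>. ((LINT \<zeta>|S h \<eta>. f \<zeta>) - f \<eta>) / h - ?L \<eta>"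
      have i: "integrable (marginal s) (\<lambda>\<eta>. LINT \<zeta>|S h \<eta>. f \<zeta>)" "integrable (marginal s) f"
        "integrable (marginal s) ?L"
        using mean_increment(2)[OF assms(1) _ assms(2)] elim(2) integrable_cylinder assms by auto
      have "(mean f (s + h) - mean f s) / h - mean ?L s = (LINT \<eta>|marginal s. ?k \<eta>)"
        using i elim(2) mean_increment(1)[OF assms(1) _ assms(2), of h] by (simp add: mean_def)
      moreover have "\<bar>LINT \<eta>|marginal s. ?k \<eta>\<bar> \<le> e / 2"
        using elim(1) i by (intro mean_abs_bound[OF assms(1)]) (auto simp: dist_real_def less_imp_le)
      ultimately show ?case using \<open>e > 0\<close> by (simp add: dist_real_def)
    qed
  qed
  then show ?thesis
    unfolding has_field_derivative_iff filterlim_at_right_to_0[of _ _ s] by (simp add: add.commute)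
qed

text \<open>A right derivative gives no continuity from the left. Uniformity gives more: one
  threshold \<open>b\<close> and one Lipschitz constant \<open>C + 1\<close> serve all starting
  times, so an increment to the left of \<open>s\<close> is read as an increment to the right of an
  earlier time.\<close>

lemma mean_continuous:
  assumes "cylinder f" "cylinder (exclusion_generator \<xi> N f)"
  shows "continuous_on {0..} (mean f)"
proof -
  let ?L = "exclusion_generator \<xi> N f"
  have ul: "uniform_limit UNIV (\<lambda>h \<eta>. ((LINT \<zeta>|S h \<eta>. f \<zeta>) - f \<eta>) / h) ?L (at_right 0)"
    using generator assms(1) unfolding generator_on_cylinders_def by auto
  obtain C where C: "C \<ge> 0" "\<And>\<eta>. \<bar>?L \<eta>\<bar> \<le> C" using cylinder_bounded[OF assms(2)] by auto
  have "\<forall>\<^sub>F h in at_right 0. \<forall>\<eta>\<in>UNIV. dist (((LINT \<zeta>|S h \<eta>. f \<zeta>) - f \<eta>) / h) (?L \<eta>) < 1"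
    using ul unfolding uniform_limit_iff by (meson zero_less_one)
  then obtain b where b: "b > 0" "\<And>h \<eta>. 0 < h \<Longrightarrow> h < b \<Longrightarrow>
      \<bar>((LINT \<zeta>|S h \<eta>. f \<zeta>) - f \<eta>) / h - ?L \<eta>\<bar> < 1"
    unfolding eventually_at_right_field dist_real_def by auto
  have inc: "\<bar>mean f (s + h) - mean f s\<bar> \<le> (C + 1) * h" if "s \<ge> 0" "0 < h" "h < b" for s h
  proof -
    have "\<bar>(LINT \<zeta>|S h \<eta>. f \<zeta>) - f \<eta>\<bar> \<le> (C + 1) * h" for \<eta>
    proof -
      have "\<bar>((LINT \<zeta>|S h \<eta>. f \<zeta>) - f \<eta>) / h\<bar> \<le> C + 1"
        using b(2)[OF that(2,3), of \<eta>] C(2)[of \<eta>] by linarith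
      then show ?thesis using that(2) by (simp add: abs_divide pos_divide_le_eq)
    qed
    then show ?thesis
      unfolding mean_increment(1)[OF that(1) less_imp_le[OF that(2)] assms(1)]
      using mean_increment(2)[OF that(1) less_imp_le[OF that(2)] assms(1)]
        integrable_cylinder[OF that(1) assms(1)] that(1)
      by (intro mean_abs_bound) auto
  qed
  have inc': "\<bar>mean f r - mean f s\<bar> \<le> (C + 1) * \<bar>r - s\<bar>" if "s \<ge> 0" "r \<ge> 0" "\<bar>r - s\<bar> < b" for r s
  proof (cases r s rule: linorder_cases)
    case less then show ?thesis using inc[of r "s - r"] that by (simp add: abs_minus_commute)
  next
    case greater then show ?thesis using inc[of s "r - s"] that by simp
  qed simp
  show ?thesis unfolding continuous_on_iff
  proof (intro ballI allI impI)
    fix s e :: real assume "s \<in> {0..}" "e > 0"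
    have "\<bar>mean f r - mean f s\<bar> < e" if r: "r \<ge> 0" "\<bar>r - s\<bar> < min b (e / (C + 2))" for r
    proof -
      have "\<bar>mean f r - mean f s\<bar> \<le> (C + 1) * \<bar>r - s\<bar>"
        using r \<open>s \<in> {0..}\<close> by (intro inc') auto
      also have "\<dots> \<le> (C + 2) * \<bar>r - s\<bar>" by (intro mult_right_mono) auto
      also have "\<dots> < e" using r C(1) by (simp add: pos_less_divide_eq mult.commute)
      finally show ?thesis .
    qed
    moreover have "min b (e / (C + 2)) > 0" using b(1) C(1) \<open>e > 0\<close> by simp
    ultimately show "\<exists>d>0. \<forall>r\<in>{0..}. dist r s < d \<longrightarrow> dist (mean f r) (mean f s) < e"
      unfolding dist_real_def by (intro exI[of _ "min b (e / (C + 2))"]) auto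
  qed
qed

end


section \<open>The energy estimate\<close>

text \<open>A mean value inequality for right derivatives. The largest point of the closed set
  \<open>T\<close>, where \<open>\<phi>\<close> lies below the line of slope
  \<open>\<kappa> + e\<close> through its initial value, must be \<open>b\<close>: at an earlier
  point the right derivative, being less than \<open>\<kappa> + e\<close>, would put further points
  into \<open>T\<close>. Then \<open>e\<close> tends to 0.\<close>

lemma right_derivative_bound:
  fixes \<phi> :: "real \<Rightarrow> real"
  assumes "a \<le> b" and cont: "continuous_on {a..b} \<phi>"
    and der: "\<And>s. a \<le> s \<Longrightarrow> s < b \<Longrightarrow> \<exists>D\<le>\<kappa>. (\<phi> has_real_derivative D) (at_right s)"
  shows "\<phi> b - \<phi> a \<le> \<kappa> * (b - a)"
proof (cases "a = b")
  case False
  then have ab: "a < b" using assms(1) by simp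
  have bound: "\<phi> b - \<phi> a \<le> (\<kappa> + e) * (b - a)" if e: "e > 0" for e
  proof -
    define T where "T = {s \<in> {a..b}. \<phi> s \<le> \<phi> a + (\<kappa> + e) * (s - a)}"
    have "closed T"
      unfolding T_def by (intro continuous_on_closed_Collect_le cont continuous_intros closed_real_atLeastAtMost)
    then have "compact T"
      unfolding T_def by (metis (no_types, lifting) bounded_closed_interval bounded_subset
          compact_eq_bounded_closed mem_Collect_eq subsetI)
    moreover have "a \<in> T" using ab by (simp add: T_def)
    ultimately obtain c where c: "c \<in> T" "\<And>s. s \<in> T \<Longrightarrow> s \<le> c"
      using compact_attains_sup[of T] by blast
    have "c = b"
    proof (rule ccontr)
      assume "c \<noteq> b"
      then have "a \<le> c" "c < b" using c(1) by (auto simp: T_def)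
      then obtain D where D: "D \<le> \<kappa>" "(\<phi> has_real_derivative D) (at_right c)"
        using der by blast
      then have "((\<lambda>s. (\<phi> s - \<phi> c) / (s - c)) \<longlongrightarrow> D) (at_right c)"
        by (simp add: has_field_derivative_iff)
      then have "\<forall>\<^sub>F s in at_right c. (\<phi> s - \<phi> c) / (s - c) < \<kappa> + e"
        using D(1) e by (intro order_tendstoD(2)) auto
      moreover have "\<forall>\<^sub>F s in at_right c. s \<in> {c<..<b}"
        using \<open>c < b\<close> by (rule eventually_at_right_real)
      ultimately have "\<forall>\<^sub>F s in at_right c. s \<in> T \<and> c < s"
      proof eventually_elim
        case (elim s)
        then have "\<phi> s - \<phi> c < (\<kappa> + e) * (s - c)"
          by (simp add: pos_divide_less_eq)
        moreover have "\<phi> c \<le> \<phi> a + (\<kappa> + e) * (c - a)" using c(1) by (simp add: T_def)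
        ultimately have "\<phi> s \<le> \<phi> a + (\<kappa> + e) * (s - a)" by (simp add: algebra_simps)
        then show ?case using elim \<open>a \<le> c\<close> by (simp add: T_def)
      qed
      then obtain s where "s \<in> T" "c < s"
        using eventually_happens[of _ "at_right c"] by (auto simp: trivial_limit_at_right_real)
      then show False using c(2) by force
    qed
    then show ?thesis using c(1) by (simp add: T_def)
  qed
  show ?thesis
  proof (rule field_le_epsilon)
    fix e :: real assume "e > 0"
    then show "\<phi> b - \<phi> a \<le> \<kappa> * (b - a) + e"
      using bound[of "e / (b - a)"] ab by (simp add: distrib_right)
  qed
qed simp

text \<open>The finite window makes this a cylinder function for every \<open>g\<close>; if
  \<open>g\<close> vanishes outside the window it is the full lattice sum, and enlarging the window
  changes nothing.\<close>

definition linear_statistic :: "int \<Rightarrow> (int \<Rightarrow> real) \<Rightarrow> config \<Rightarrow> real" where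
  "linear_statistic m g \<eta> = (\<Sum>x\<in>{-m..m}. g x * of_bool (\<eta> x))"

text \<open>The generator of a single random walk with bond conductances \<open>\<xi>\<close>,
  speeded up by N^2; it gives the drift of a linear statistic, as if the particles did not
  interact.\<close>

definition disorder_laplacian :: "(int \<Rightarrow> real) \<Rightarrow> nat \<Rightarrow> (int \<Rightarrow> real) \<Rightarrow> int \<Rightarrow> real" where
  "disorder_laplacian \<xi> N g x =
     (real N)\<^sup>2 * (\<xi> x * (g (x + 1) - g x) - \<xi> (x - 1) * (g x - g (x - 1)))"

text \<open>The bonds from -m-1 to m are those touching the window. Since occupation numbers differ
  by at most 1, this deterministic quantity bounds the quadratic variation rate of the statistic of
  a \<open>g\<close> supported in the window, in every configuration.\<close>

definition dirichlet_form :: "(int \<Rightarrow> real) \<Rightarrow> nat \<Rightarrow> int \<Rightarrow> (int \<Rightarrow> real) \<Rightarrow> real" where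
  "dirichlet_form \<xi> N m g = (real N)\<^sup>2 * (\<Sum>x\<in>{-m-1..m}. \<xi> x * (g (x + 1) - g x)\<^sup>2)"

lemma cylinder_linear_statistic: "cylinder (linear_statistic m g)"
  unfolding linear_statistic_def by (intro cylinder_sum cylinder_times cylinder_const cylinder_site)

lemma linear_statistic_local:
  "(\<forall>x\<in>{-m..m}. \<eta> x = \<zeta> x) \<Longrightarrow> linear_statistic m g \<eta> = linear_statistic m g \<zeta>"
  unfolding linear_statistic_def by (intro sum.cong) auto

lemma linear_statistic_wider:
  assumes "\<And>x. x \<notin> {-m..m} \<Longrightarrow> g x = 0" "m \<le> n"
  shows "linear_statistic m g \<eta> = linear_statistic n g \<eta>"
  unfolding linear_statistic_def using assms by (intro sum.mono_neutral_left) auto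

lemma linear_statistic_add:
  "linear_statistic m (\<lambda>x. a * g x + b * h x) \<eta> = a * linear_statistic m g \<eta> + b * linear_statistic m h \<eta>"
  unfolding linear_statistic_def sum_distrib_left sum.distrib[symmetric]
  by (intro sum.cong) (auto simp: algebra_simps)

lemma linear_statistic_bound: "\<bar>linear_statistic m g \<eta>\<bar> \<le> (\<Sum>x\<in>{-m..m}. \<bar>g x\<bar>)"
  unfolding linear_statistic_def
  by (rule order_trans[OF sum_abs], intro sum_mono) (auto simp: abs_mult)

section \<open>The generator on linear statistics and their squares\<close>

lemma exclusion_generator_local:
  assumes "\<And>\<eta> \<zeta>. (\<forall>x\<in>{-m..m}. \<eta> x = \<zeta> x) \<Longrightarrow> f \<eta> = f \<zeta>"
  shows "exclusion_generator \<xi> N f \<eta> =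
    (real N)\<^sup>2 * (\<Sum>x\<in>{-m-1..m}. \<xi> x * (f (exchange x \<eta>) - f \<eta>))"
proof -
  have "f (exchange x \<eta>) = f \<eta>" if "x \<notin> {-m-1..m}" for x
    using that by (intro assms) (auto simp: exchange_def)
  then have "(\<Sum>\<^sub>\<infinity>x\<in>UNIV. \<xi> x * (f (exchange x \<eta>) - f \<eta>))
      = (\<Sum>\<^sub>\<infinity>x\<in>{-m-1..m}. \<xi> x * (f (exchange x \<eta>) - f \<eta>))"
    by (intro infsum_cong_neutral) auto
  then show ?thesis by (simp add: exclusion_generator_def)
qed

lemma cylinder_exclusion_generator:
  assumes "\<And>\<eta> \<zeta>. (\<forall>x\<in>{-m..m}. \<eta> x = \<zeta> x) \<Longrightarrow> f \<eta> = f \<zeta>"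
  shows "cylinder f" "cylinder (exclusion_generator \<xi> N f)"
proof -
  show c: "cylinder f" unfolding cylinder_def using assms by (intro exI[of _ "{-m..m}"]) auto
  have eq: "exclusion_generator \<xi> N f =
      (\<lambda>\<eta>. (real N)\<^sup>2 * (\<Sum>x\<in>{-m-1..m}. \<xi> x * (f (exchange x \<eta>) - f \<eta>)))"
    using assms by (intro ext exclusion_generator_local) blast
  show "cylinder (exclusion_generator \<xi> N f)"
    unfolding eq
    by (intro cylinder_times[OF cylinder_const] cylinder_sum cylinder_minus cylinder_exchange c)
qed

lemma linear_statistic_exchange:
  assumes "\<And>x. x \<notin> {-m..m} \<Longrightarrow> g x = 0" "x \<in> {-m-1..m}"
  shows "linear_statistic m g (exchange x \<eta>)
    = linear_statistic m g \<eta> + (g (x + 1) - g x) * (of_bool (\<eta> x) - of_bool (\<eta> (x + 1)))"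
proof -
  \<comment> \<open>The window is enlarged by one so that both ends of the bond lie in it even for x
    = -m-1 and x = m.\<close>
  have "linear_statistic (m + 1) g (exchange x \<eta>) - linear_statistic (m + 1) g \<eta>
     = (\<Sum>y\<in>{-(m+1)..m+1}. (if y = x then g x * (of_bool (\<eta> (x + 1)) - of_bool (\<eta> x)) else 0)
          + (if y = x + 1 then g (x + 1) * (of_bool (\<eta> x) - of_bool (\<eta> (x + 1))) else 0))"
    unfolding linear_statistic_def sum_subtractf[symmetric]
    by (intro sum.cong) (auto simp: exchange_def algebra_simps)
  also have "\<dots> = (g (x + 1) - g x) * (of_bool (\<eta> x) - of_bool (\<eta> (x + 1)))"
    unfolding sum.distrib using assms(2) by (subst (1 2) sum.delta) (auto simp: algebra_simps)
  finally show ?thesis using linear_statistic_wider[of m g "m + 1", OF assms(1)] by (simp only:) simp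
qed

text \<open>Summation by parts moves the difference from the occupation numbers to \<open>g\<close>,
  so the drift of a linear statistic is again a linear statistic. The window grows by one because
  the Laplacian of \<open>g\<close> may be nonzero one site beyond the support.\<close>

lemma sum_by_parts_sites:
  assumes "\<And>x. x \<notin> {-m..m} \<Longrightarrow> g x = 0"
  shows "(real N)\<^sup>2 * (\<Sum>x\<in>{-m-1..m}. \<xi> x * ((g (x + 1) - g x) * (of_bool (\<eta> x) - of_bool (\<eta> (x + 1)))))
    = linear_statistic (m + 1) (disorder_laplacian \<xi> N g) \<eta>"
proof -
  let ?c = "\<lambda>x. \<xi> x * (g (x + 1) - g x)" and ?e = "\<lambda>x. of_bool (\<eta> x) :: real"
  have "(\<Sum>x\<in>{-m-1..m}. \<xi> x * ((g (x + 1) - g x) * (?e x - ?e (x + 1))))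
      = (\<Sum>x\<in>{-m-1..m}. ?c x * ?e x) - (\<Sum>x\<in>{-m-1..m}. ?c x * ?e (x + 1))"
    unfolding sum_subtractf[symmetric] by (intro sum.cong) (auto simp: algebra_simps)
  also have "(\<Sum>x\<in>{-m-1..m}. ?c x * ?e (x + 1)) = (\<Sum>x\<in>{-m..m+1}. ?c (x - 1) * ?e x)"
    by (rule sum.reindex_bij_witness[where i = "\<lambda>x. x - 1" and j = "\<lambda>x. x + 1"]) auto
  also have "\<dots> = (\<Sum>x\<in>{-m-1..m+1}. ?c (x - 1) * ?e x)"
    by (rule sum.mono_neutral_left) (auto simp: assms)
  also have "(\<Sum>x\<in>{-m-1..m}. ?c x * ?e x) = (\<Sum>x\<in>{-m-1..m+1}. ?c x * ?e x)"
    by (rule sum.mono_neutral_left) (auto simp: assms)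
  also have "(\<Sum>x\<in>{-m-1..m+1}. ?c x * ?e x) - (\<Sum>x\<in>{-m-1..m+1}. ?c (x - 1) * ?e x)
      = (\<Sum>x\<in>{-(m+1)..m+1}. (?c x - ?c (x - 1)) * ?e x)"
    unfolding sum_subtractf[symmetric] by (rule sum.cong) (auto simp: algebra_simps)
  finally have "(\<Sum>x\<in>{-m-1..m}. \<xi> x * ((g (x + 1) - g x) * (?e x - ?e (x + 1))))
      = (\<Sum>x\<in>{-(m+1)..m+1}. (?c x - ?c (x - 1)) * ?e x)" .
  then show ?thesis
    unfolding linear_statistic_def disorder_laplacian_def
    by (simp only: sum_distrib_left mult.assoc diff_add_cancel)
qed

text \<open>An exchange shifts \<open>F\<close> by some d, and (a + d)^2 - a^2 = 2ad + d^2: the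
  first term sums to the drift, the second is at most the squared gradient because two occupation
  numbers differ by at most 1.\<close>

lemma generator_square:
  assumes "\<And>x. x \<notin> {-m..m} \<Longrightarrow> g x = 0" "\<And>x. \<xi> x > 0"
    and F: "\<And>\<eta>. F \<eta> = linear_statistic m g \<eta> - z"
  shows "(real N)\<^sup>2 * (\<Sum>x\<in>{-m-1..m}. \<xi> x * ((F (exchange x \<eta>))\<^sup>2 - (F \<eta>)\<^sup>2))
    \<le> 2 * F \<eta> * linear_statistic (m + 1) (disorder_laplacian \<xi> N g) \<eta> + dirichlet_form \<xi> N m g"
proof -
  let ?d = "\<lambda>x. (g (x + 1) - g x) * (of_bool (\<eta> x) - of_bool (\<eta> (x + 1)))"
  have "(\<Sum>x\<in>{-m-1..m}. \<xi> x * ((F (exchange x \<eta>))\<^sup>2 - (F \<eta>)\<^sup>2))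
      = (\<Sum>x\<in>{-m-1..m}. 2 * F \<eta> * (\<xi> x * ?d x) + \<xi> x * (?d x)\<^sup>2)"
  proof (rule sum.cong)
    fix x assume "x \<in> {-m-1..m}"
    then have "F (exchange x \<eta>) = F \<eta> + ?d x"
      unfolding F using linear_statistic_exchange[of m g x \<eta>, OF assms(1)] by (simp only:) simp
    moreover have "\<xi> x * ((a + d)\<^sup>2 - a\<^sup>2) = 2 * a * (\<xi> x * d) + \<xi> x * d\<^sup>2" for a d :: real
      by (simp add: power2_eq_square algebra_simps)
    ultimately show "\<xi> x * ((F (exchange x \<eta>))\<^sup>2 - (F \<eta>)\<^sup>2) = 2 * F \<eta> * (\<xi> x * ?d x) + \<xi> x * (?d x)\<^sup>2"
      by presburger
  qed simp
  also have "\<dots> = 2 * F \<eta> * (\<Sum>x\<in>{-m-1..m}. \<xi> x * ?d x) + (\<Sum>x\<in>{-m-1..m}. \<xi> x * (?d x)\<^sup>2)"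
    by (simp only: sum.distrib sum_distrib_left)
  also have "(\<Sum>x\<in>{-m-1..m}. \<xi> x * (?d x)\<^sup>2) \<le> (\<Sum>x\<in>{-m-1..m}. \<xi> x * (g (x + 1) - g x)\<^sup>2)"
    using assms(2) by (intro sum_mono mult_left_mono) (auto simp: power_mult_distrib less_imp_le)
  finally have "(real N)\<^sup>2 * (\<Sum>x\<in>{-m-1..m}. \<xi> x * ((F (exchange x \<eta>))\<^sup>2 - (F \<eta>)\<^sup>2))
      \<le> (real N)\<^sup>2 * (2 * F \<eta> * (\<Sum>x\<in>{-m-1..m}. \<xi> x * ?d x)
            + (\<Sum>x\<in>{-m-1..m}. \<xi> x * (g (x + 1) - g x)\<^sup>2))"
    by (intro mult_left_mono) auto
  also have "\<dots> = 2 * F \<eta> * ((real N)\<^sup>2 * (\<Sum>x\<in>{-m-1..m}. \<xi> x * ?d x)) + dirichlet_form \<xi> N m g"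
    by (simp add: dirichlet_form_def algebra_simps)
  also have "(real N)\<^sup>2 * (\<Sum>x\<in>{-m-1..m}. \<xi> x * ?d x)
      = linear_statistic (m + 1) (disorder_laplacian \<xi> N g) \<eta>"
    using assms(1) by (rule sum_by_parts_sites)
  finally show ?thesis .
qed

lemma disorder_laplacian_add:
  "disorder_laplacian \<xi> N (\<lambda>x. a * g x + b * h x) x
    = a * disorder_laplacian \<xi> N g x + b * disorder_laplacian \<xi> N h x"
  by (simp add: disorder_laplacian_def algebra_simps)

text \<open>Convexity of the square, bond by bond. It carries bounds at both ends of a time step
  over to the interpolated test function.\<close>

lemma dirichlet_form_convex:
  assumes "\<And>x. \<xi> x > 0" "0 \<le> u" "u \<le> 1" "dirichlet_form \<xi> N m g \<le> \<kappa>" "dirichlet_form \<xi> N m h \<le> \<kappa>"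
  shows "dirichlet_form \<xi> N m (\<lambda>x. (1 - u) * g x + u * h x) \<le> \<kappa>"
proof -
  have sq: "((1 - u) * a + u * b)\<^sup>2 \<le> (1 - u) * a\<^sup>2 + u * b\<^sup>2" for a b :: real
  proof -
    have "(1 - u) * a\<^sup>2 + u * b\<^sup>2 - ((1 - u) * a + u * b)\<^sup>2 = u * (1 - u) * (a - b)\<^sup>2"
      by (simp add: power2_eq_square algebra_simps)
    moreover have "u * (1 - u) * (a - b)\<^sup>2 \<ge> 0" using assms(2,3) by simp
    ultimately show ?thesis by linarith
  qed
  have "dirichlet_form \<xi> N m (\<lambda>x. (1 - u) * g x + u * h x)
      \<le> (real N)\<^sup>2 * (\<Sum>x\<in>{-m-1..m}. \<xi> x * ((1 - u) * (g (x + 1) - g x)\<^sup>2 + u * (h (x + 1) - h x)\<^sup>2))"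
    unfolding dirichlet_form_def
  proof (intro mult_left_mono sum_mono)
    fix x
    have "((1 - u) * g (x + 1) + u * h (x + 1) - ((1 - u) * g x + u * h x))\<^sup>2
       = ((1 - u) * (g (x + 1) - g x) + u * (h (x + 1) - h x))\<^sup>2" by (simp add: algebra_simps)
    then show "((1 - u) * g (x + 1) + u * h (x + 1) - ((1 - u) * g x + u * h x))\<^sup>2
       \<le> (1 - u) * (g (x + 1) - g x)\<^sup>2 + u * (h (x + 1) - h x)\<^sup>2" using sq by presburger
  qed (use assms(1) in \<open>auto simp: less_imp_le\<close>)
  also have "\<dots> = (1 - u) * dirichlet_form \<xi> N m g + u * dirichlet_form \<xi> N m h"
    unfolding dirichlet_form_def sum_distrib_left
    by (simp add: algebra_simps sum.distrib sum_subtractf)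
  also have "\<dots> \<le> (1 - u) * \<kappa> + u * \<kappa>"
    using assms by (intro add_mono mult_left_mono) auto
  finally show ?thesis by (simp add: algebra_simps)
qed

context exclusion_process
begin

text \<open>The test function is interpolated linearly in time, so that the squared statistic is a
  polynomial in time whose coefficients are three fixed cylinder functions.\<close>

lemma energy_step:
  assumes \<xi>: "\<And>x. \<xi> x > 0" and s: "s \<ge> 0" and \<tau>: "\<tau> > 0"
    and supp: "\<And>x. x \<notin> {-m..m} \<Longrightarrow> g0 x = 0" "\<And>x. x \<notin> {-m..m} \<Longrightarrow> g1 x = 0"
    and e0: "(\<Sum>x\<in>{-m-1..m+1}. \<bar>(g1 x - g0 x) / \<tau> + disorder_laplacian \<xi> N g0 x\<bar>) \<le> e"
    and e1: "(\<Sum>x\<in>{-m-1..m+1}. \<bar>(g1 x - g0 x) / \<tau> + disorder_laplacian \<xi> N g1 x\<bar>) \<le> e"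
    and \<kappa>: "dirichlet_form \<xi> N m g0 \<le> \<kappa>" "dirichlet_form \<xi> N m g1 \<le> \<kappa>"
  shows "mean (\<lambda>\<eta>. (linear_statistic m g1 \<eta> - z)\<^sup>2) (s + \<tau>)
    \<le> exp \<tau> * (mean (\<lambda>\<eta>. (linear_statistic m g0 \<eta> - z)\<^sup>2) s + \<tau> * (e\<^sup>2 + \<kappa>))"
proof -
  define v where "v x = (g1 x - g0 x) / \<tau>" for x
  define Z where "Z \<eta> = linear_statistic m g0 \<eta> - z" for \<eta>
  define V where "V = linear_statistic m v"
  define A where "A \<eta> = (Z \<eta>)\<^sup>2" for \<eta>
  define B where "B \<eta> = Z \<eta> * V \<eta>" for \<eta>
  define C where "C \<eta> = (V \<eta>)\<^sup>2" for \<eta>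
  define \<phi> where "\<phi> \<theta> = mean A (s + \<theta>) + 2 * \<theta> * mean B (s + \<theta>) + \<theta>\<^sup>2 * mean C (s + \<theta>)" for \<theta>
  let ?L = "exclusion_generator \<xi> N"
  have loc: "A \<eta> = A \<zeta>" "B \<eta> = B \<zeta>" "C \<eta> = C \<zeta>" if "\<forall>x\<in>{-m..m}. \<eta> x = \<zeta> x" for \<eta> \<zeta>
    using linear_statistic_local[OF that] by (simp_all add: A_def B_def C_def Z_def V_def)
  have cyl: "cylinder A" "cylinder B" "cylinder C"
    "cylinder (?L A)" "cylinder (?L B)" "cylinder (?L C)"
    using cylinder_exclusion_generator[of m A] cylinder_exclusion_generator[of m B]
      cylinder_exclusion_generator[of m C] loc by blast+
  have \<phi>_mean: "\<phi> \<theta> = mean (\<lambda>\<eta>. (Z \<eta> + \<theta> * V \<eta>)\<^sup>2) (s + \<theta>)" if "\<theta> \<ge> 0" for \<theta>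
  proof -
    have i: "integrable (marginal (s + \<theta>)) A" "integrable (marginal (s + \<theta>)) B"
      "integrable (marginal (s + \<theta>)) C"
      using cyl s that by (auto intro!: integrable_cylinder)
    have "(Z \<eta> + \<theta> * V \<eta>)\<^sup>2 = A \<eta> + 2 * \<theta> * B \<eta> + \<theta>\<^sup>2 * C \<eta>" for \<eta>
      by (simp add: A_def B_def C_def power2_eq_square algebra_simps)
    then show ?thesis using i by (simp add: \<phi>_def mean_def)
  qed
  have cont: "continuous_on {0..\<tau>} \<phi>"
  proof -
    have "continuous_on {0..\<tau>} (\<lambda>\<theta>. mean f (s + \<theta>))" if "cylinder f" "cylinder (?L f)" for f
      using s by (intro continuous_on_compose2[OF mean_continuous[OF that]] continuous_intros) auto
    then show ?thesis unfolding \<phi>_def using cyl by (intro continuous_intros) auto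
  qed
  define D where "D \<theta> = mean (?L A) (s + \<theta>) + (2 * mean B (s + \<theta>) + 2 * \<theta> * mean (?L B) (s + \<theta>))
      + (2 * \<theta> * mean C (s + \<theta>) + \<theta>\<^sup>2 * mean (?L C) (s + \<theta>))" for \<theta>
  have der: "(\<phi> has_real_derivative D \<theta>) (at_right \<theta>)" if "\<theta> \<ge> 0" for \<theta>
  proof -
    have d: "((\<lambda>\<theta>. mean f (s + \<theta>)) has_real_derivative mean (?L f) (s + \<theta>)) (at_right \<theta>)"
      if "cylinder f" "cylinder (?L f)" for f
    proof -
      have "(mean f has_real_derivative mean (?L f) (s + \<theta>)) (at (s + \<theta>) within (+) s ` {\<theta><..})"
      proof -
        have "(+) s ` {\<theta><..} = {s + \<theta><..}" by (auto intro!: image_eqI[where x = "_ - s"])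
        then show ?thesis using mean_right_derivative[OF _ that, of "s + \<theta>"] s \<open>\<theta> \<ge> 0\<close> by simp
      qed
      moreover have "((+) s has_real_derivative 1) (at_right \<theta>)"
        by (auto intro!: derivative_eq_intros)
      ultimately show ?thesis using DERIV_image_chain[of "mean f" _ "(+) s" \<theta> "{\<theta><..}" 1]
        by (simp add: o_def)
    qed
    show ?thesis unfolding \<phi>_def D_def
      by (rule derivative_eq_intros d cyl refl | simp)+
  qed
  \<comment> \<open>The drift of the square is 2F(V + w), with V the velocity of the test function
    and w the statistic of its disorder Laplacian. V + w is the residual of the backward equation,
    at most \<open>e\<close>; 2ab \<le> a^2 + b^2 trades the product against \<open>\<phi>\<close>
    itself, in the form needed for Gronwall.\<close>
  have D_le: "D \<theta> \<le> \<phi> \<theta> + (e\<^sup>2 + \<kappa>)" if \<theta>: "\<theta> \<ge> 0" "\<theta> \<le> \<tau>" for \<theta>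
  proof -
    define u where "u = \<theta> / \<tau>"
    have u: "0 \<le> u" "u \<le> 1" using \<theta> \<tau> by (auto simp: u_def)
    define g where "g x = (1 - u) * g0 x + u * g1 x" for x
    have g_alt: "g = (\<lambda>x. 1 * g0 x + \<theta> * v x)"
      using \<tau> by (auto simp: g_def u_def v_def field_simps)
    have F: "Z \<eta> + \<theta> * V \<eta> = linear_statistic m g \<eta> - z" for \<eta>
      unfolding g_alt linear_statistic_add by (simp add: Z_def V_def)
    have supp_g: "g x = 0" "v x = 0" if "x \<notin> {-m..m}" for x
      using supp that by (auto simp: g_def v_def)
    have pointwise: "?L A \<eta> + (2 * B \<eta> + 2 * \<theta> * ?L B \<eta>) + (2 * \<theta> * C \<eta> + \<theta>\<^sup>2 * ?L C \<eta>)
        \<le> (Z \<eta> + \<theta> * V \<eta>)\<^sup>2 + (e\<^sup>2 + \<kappa>)" for \<eta>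
    proof -
      let ?F = "\<lambda>\<eta>. Z \<eta> + \<theta> * V \<eta>"
      let ?w = "linear_statistic (m + 1) (disorder_laplacian \<xi> N g) \<eta>"
      have L: "?L A \<eta> = (real N)\<^sup>2 * (\<Sum>x\<in>{-m-1..m}. \<xi> x * (A (exchange x \<eta>) - A \<eta>))"
        "?L B \<eta> = (real N)\<^sup>2 * (\<Sum>x\<in>{-m-1..m}. \<xi> x * (B (exchange x \<eta>) - B \<eta>))"
        "?L C \<eta> = (real N)\<^sup>2 * (\<Sum>x\<in>{-m-1..m}. \<xi> x * (C (exchange x \<eta>) - C \<eta>))"
        using loc by (auto intro!: exclusion_generator_local)
      have "?L A \<eta> + 2 * \<theta> * ?L B \<eta> + \<theta>\<^sup>2 * ?L C \<eta>
        = (real N)\<^sup>2 * (\<Sum>x\<in>{-m-1..m}. \<xi> x * ((?F (exchange x \<eta>))\<^sup>2 - (?F \<eta>)\<^sup>2))"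
        unfolding L by (simp add: A_def B_def C_def sum_distrib_left sum.distrib[symmetric] power2_eq_square
            algebra_simps)
      also have "\<dots> \<le> 2 * ?F \<eta> * ?w + dirichlet_form \<xi> N m g"
        using supp_g(1) \<xi> F by (rule generator_square)
      also have "dirichlet_form \<xi> N m g \<le> \<kappa>"
        unfolding g_def using \<xi> u \<kappa> by (rule dirichlet_form_convex)
      finally have 1: "?L A \<eta> + 2 * \<theta> * ?L B \<eta> + \<theta>\<^sup>2 * ?L C \<eta> \<le> 2 * ?F \<eta> * ?w + \<kappa>" by simp
      have "V \<eta> + ?w = linear_statistic (m + 1) (\<lambda>x. 1 * v x + 1 * disorder_laplacian \<xi> N g x) \<eta>"
        unfolding linear_statistic_add V_def
        using linear_statistic_wider[of m v "m + 1"] supp_g(2) by simp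
      then have "\<bar>V \<eta> + ?w\<bar> \<le> (\<Sum>x\<in>{-m-1..m+1}. \<bar>v x + disorder_laplacian \<xi> N g x\<bar>)"
        using linear_statistic_bound[of "m + 1"] by simp
      \<comment> \<open>For fixed velocity the residual is affine in the test function, so along the
        interpolation it is a convex combination of the residuals at \<open>g0\<close> and
        \<open>g1\<close>.\<close>
      also have "\<dots> \<le> (\<Sum>x\<in>{-m-1..m+1}. (1 - u) * \<bar>v x + disorder_laplacian \<xi> N g0 x\<bar>
           + u * \<bar>v x + disorder_laplacian \<xi> N g1 x\<bar>)"
      proof (rule sum_mono)
        fix x
        have "v x + disorder_laplacian \<xi> N g x = (1 - u) * (v x + disorder_laplacian \<xi> N g0 x)
            + u * (v x + disorder_laplacian \<xi> N g1 x)"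
          unfolding g_def disorder_laplacian_add by (simp add: algebra_simps)
        then show "\<bar>v x + disorder_laplacian \<xi> N g x\<bar>
            \<le> (1 - u) * \<bar>v x + disorder_laplacian \<xi> N g0 x\<bar> + u * \<bar>v x + disorder_laplacian \<xi> N g1 x\<bar>"
          using u abs_triangle_ineq[of "(1 - u) * (v x + disorder_laplacian \<xi> N g0 x)"
              "u * (v x + disorder_laplacian \<xi> N g1 x)"] by (simp add: abs_mult)
      qed
      also have "\<dots> = (1 - u) * (\<Sum>x\<in>{-m-1..m+1}. \<bar>v x + disorder_laplacian \<xi> N g0 x\<bar>)
          + u * (\<Sum>x\<in>{-m-1..m+1}. \<bar>v x + disorder_laplacian \<xi> N g1 x\<bar>)"
        by (simp only: sum.distrib sum_distrib_left)
      also have "\<dots> \<le> (1 - u) * e + u * e"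
        using u e0 e1 by (intro add_mono mult_left_mono) (auto simp: v_def)
      finally have "\<bar>V \<eta> + ?w\<bar> \<le> e" by (simp add: algebra_simps)
      then have "(V \<eta> + ?w)\<^sup>2 \<le> e\<^sup>2" by (simp add: abs_le_square_iff[symmetric])
      moreover have "2 * ?F \<eta> * (V \<eta> + ?w) \<le> (?F \<eta>)\<^sup>2 + (V \<eta> + ?w)\<^sup>2" by (rule sum_squares_bound)
      moreover have "2 * B \<eta> + 2 * \<theta> * C \<eta> = 2 * ?F \<eta> * V \<eta>"
        by (simp add: B_def C_def power2_eq_square algebra_simps)
      ultimately show ?thesis using 1 by (simp add: algebra_simps)
    qed
    interpret M: prob_space "marginal (s + \<theta>)"
      using s \<theta> by (intro prob_space_marginal) simp
    have i: "integrable (marginal (s + \<theta>)) f" if "cylinder f" for f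
      using that s \<theta> by (intro integrable_cylinder) auto
    have cF: "cylinder (\<lambda>\<eta>. (Z \<eta> + \<theta> * V \<eta>)\<^sup>2)"
      unfolding F power2_eq_square
      by (intro cylinder_times cylinder_minus cylinder_linear_statistic cylinder_const)
    have "D \<theta> = (LINT \<eta>|marginal (s + \<theta>).
        ?L A \<eta> + (2 * B \<eta> + 2 * \<theta> * ?L B \<eta>) + (2 * \<theta> * C \<eta> + \<theta>\<^sup>2 * ?L C \<eta>))"
      unfolding D_def mean_def using cyl[THEN i] by simp
    also have "\<dots> \<le> (LINT \<eta>|marginal (s + \<theta>). (Z \<eta> + \<theta> * V \<eta>)\<^sup>2 + (e\<^sup>2 + \<kappa>))"
      using cyl[THEN i] i[OF cF] pointwise by (intro integral_mono) auto
    also have "\<dots> = \<phi> \<theta> + (e\<^sup>2 + \<kappa>)"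
      using i[OF cF] \<theta>(1) M.prob_space by (simp add: \<phi>_mean mean_def)
    finally show ?thesis .
  qed
  have "dirichlet_form \<xi> N m g0 \<ge> 0"
    unfolding dirichlet_form_def using \<xi>
    by (intro mult_nonneg_nonneg sum_nonneg) (auto simp: less_imp_le)
  then have "\<kappa> \<ge> 0" using \<kappa>(1) by simp
  \<comment> \<open>The integrating factor turns the differential inequality into a bounded right
    derivative.\<close>
  let ?\<psi> = "\<lambda>\<theta>. exp (-\<theta>) * \<phi> \<theta>"
  have "?\<psi> \<tau> - ?\<psi> 0 \<le> (e\<^sup>2 + \<kappa>) * (\<tau> - 0)"
  proof (rule right_derivative_bound)
    show "continuous_on {0..\<tau>} ?\<psi>" using cont by (intro continuous_intros)
    fix \<theta> assume \<theta>: "0 \<le> \<theta>" "\<theta> < \<tau>"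
    have "(?\<psi> has_real_derivative exp (-\<theta>) * (D \<theta> - \<phi> \<theta>)) (at_right \<theta>)"
      by (rule derivative_eq_intros der[OF \<theta>(1)] refl)+ (simp add: algebra_simps)
    moreover have "exp (-\<theta>) * (D \<theta> - \<phi> \<theta>) \<le> 1 * (e\<^sup>2 + \<kappa>)"
    proof (cases "D \<theta> - \<phi> \<theta> \<ge> 0")
      case True then show ?thesis using D_le[of \<theta>] \<theta> by (intro mult_mono) auto
    next
      case False
      then have "exp (-\<theta>) * (D \<theta> - \<phi> \<theta>) \<le> 0" by (intro mult_nonneg_nonpos) auto
      then show ?thesis using \<open>\<kappa> \<ge> 0\<close> by (smt (verit) zero_le_power2)
    qed
    ultimately show "\<exists>D\<le>e\<^sup>2 + \<kappa>. (?\<psi> has_real_derivative D) (at_right \<theta>)" by auto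
  qed (use \<tau> in simp)
  then have "\<phi> \<tau> \<le> exp \<tau> * (\<phi> 0 + \<tau> * (e\<^sup>2 + \<kappa>))"
    by (simp add: exp_minus field_simps)
  moreover have "(\<lambda>\<eta>. (Z \<eta> + \<tau> * V \<eta>)\<^sup>2) = (\<lambda>\<eta>. (linear_statistic m g1 \<eta> - z)\<^sup>2)"
  proof -
    have "g1 = (\<lambda>x. 1 * g0 x + \<tau> * v x)" using \<tau> by (auto simp: v_def)
    then have "linear_statistic m g1 \<eta> = linear_statistic m g0 \<eta> + \<tau> * linear_statistic m v \<eta>" for \<eta>
      using linear_statistic_add[of m 1 g0 \<tau> v \<eta>] by simp
    then show ?thesis by (simp add: Z_def V_def algebra_simps)
  qed
  moreover have "(\<lambda>\<eta>. (Z \<eta>)\<^sup>2) = (\<lambda>\<eta>. (linear_statistic m g0 \<eta> - z)\<^sup>2)"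
    by (simp add: Z_def)
  ultimately show ?thesis using \<phi>_mean[of \<tau>] \<phi>_mean[of 0] \<tau> by simp
qed

end


section \<open>Test functions corrected by the disorder\<close>

lemma derivative_lipschitz:
  fixes f :: "real \<Rightarrow> real"
  assumes "\<And>u. (f has_real_derivative f' u) (at u)" "\<And>u. \<bar>f' u\<bar> \<le> K"
  shows "\<bar>f v - f u\<bar> \<le> K * \<bar>v - u\<bar>"
  using field_differentiable_bound[of UNIV f f' K v u] assms
  by (simp add: has_field_derivative_at_within)

text \<open>The mean value bound is applied to \<open>f x - x * f' u\<close>, whose derivative is at
  most K |v - u| between u and v; this yields the constant K, half of which would be
  optimal.\<close>

lemma taylor_first_order:
  fixes f :: "real \<Rightarrow> real"
  assumes f: "\<And>u. (f has_real_derivative f' u) (at u)"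
    and f': "\<And>u. (f' has_real_derivative f'' u) (at u)" and K: "\<And>u. \<bar>f'' u\<bar> \<le> K"
  shows "\<bar>f v - f u - (v - u) * f' u\<bar> \<le> K * (v - u)\<^sup>2"
proof -
  have lip: "\<bar>f' x - f' u\<bar> \<le> K * \<bar>x - u\<bar>" for x
    using f' K by (rule derivative_lipschitz)
  have "\<bar>(f v - v * f' u) - (f u - u * f' u)\<bar> \<le> (K * \<bar>v - u\<bar>) * \<bar>v - u\<bar>"
  proof -
    have "K \<ge> 0" using K[of 0] by (meson abs_ge_zero order_trans)
    have "norm ((f v - v * f' u) - (f u - u * f' u)) \<le> (K * \<bar>v - u\<bar>) * norm (v - u)"
    proof (rule field_differentiable_bound[of "closed_segment u v"])
      fix x assume x: "x \<in> closed_segment u v"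
      show "((\<lambda>x. f x - x * f' u) has_field_derivative f' x - f' u) (at x within closed_segment u v)"
        by (rule derivative_eq_intros has_field_derivative_at_within[OF f] refl)+ simp
      have "\<bar>x - u\<bar> \<le> \<bar>v - u\<bar>"
        using x by (auto simp: closed_segment_eq_real_ivl split: if_splits)
      then show "norm (f' x - f' u) \<le> K * \<bar>v - u\<bar>"
        using lip[of x] \<open>K \<ge> 0\<close> by (smt (verit) mult_left_mono real_norm_def)
    qed auto
    then show ?thesis by simp
  qed
  then show ?thesis by (simp add: power2_eq_square algebra_simps)
qed

lemma summation_by_parts:
  fixes W p :: "nat \<Rightarrow> real"
  shows "(\<Sum>i<n. (W (Suc i) - W i) * p i)
    = W n * p n - W 0 * p 0 - (\<Sum>i<n. W (Suc i) * (p (Suc i) - p i))"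
  by (induction n) (auto simp: algebra_simps)

lemma sum_int_interval_shift:
  "(\<Sum>y\<in>{l..<l + int n}. f y) = (\<Sum>i<n. f (l + int i))"
  by (rule sum.reindex_bij_witness[where i = "\<lambda>i. l + int i" and j = "\<lambda>y. nat (y - l)"]) auto

definition lattice_radius :: "real \<Rightarrow> nat \<Rightarrow> nat" where
  "lattice_radius R N = nat \<lceil>R * real N\<rceil>"

lemma lattice_radius_bounds: "R \<ge> 0 \<Longrightarrow> R * real N \<le> real (lattice_radius R N)" "R \<ge> 0 \<Longrightarrow> real (lattice_radius R N) \<le> R * real N + 1"
  unfolding lattice_radius_def by (simp_all add: real_nat_ceiling_ge of_int_ceiling_le_add_one)

lemma lattice_radius_ratio:
  assumes "R \<ge> 0"
  shows "(\<lambda>N. real (lattice_radius R N) / real N) \<longlonglongrightarrow> R"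
proof (rule tendsto_sandwich)
  show "\<forall>\<^sub>F N in sequentially. R \<le> real (lattice_radius R N) / real N"
    using eventually_gt_at_top[of "0::nat"]
    by eventually_elim (use lattice_radius_bounds(1)[OF assms] in \<open>simp add: pos_le_divide_eq\<close>)
  show "\<forall>\<^sub>F N in sequentially. real (lattice_radius R N) / real N \<le> R + 1 / real N"
    using eventually_gt_at_top[of "0::nat"]
    by eventually_elim (use lattice_radius_bounds(2)[OF assms] in \<open>simp add: pos_divide_le_eq distrib_right\<close>)
  show "(\<lambda>N. R + 1 / real N) \<longlonglongrightarrow> R"
    using tendsto_add[OF tendsto_const lim_1_over_n, of R] by simp
qed simp

section \<open>The corrector of the bond resistances\<close>

locale bond_disorder =
  fixes \<xi> :: "int \<Rightarrow> real" and \<gamma> :: real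
  assumes \<xi>_pos: "\<xi> x > 0" and \<gamma>_pos: "\<gamma> > 0"
    and right_average: "(\<lambda>K::nat. (1 / real K) * (\<Sum>x = 1..int K. inverse (\<xi> x))) \<longlonglongrightarrow> \<gamma>"
    and left_average: "(\<lambda>K::nat. (1 / real K) * (\<Sum>x = - int K..-1. inverse (\<xi> x))) \<longlonglongrightarrow> \<gamma>"
begin

text \<open>Normalised by \<open>\<gamma>\<close> so that the averages tend to 1 on both
  half-lines.\<close>

definition resistance :: "int \<Rightarrow> real" where
  "resistance x = 1 / (\<gamma> * \<xi> x)"

lemma resistance_pos: "resistance x > 0"
  using \<xi>_pos \<gamma>_pos by (simp add: resistance_def)

lemma conductance_resistance: "\<xi> x * resistance x = 1 / \<gamma>"
  using \<xi>_pos[of x] by (simp add: resistance_def)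

text \<open>The corrector of one-dimensional homogenisation: \<open>x + fluctuation x\<close> has
  increments \<open>resistance x\<close>, hence constant flux 1/\<gamma> through all bonds. The sign
  for negative \<open>x\<close> makes the increment formula hold on the whole lattice.\<close>

definition fluctuation :: "int \<Rightarrow> real" where
  "fluctuation x = (if x \<ge> 0 then (\<Sum>y\<in>{0..<x}. resistance y - 1) else - (\<Sum>y\<in>{x..<0}. resistance y - 1))"

lemma fluctuation_step: "fluctuation (x + 1) - fluctuation x = resistance x - 1"
proof -
  consider "x \<ge> 0" | "x = -1" | "x < -1" by linarith
  then show ?thesis
  proof cases
    case 1
    then have "{0..<x + 1} = insert x {0..<x}" by auto
    then show ?thesis using 1 by (simp add: fluctuation_def)
  next
    case 2
    have "{-1..<0::int} = {-1}" by auto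
    then show ?thesis using 2 by (simp add: fluctuation_def)
  next
    case 3
    then have "{x..<0} = insert x {x + 1..<0}" by auto
    then show ?thesis using 3 by (simp add: fluctuation_def)
  qed
qed

text \<open>Convergence of the averages makes the deviations at most \<open>e * K\<close> from some
  \<open>K0\<close> on; the finitely many earlier ones are absorbed in \<open>C\<close>. The family
  \<open>A\<close> is left general to cover both half-lines.\<close>

lemma average_sublinear:
  assumes "(\<lambda>K::nat. (1 / real K) * (\<Sum>x\<in>A K. inverse (\<xi> x))) \<longlonglongrightarrow> \<gamma>"
    and "\<And>K. card (A K) = K" "e > 0"
  obtains C where "C \<ge> 0" "\<And>K. \<bar>\<Sum>x\<in>A K. resistance x - 1\<bar> \<le> C + e * real K"
proof -
  define s where "s K = (\<Sum>x\<in>A K. resistance x - 1)" for K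
  have "(\<lambda>K. (1 / real K) * (\<Sum>x\<in>A K. inverse (\<xi> x)) / \<gamma> - 1) \<longlonglongrightarrow> \<gamma> / \<gamma> - 1"
    using assms(1) \<gamma>_pos by (intro tendsto_intros) auto
  then have "(\<lambda>K. (1 / real K) * (\<Sum>x\<in>A K. inverse (\<xi> x)) / \<gamma> - 1) \<longlonglongrightarrow> 0"
    using \<gamma>_pos by simp
  from tendstoD[OF this \<open>e > 0\<close>] have "\<forall>\<^sub>F K in sequentially. \<bar>s K\<bar> \<le> e * real K"
    using eventually_gt_at_top[of "0::nat"]
  proof eventually_elim
    case (elim K)
    have "s K = (\<Sum>x\<in>A K. inverse (\<xi> x)) / \<gamma> - real K"
      by (simp add: s_def resistance_def sum_subtractf assms(2) sum_divide_distrib field_simps)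
    then have "s K = real K * ((1 / real K) * (\<Sum>x\<in>A K. inverse (\<xi> x)) / \<gamma> - 1)"
      using elim(2) by (simp add: field_simps)
    then show ?case using elim by (simp add: abs_mult)
  qed
  then obtain K0 where K0: "\<And>K. K \<ge> K0 \<Longrightarrow> \<bar>s K\<bar> \<le> e * real K"
    by (auto simp: eventually_at_top_linorder)
  have "\<bar>s K\<bar> \<le> (\<Sum>k<K0. \<bar>s k\<bar>) + e * real K" for K
  proof (cases "K < K0")
    case True
    then have "\<bar>s K\<bar> \<le> (\<Sum>k<K0. \<bar>s k\<bar>)"
      using member_le_sum[of K "{..<K0}" "\<lambda>k. \<bar>s k\<bar>"] by simp
    then show ?thesis using \<open>e > 0\<close> by (simp add: add_increasing2)
  next
    case False
    then show ?thesis using K0[of K] by (simp add: add_increasing sum_nonneg)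
  qed
  then show thesis by (intro that[of "\<Sum>k<K0. \<bar>s k\<bar>"]) (auto simp: s_def sum_nonneg)
qed

lemma fluctuation_sublinear:
  assumes "e > 0"
  obtains C where "\<And>x. \<bar>fluctuation x\<bar> \<le> C + e * \<bar>real_of_int x\<bar>"
proof -
  obtain C1 where C1: "C1 \<ge> 0" "\<And>K. \<bar>\<Sum>x = 1..int K. resistance x - 1\<bar> \<le> C1 + e * real K"
    using right_average by (rule average_sublinear) (use assms in auto)
  obtain C2 where C2: "C2 \<ge> 0" "\<And>K. \<bar>\<Sum>x = - int K..-1. resistance x - 1\<bar> \<le> C2 + e * real K"
    using left_average by (rule average_sublinear) (use assms in auto)
  \<comment> \<open>Neither of the two averages contains the bond 0, so its deviation is added to
    the constant.\<close>
  have "\<bar>fluctuation x\<bar> \<le> C1 + C2 + \<bar>resistance 0 - 1\<bar> + e * \<bar>real_of_int x\<bar>" for x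
  proof -
    consider "x = 0" | "x > 0" | "x < 0" by linarith
    then show ?thesis
    proof cases
      case 1 then show ?thesis using C1(1) C2(1) by (simp add: fluctuation_def)
    next
      case 2
      then have "{0..<x} = insert 0 {1..int (nat (x - 1))}" by auto
      then have "fluctuation x = (resistance 0 - 1) + (\<Sum>x = 1..int (nat (x - 1)). resistance x - 1)"
        using 2 by (simp add: fluctuation_def)
      moreover have "e * real (nat (x - 1)) \<le> e * \<bar>real_of_int x\<bar>"
        using 2 assms by (intro mult_left_mono) auto
      ultimately show ?thesis using C1(2)[of "nat (x - 1)"] C2(1) by linarith
    next
      case 3
      then have "{x..<0} = {- int (nat (-x))..-1}" by auto
      then have "fluctuation x = - (\<Sum>x = - int (nat (-x))..-1. resistance x - 1)"
        using 3 by (simp add: fluctuation_def)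
      then show ?thesis using C2(2)[of "nat (-x)"] C1(1) 3 by simp
    qed
  qed
  then show thesis by (rule that)
qed

text \<open>The discrete derivative of the corrected test function is chosen so that its flux through
  the bond \<open>x\<close> is \<open>(f'(x/N) - \<epsilon>)/\<gamma>\<close>, free of the disorder; the constant \<open>\<epsilon>\<close> restores the
  compact support.\<close>

lemma corrected_test_function_exists:
  fixes f f1 f2 f3 :: "real \<Rightarrow> real" and N M :: nat
  assumes N: "N \<ge> 1"
    and d: "\<And>u. (f has_real_derivative f1 u) (at u)" "\<And>u. (f1 has_real_derivative f2 u) (at u)"
      "\<And>u. (f2 has_real_derivative f3 u) (at u)"
    and K: "\<And>u. \<bar>f1 u\<bar> \<le> K" "\<And>u. \<bar>f2 u\<bar> \<le> K" "\<And>u. \<bar>f3 u\<bar> \<le> K"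
    and supp: "\<And>u. \<bar>u\<bar> \<ge> real M / real N \<Longrightarrow> f u = 0" "\<And>u. \<bar>u\<bar> \<ge> real M / real N \<Longrightarrow> f1 u = 0"
    and w: "\<And>x. x \<in> {- int M..int M + 1} \<Longrightarrow> \<bar>fluctuation x\<bar> \<le> w"
    and E: "E \<ge> 0" "(w * (2 * K + (2 * real M + 1) * K / N) + (2 * real M + 1) * K / N)
        \<le> E * (2 * real M + 1 - 2 * w)"
  shows "\<exists>g. (\<forall>x. x \<notin> {-(int M + 1)..int M + 1} \<longrightarrow> g x = 0) \<and>
    (\<Sum>x\<in>{-(int M + 1)..int M + 1}. \<bar>g x - f (x / N) / N\<bar>)
      \<le> (2 * real M + 3) / N * (2 * (w * (2 * K + (2 * real M + 1) * K / N) + (2 * real M + 1) * K / N) / N) \<and>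
    (\<Sum>x\<in>{-(int M + 1) - 1..int M + 1 + 1}. \<bar>disorder_laplacian \<xi> N g x - f2 (x / N) / (\<gamma> * N)\<bar>)
      \<le> ((2 * real M + 5) * K / (real N)\<^sup>2 + 2 * E) / \<gamma> \<and>
    dirichlet_form \<xi> N (int M + 1) g \<le> (K + E)\<^sup>2 * (2 * real M + 1 + 2 * w) / (\<gamma> * (real N)\<^sup>2)"
proof -
  define m where "m = int M"
  define S where "S = (\<Sum>y\<in>{-m..m}. resistance y)"
  \<comment> \<open>The mean of f' over the window, weighted by the resistances: subtracting it
    makes the increments \<open>b\<close> sum to zero, so that \<open>g\<close> returns to 0 at the
    right end.\<close>
  define \<epsilon> where "\<epsilon> = (\<Sum>y\<in>{-m..m}. resistance y * f1 (y / N)) / S"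
  define b where "b y = (if y \<in> {-m..m} then resistance y * (f1 (y / N) - \<epsilon>) else 0)" for y
  \<comment> \<open>The increment of f/N from one site to the next is of order N^-2, hence the
    square.\<close>
  define g where "g x = (\<Sum>y\<in>{-m..<x}. b y) / (real N)\<^sup>2" for x
  \<comment> \<open>Error of the weighted sum of f' as a primitive of f: two boundary terms and a
    Lipschitz sum from summation by parts against the fluctuation, plus the accumulated Taylor
    error.\<close>
  define \<eta> where "\<eta> = (w * (2 * K + (2 * real M + 1) * K / N) + (2 * real M + 1) * K / N) / N"
  define p where "p i = f1 (real_of_int (-m + int i) / N)" for i :: nat
  define q where "q i = f (real_of_int (-m + int i) / N)" for i :: nat
  define W where "W i = fluctuation (-m + int i)" for i :: nat
  define a where "a i = resistance (-m + int i)" for i :: nat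
  have N0: "real N > 0" using N by simp
  have K0: "K \<ge> 0" using K(1)[of 0] by (meson abs_ge_zero order_trans)
  have w0: "w \<ge> 0" using w[of 0] by auto
  have set_eq: "{-m..m} = {-m..<-m + int (2 * M + 1)}" by (auto simp: m_def)
  have sum_box: "(\<Sum>y\<in>{-m..m}. h y) = (\<Sum>i<2*M+1. h (-m + int i))" for h :: "int \<Rightarrow> real"
    unfolding set_eq by (rule sum_int_interval_shift)
  have a_W: "a i - 1 = W (Suc i) - W i" for i
    using fluctuation_step[of "-m + int i"] by (simp add: a_def W_def ac_simps)
  \<comment> \<open>The index 2M+1 is the site M+1, one beyond the window; this is why
    \<open>w\<close> has to bound the fluctuation up to M+1.\<close>
  have Wb: "\<bar>W i\<bar> \<le> w" if "i \<le> 2*M+1" for i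
    unfolding W_def using that by (intro w) (auto simp: m_def)
  have S_sum: "S = (\<Sum>i<2*M+1. a i)" unfolding S_def sum_box a_def ..
  have "S = (\<Sum>i<2*M+1. 1 + (W (Suc i) - W i))" unfolding S_sum a_W[symmetric] by simp
  also have "\<dots> = 2 * real M + 1 + (W (2*M+1) - W 0)"
    unfolding sum.distrib sum_lessThan_telescope by simp
  finally have S_bounds: "2 * real M + 1 - 2 * w \<le> S" "S \<le> 2 * real M + 1 + 2 * w"
    using Wb[of "2*M+1"] Wb[of 0] by auto
  have S_pos: "S > 0" unfolding S_def by (intro sum_pos resistance_pos) (auto simp: m_def)

  have p_lip: "\<bar>p (Suc i) - p i\<bar> \<le> K / N" for i
    using derivative_lipschitz[of f1 f2 K "real_of_int (-m + int (Suc i)) / N" "real_of_int (-m + int i) / N"]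
      d(2) K(2) N0 by (simp add: p_def diff_divide_distrib[symmetric])
  have q_step: "\<bar>q (Suc i) - q i - p i / N\<bar> \<le> K / (real N)\<^sup>2" for i
    using taylor_first_order[of f f1 f2 K "real_of_int (-m + int (Suc i)) / N" "real_of_int (-m + int i) / N"]
      d(1,2) K(2) by (simp add: p_def q_def diff_divide_distrib[symmetric] power_divide)
  have q0: "q 0 = 0" unfolding q_def using N0 by (intro supp) (simp add: m_def)
  have q_end: "q (2 * M + 1) = 0"
    unfolding q_def using N0 by (intro supp) (simp add: m_def divide_right_mono)
  \<comment> \<open>The weight \<open>a i\<close> is split into 1 and the increment of
    \<open>W\<close>. The part with 1 telescopes to f up to Taylor errors. In the other part only
    \<open>W\<close> is bounded by \<open>w\<close>, not its increments, so the difference is moved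
    onto \<open>p\<close>, which changes by at most K/N per site.\<close>
  have main: "\<bar>(\<Sum>i<n. a i * p i) / N - q n\<bar> \<le> \<eta>" if n: "n \<le> 2*M+1" for n
  proof -
    have "(\<Sum>i<n. a i * p i) = (\<Sum>i<n. (W (Suc i) - W i) * p i) + (\<Sum>i<n. p i)"
      unfolding a_W[symmetric] sum.distrib[symmetric] by (simp add: algebra_simps)
    moreover have "q n = (\<Sum>i<n. q (Suc i) - q i)" unfolding sum_lessThan_telescope by (simp add: q0)
    ultimately have "(\<Sum>i<n. a i * p i) / N - q n
        = (\<Sum>i<n. (W (Suc i) - W i) * p i) / N - (\<Sum>i<n. q (Suc i) - q i - p i / N)"
      by (simp add: add_divide_distrib sum_divide_distrib sum_subtractf)
    moreover have "\<bar>\<Sum>i<n. (W (Suc i) - W i) * p i\<bar> \<le> w * (2 * K + (2 * real M + 1) * K / N)"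
    proof -
      have "\<bar>W n * p n\<bar> \<le> w * K" "\<bar>W 0 * p 0\<bar> \<le> w * K"
        unfolding abs_mult p_def using Wb n K(1) K0 w0 by (auto intro!: mult_mono)
      moreover have "\<bar>\<Sum>i<n. W (Suc i) * (p (Suc i) - p i)\<bar> \<le> (\<Sum>i<n. w * (K / N))"
      proof (rule order_trans[OF sum_abs], rule sum_mono)
        fix i assume "i \<in> {..<n}"
        then have "\<bar>W (Suc i)\<bar> \<le> w" using n by (intro Wb) simp
        then show "\<bar>W (Suc i) * (p (Suc i) - p i)\<bar> \<le> w * (K / N)"
          unfolding abs_mult using p_lip w0 by (intro mult_mono) auto
      qed
      moreover have "(\<Sum>i<n. w * (K / N)) \<le> (2 * real M + 1) * (w * (K / N))"
        unfolding sum_constant card_lessThan using n w0 K0 by (intro mult_right_mono) auto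
      ultimately have "\<bar>W n * p n - W 0 * p 0 - (\<Sum>i<n. W (Suc i) * (p (Suc i) - p i))\<bar>
          \<le> w * K + w * K + (2 * real M + 1) * (w * (K / N))"
        by linarith
      also have "\<dots> = w * (2 * K + (2 * real M + 1) * K / N)" by (simp add: algebra_simps add_divide_distrib)
      finally show ?thesis unfolding summation_by_parts .
    qed
    moreover have "\<bar>\<Sum>i<n. q (Suc i) - q i - p i / N\<bar> \<le> (2 * real M + 1) * K / N / N"
    proof -
      have "\<bar>\<Sum>i<n. q (Suc i) - q i - p i / N\<bar> \<le> (\<Sum>i<n. K / (real N)\<^sup>2)"
        by (intro order_trans[OF sum_abs] sum_mono q_step)
      also have "\<dots> \<le> (2 * real M + 1) * (K / (real N)\<^sup>2)"
        unfolding sum_constant card_lessThan using n K0 by (intro mult_right_mono) auto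
      finally show ?thesis by (simp add: power2_eq_square)
    qed
    moreover have "\<bar>A / N - B\<bar> \<le> X / N + Y" if "\<bar>A\<bar> \<le> X" "\<bar>B\<bar> \<le> Y" for A B X Y
    proof -
      have "\<bar>A / N\<bar> \<le> X / N" using that(1) N0 by (simp add: abs_divide divide_right_mono)
      then show ?thesis using that(2) by linarith
    qed
    ultimately have "\<bar>(\<Sum>i<n. a i * p i) / N - q n\<bar>
        \<le> w * (2 * K + (2 * real M + 1) * K / N) / N + (2 * real M + 1) * K / N / N"
      by presburger
    then show ?thesis unfolding \<eta>_def add_divide_distrib .
  qed
  have \<epsilon>S: "\<epsilon> * S = (\<Sum>i<2*M+1. a i * p i)"
    using S_pos by (simp add: \<epsilon>_def sum_box a_def p_def)
  \<comment> \<open>Across the whole window f has returned to 0, so the comparison measures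
    \<epsilon> S / N alone.\<close>
  have \<epsilon>_\<eta>: "\<bar>\<epsilon>\<bar> * S / N \<le> \<eta>"
    using main[of "2*M+1"] unfolding \<epsilon>S[symmetric] q_end using S_pos by (simp add: abs_mult)
  have \<epsilon>_E: "\<bar>\<epsilon>\<bar> \<le> E"
  proof -
    have "\<bar>\<epsilon>\<bar> * S \<le> \<eta> * N" using \<epsilon>_\<eta> N0 by (simp add: pos_divide_le_eq)
    also have "\<dots> \<le> E * (2 * real M + 1 - 2 * w)" using E(2) N0 by (simp add: \<eta>_def)
    also have "\<dots> \<le> E * S" using E(1) S_bounds(1) by (intro mult_left_mono) auto
    finally show ?thesis using S_pos by simp
  qed
  have g_step: "g (x + 1) - g x = b x / (real N)\<^sup>2" for x
  proof (cases "x \<ge> -m")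
    case True
    then have "{-m..<x + 1} = insert x {-m..<x}" by auto
    then show ?thesis by (simp add: g_def add_divide_distrib)
  qed (auto simp: g_def b_def)
  \<comment> \<open>The flux formula holds on every bond because \<open>f1\<close> vanishes outside
    the window.\<close>
  have b_alt: "\<xi> x * b x = (f1 (x / N) - \<epsilon> * of_bool (x \<in> {-m..m})) / \<gamma>" for x
  proof (cases "x \<in> {-m..m}")
    case True
    then show ?thesis using conductance_resistance[of x]
      by (simp add: b_def mult.assoc[symmetric])
  next
    case False
    then have "\<bar>real_of_int x / N\<bar> \<ge> real M / N"
      using N0 by (auto simp: m_def abs_divide intro!: divide_right_mono)
    then have "f1 (x / N) = 0" by (rule supp(2))
    moreover have "b x = 0" using False unfolding b_def by (rule if_not_P)
    moreover have "of_bool (x \<in> {-m..m}) = (0::real)" using False by (simp only: of_bool_eq)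
    ultimately show ?thesis by simp
  qed
  \<comment> \<open>One \<open>\<eta>\<close> comes from the comparison with f, the second from the
    \<epsilon> term, in which partial sums of resistances are at most S.\<close>
  have N_g: "\<bar>N * g (-m + int n) - q n\<bar> \<le> 2 * \<eta>" if n: "n \<le> 2*M+1" for n
  proof -
    have "N * g (-m + int n) = (\<Sum>i<n. b (-m + int i)) / N"
      unfolding g_def sum_int_interval_shift using N0 by (simp add: power2_eq_square)
    also have "(\<Sum>i<n. b (-m + int i)) = (\<Sum>i<n. a i * p i - \<epsilon> * a i)"
      using n by (intro sum.cong) (auto simp: b_def a_def p_def m_def algebra_simps)
    also have "\<dots> = (\<Sum>i<n. a i * p i) - \<epsilon> * (\<Sum>i<n. a i)"
      by (simp add: sum_subtractf sum_distrib_left)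
    finally have "N * g (-m + int n) - q n = ((\<Sum>i<n. a i * p i) / N - q n) - \<epsilon> * (\<Sum>i<n. a i) / N"
      by (simp add: diff_divide_distrib)
    moreover have "\<bar>\<epsilon> * (\<Sum>i<n. a i) / N\<bar> \<le> \<eta>"
    proof -
      have a0: "0 \<le> a i" for i by (simp add: a_def resistance_pos less_imp_le)
      have "0 \<le> (\<Sum>i<n. a i)" by (intro sum_nonneg a0)
      have "(\<Sum>i<n. a i) \<le> S" unfolding S_sum using n by (intro sum_mono2 a0) auto
      then have "\<bar>\<epsilon>\<bar> * (\<Sum>i<n. a i) / N \<le> \<bar>\<epsilon>\<bar> * S / N"
        by (intro divide_right_mono mult_left_mono) auto
      then show ?thesis using \<epsilon>_\<eta> \<open>0 \<le> (\<Sum>i<n. a i)\<close> by (simp add: abs_mult)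
    qed
    ultimately show ?thesis using main[OF n] by linarith
  qed
  have g_zero: "g x = 0" if x: "x \<notin> {-m..m}" for x
  proof (cases "x < -m")
    case True then show ?thesis by (simp add: g_def)
  next
    case False
    then have "x > m" using x by auto
    then have "(\<Sum>y\<in>{-m..<x}. b y) = (\<Sum>y\<in>{-m..m}. b y)"
      by (intro sum.mono_neutral_right) (auto simp: b_def)
    also have "\<dots> = (\<Sum>y\<in>{-m..m}. resistance y * f1 (y / N)) - \<epsilon> * S"
      by (simp add: b_def S_def algebra_simps sum_subtractf sum_distrib_left)
    also have "\<dots> = 0" using S_pos by (simp add: \<epsilon>_def)
    finally show ?thesis by (simp add: g_def)
  qed
  have site: "\<bar>g x - f (x / N) / N\<bar> \<le> 2 * \<eta> / N" if x: "x \<in> {-(m + 1)..m + 1}" for x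
  proof (cases "x \<in> {-m..m}")
    case True
    then have "x = -m + int (nat (x + m))" "nat (x + m) \<le> 2*M+1" by (auto simp: m_def)
    then have "\<bar>N * g x - f (x / N)\<bar> \<le> 2 * \<eta>"
      using N_g[of "nat (x + m)"] unfolding q_def by metis
    then have "\<bar>N * g x - f (x / N)\<bar> / N \<le> 2 * \<eta> / N" by (intro divide_right_mono) auto
    moreover have "(N * g x - f (x / N)) / N = g x - f (x / N) / N"
      using N0 by (simp add: diff_divide_distrib)
    then have "\<bar>N * g x - f (x / N)\<bar> / N = \<bar>g x - f (x / N) / N\<bar>"
      using N0 by (metis abs_divide abs_of_pos)
    ultimately show ?thesis by simp
  next
    case False
    then have "\<bar>real_of_int x / N\<bar> \<ge> real M / N"
      using N0 by (auto simp: m_def abs_divide intro!: divide_right_mono)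
    then show ?thesis using False supp(1) g_zero w0 K0 by (simp add: \<eta>_def)
  qed
  have 1: "(\<Sum>x\<in>{-(m + 1)..m + 1}. \<bar>g x - f (x / N) / N\<bar>) \<le> (2 * real M + 3) / N * (2 * \<eta>)"
  proof -
    have "(\<Sum>x\<in>{-(m + 1)..m + 1}. \<bar>g x - f (x / N) / N\<bar>) \<le> (\<Sum>x\<in>{-(m + 1)..m + 1}. 2 * \<eta> / N)"
      by (intro sum_mono site) auto
    also have "\<dots> = (2 * real M + 3) * (2 * \<eta> / N)" by (simp add: m_def)
    finally show ?thesis by simp
  qed
  have 2: "(\<Sum>x\<in>{-(m + 1) - 1..m + 1 + 1}. \<bar>disorder_laplacian \<xi> N g x - f2 (x / N) / (\<gamma> * N)\<bar>)
      \<le> ((2 * real M + 5) * K / (real N)\<^sup>2 + 2 * E) / \<gamma>"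
  proof -
    let ?A = "{-(m + 1) - 1..m + 1 + 1}"
    \<comment> \<open>The Laplacian of \<open>g\<close> is a difference of neighbouring fluxes. The
      \<epsilon> terms cancel except at the two ends -m and m+1, which produce the 2E.\<close>
    have "\<bar>disorder_laplacian \<xi> N g x - f2 (x / N) / (\<gamma> * N)\<bar>
        \<le> (K / (real N)\<^sup>2 + E * (of_bool (x = -m) + of_bool (x = m + 1))) / \<gamma>" for x
    proof -
      let ?i = "\<lambda>x. of_bool (x \<in> {-m..m}) :: real"
      have "disorder_laplacian \<xi> N g x = (real N)\<^sup>2 * (\<xi> x * (b x / (real N)\<^sup>2) - \<xi> (x - 1) * (b (x - 1) / (real N)\<^sup>2))"
        unfolding disorder_laplacian_def using g_step[of x] g_step[of "x - 1"] by simp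
      also have "\<dots> = \<xi> x * b x - \<xi> (x - 1) * b (x - 1)" using N0 by (simp add: field_simps)
      finally have L: "disorder_laplacian \<xi> N g x
          = (f1 (x / N) - \<epsilon> * ?i x) / \<gamma> - (f1 (real_of_int (x - 1) / N) - \<epsilon> * ?i (x - 1)) / \<gamma>"
        unfolding b_alt .
      have "(p - \<epsilon> * i) / \<gamma> - (q - \<epsilon> * j) / \<gamma> - c / (\<gamma> * N)
          = ((p - q - c / N) - \<epsilon> * (i - j)) / \<gamma>" for p q c i j :: real
        using \<gamma>_pos N0 by (simp add: field_simps)
      then have "disorder_laplacian \<xi> N g x - f2 (x / N) / (\<gamma> * N)
         = ((f1 (x / N) - f1 (real_of_int (x - 1) / N) - f2 (x / N) / N) - \<epsilon> * (?i x - ?i (x - 1))) / \<gamma>"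
        unfolding L .
      moreover have "\<bar>f1 (x / N) - f1 (real_of_int (x - 1) / N) - f2 (x / N) / N\<bar> \<le> K / (real N)\<^sup>2"
      proof -
        have "real_of_int (x - 1) / N - x / N = - (1 / N)" by (simp add: diff_divide_distrib)
        then show ?thesis
          using taylor_first_order[of f1 f2 f3 K "real_of_int (x - 1) / N" "x / N", OF d(2,3) K(3)]
          by (simp add: power_divide)
      qed
      moreover have "\<bar>\<epsilon> * (?i x - ?i (x - 1))\<bar> \<le> E * (of_bool (x = -m) + of_bool (x = m + 1))"
        unfolding abs_mult using \<epsilon>_E E(1) by (intro mult_mono) (auto simp: m_def)
      ultimately show ?thesis
        using \<gamma>_pos by (simp only: abs_divide abs_of_pos) (intro divide_right_mono; linarith)
    qed
    then have "(\<Sum>x\<in>?A. \<bar>disorder_laplacian \<xi> N g x - f2 (x / N) / (\<gamma> * N)\<bar>)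
        \<le> (\<Sum>x\<in>?A. (K / (real N)\<^sup>2 + E * (of_bool (x = -m) + of_bool (x = m + 1))) / \<gamma>)"
      by (intro sum_mono) auto
    also have "\<dots> = ((\<Sum>x\<in>?A. K / (real N)\<^sup>2)
        + E * ((\<Sum>x\<in>?A. of_bool (x = -m)) + (\<Sum>x\<in>?A. of_bool (x = m + 1)))) / \<gamma>"
      by (simp only: sum_divide_distrib[symmetric] sum.distrib sum_distrib_left[symmetric])
    also have "(\<Sum>x\<in>?A. of_bool (x = -m)) = (1::real)"
      by (subst sum.remove[of _ "-m"]) (auto simp: m_def)
    also have "(\<Sum>x\<in>?A. of_bool (x = m + 1)) = (1::real)"
      by (subst sum.remove[of _ "m + 1"]) (auto simp: m_def)
    also have "(\<Sum>x\<in>?A. K / (real N)\<^sup>2) = (2 * real M + 5) * K / (real N)\<^sup>2"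
      by (simp add: m_def)
    finally show ?thesis by (simp add: mult.commute)
  qed
  \<comment> \<open>Conductance times squared increment is a bounded factor times the resistance;
    the resistances sum to at most 2M + 1 + 2w, and the division by N^2 leaves order 1/N when
    \<open>M\<close> is of order \<open>N\<close>.\<close>
  have 3: "dirichlet_form \<xi> N (m + 1) g \<le> (K + E)\<^sup>2 * (2 * real M + 1 + 2 * w) / (\<gamma> * (real N)\<^sup>2)"
  proof -
    have "dirichlet_form \<xi> N (m + 1) g
        = (\<Sum>x\<in>{-(m+1)-1..m+1}. \<xi> x * b x * b x) / (real N)\<^sup>2"
      unfolding dirichlet_form_def g_step using N0
      by (simp add: sum_distrib_left sum_divide_distrib power2_eq_square field_simps)
    also have "(\<Sum>x\<in>{-(m+1)-1..m+1}. \<xi> x * b x * b x) = (\<Sum>x\<in>{-m..m}. \<xi> x * b x * b x)"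
      by (intro sum.mono_neutral_right) (auto simp: b_def)
    also have "\<dots> \<le> (\<Sum>x\<in>{-m..m}. (K + E)\<^sup>2 / \<gamma> * resistance x)"
    proof (rule sum_mono)
      fix x assume x: "x \<in> {-m..m}"
      have "\<bar>f1 (x / N) - \<epsilon>\<bar> \<le> K + E"
        using K(1)[of "x / N"] \<epsilon>_E by linarith
      then have "(f1 (x / N) - \<epsilon>)\<^sup>2 \<le> (K + E)\<^sup>2"
        using K0 E(1) by (simp add: abs_le_square_iff[symmetric])
      moreover have "\<xi> x * b x * b x = (f1 (x / N) - \<epsilon>)\<^sup>2 / \<gamma> * resistance x"
        unfolding b_alt using x by (simp add: b_def power2_eq_square)
      ultimately show "\<xi> x * b x * b x \<le> (K + E)\<^sup>2 / \<gamma> * resistance x"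
        using \<gamma>_pos resistance_pos[of x] by (simp add: divide_right_mono mult_right_mono less_imp_le)
    qed
    also have "\<dots> = (K + E)\<^sup>2 / \<gamma> * S" by (simp add: S_def sum_distrib_left)
    also have "\<dots> \<le> (K + E)\<^sup>2 / \<gamma> * (2 * real M + 1 + 2 * w)"
      using S_bounds(2) \<gamma>_pos by (intro mult_left_mono) auto
    finally show ?thesis
      using N0 by (simp add: divide_right_mono)
  qed
  show ?thesis
    using 1 2 3 g_zero unfolding \<eta>_def m_def by (intro exI[of _ g]) (auto simp: m_def)
qed

text \<open>Sublinear growth with a slope \<open>e'\<close> small compared with 1/(R + 1) makes even
  the maximum over a window of order N negligible against N; the additive constant disappears in the
  limit.\<close>

lemma fluctuation_negligible:
  assumes R: "R \<ge> 0"
  obtains w where "\<And>N x. x \<in> {- int (lattice_radius R N)..int (lattice_radius R N) + 1} \<Longrightarrow> \<bar>fluctuation x\<bar> \<le> w N"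
    and "(\<lambda>N. w N / real N) \<longlonglongrightarrow> 0"
proof -
  define w where "w N = Max ((\<lambda>x. \<bar>fluctuation x\<bar>) ` {- int (lattice_radius R N)..int (lattice_radius R N) + 1})" for N
  have ub: "\<bar>fluctuation x\<bar> \<le> w N" if "x \<in> {- int (lattice_radius R N)..int (lattice_radius R N) + 1}" for x N
    unfolding w_def using that by (intro Max_ge) auto
  have "(\<lambda>N. w N / real N) \<longlonglongrightarrow> 0"
  proof (rule tendstoI)
    fix e :: real assume "e > 0"
    define e' where "e' = e / (2 * (R + 1))"
    have "e' > 0" using \<open>e > 0\<close> R by (simp add: e'_def)
    obtain C where C: "\<And>x. \<bar>fluctuation x\<bar> \<le> C + e' * \<bar>real_of_int x\<bar>"
      using fluctuation_sublinear[OF \<open>e' > 0\<close>] by blast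
    have w_le: "w N \<le> C + e' * (real (lattice_radius R N) + 1)" for N
      unfolding w_def
    proof (rule Max.boundedI)
      fix y assume "y \<in> (\<lambda>x. \<bar>fluctuation x\<bar>) ` {- int (lattice_radius R N)..int (lattice_radius R N) + 1}"
      then obtain x where x: "y = \<bar>fluctuation x\<bar>" "x \<in> {- int (lattice_radius R N)..int (lattice_radius R N) + 1}" by auto
      have "e' * \<bar>real_of_int x\<bar> \<le> e' * (real (lattice_radius R N) + 1)"
        using x(2) \<open>e' > 0\<close> by (intro mult_left_mono) auto
      then show "y \<le> C + e' * (real (lattice_radius R N) + 1)" using C[of x] x(1) by linarith
    qed auto
    have "(\<lambda>N. C * (1 / real N) + e' * (real (lattice_radius R N) / real N + 1 / real N)) \<longlonglongrightarrow> C * 0 + e' * (R + 0)"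
      by (intro tendsto_intros lattice_radius_ratio R lim_1_over_n)
    moreover have "C * 0 + e' * (R + 0) < e" using \<open>e > 0\<close> R
      by (simp add: e'_def field_simps add_nonneg_pos)
    ultimately have "\<forall>\<^sub>F N in sequentially. C * (1 / real N) + e' * (real (lattice_radius R N) / real N + 1 / real N) < e"
      by (rule order_tendstoD)
    then show "\<forall>\<^sub>F N in sequentially. dist (w N / real N) 0 < e"
      using eventually_gt_at_top[of "0::nat"]
    proof eventually_elim
      case (elim N)
      have "w N / real N \<le> (C + e' * (real (lattice_radius R N) + 1)) / real N"
        using w_le by (intro divide_right_mono) auto
      moreover have "0 \<le> w N" using ub[of 0 N] by auto
      ultimately show ?case using elim by (simp add: add_divide_distrib algebra_simps)
    qed
  qed
  with ub show thesis by (rule that)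
qed

text \<open>The explicit bounds of the construction are rewritten in the ratios \<open>r\<close>,
  \<open>v\<close>, \<open>h\<close>, which tend to R, 0 and 0; each of them then visibly tends to
  0.\<close>

lemma corrected_test_function:
  fixes f f1 f2 f3 :: "real \<Rightarrow> real"
  assumes R: "R > 0" and e: "e > 0"
    and d: "\<And>u. (f has_real_derivative f1 u) (at u)" "\<And>u. (f1 has_real_derivative f2 u) (at u)"
      "\<And>u. (f2 has_real_derivative f3 u) (at u)"
    and K: "\<And>u. \<bar>f1 u\<bar> \<le> K" "\<And>u. \<bar>f2 u\<bar> \<le> K" "\<And>u. \<bar>f3 u\<bar> \<le> K"
    and supp: "\<And>u. \<bar>u\<bar> \<ge> R \<Longrightarrow> f u = 0" "\<And>u. \<bar>u\<bar> \<ge> R \<Longrightarrow> f1 u = 0"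
  shows "\<forall>\<^sub>F N in sequentially. \<exists>g. let n = int (lattice_radius R N) + 1 in
    (\<forall>x. x \<notin> {-n..n} \<longrightarrow> g x = 0) \<and>
    (\<Sum>x\<in>{-n..n}. \<bar>g x - f (x / N) / N\<bar>) \<le> e \<and>
    (\<Sum>x\<in>{-n-1..n+1}. \<bar>disorder_laplacian \<xi> N g x - f2 (x / N) / (\<gamma> * N)\<bar>) \<le> e \<and>
    dirichlet_form \<xi> N n g \<le> e"
proof -
  have R0: "R \<ge> 0" using R by simp
  obtain w where w: "\<And>N x. x \<in> {- int (lattice_radius R N)..int (lattice_radius R N) + 1} \<Longrightarrow> \<bar>fluctuation x\<bar> \<le> w N"
    and w_lim: "(\<lambda>N. w N / real N) \<longlonglongrightarrow> 0"
    using fluctuation_negligible[OF R0] by blast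
  define r where "r N = real (lattice_radius R N) / real N" for N
  define v where "v N = w N / real N" for N
  define h where "h N = 1 / real N" for N :: nat
  define \<eta> where "\<eta> N = v N * (2 * K + (2 * r N + h N) * K) + (2 * r N + h N) * K * h N" for N
  \<comment> \<open>Chosen to meet the condition on \<open>E\<close> in
    \<open>corrected_test_function_exists\<close> once the denominator is positive; the absolute
    value keeps it nonnegative for every N.\<close>
  define E where "E N = \<bar>\<eta> N / (2 * r N + h N - 2 * v N)\<bar>" for N
  have r: "r \<longlonglongrightarrow> R" unfolding r_def using R0 by (rule lattice_radius_ratio)
  have v: "v \<longlonglongrightarrow> 0" unfolding v_def by fact
  have h: "h \<longlonglongrightarrow> 0" unfolding h_def by (rule lim_1_over_n)
  have \<eta>: "\<eta> \<longlonglongrightarrow> 0"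
    unfolding \<eta>_def by (rule tendsto_eq_intros r v h refl | simp)+
  have den: "(\<lambda>N. 2 * r N + h N - 2 * v N) \<longlonglongrightarrow> 2 * R"
    by (rule tendsto_eq_intros r v h refl | simp)+
  have E: "E \<longlonglongrightarrow> 0"
    unfolding E_def using tendsto_rabs[OF tendsto_divide[OF \<eta> den]] R by simp
  have "(\<lambda>N. (2 * r N + 3 * h N) * (2 * \<eta> N)) \<longlonglongrightarrow> 0"
    by (rule tendsto_eq_intros r v h \<eta> refl | simp)+
  then have ev1: "\<forall>\<^sub>F N in sequentially. (2 * r N + 3 * h N) * (2 * \<eta> N) < e"
    using e by (rule order_tendstoD)
  have "(\<lambda>N. ((2 * r N + 5 * h N) * K * h N + 2 * E N) / \<gamma>) \<longlonglongrightarrow> 0"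
    by (rule tendsto_eq_intros r v h E refl | use \<gamma>_pos in simp)+
  then have ev2: "\<forall>\<^sub>F N in sequentially. ((2 * r N + 5 * h N) * K * h N + 2 * E N) / \<gamma> < e"
    using e by (rule order_tendstoD)
  have "(\<lambda>N. (K + E N)\<^sup>2 * ((2 * r N + h N + 2 * v N) * h N) / \<gamma>) \<longlonglongrightarrow> 0"
    by (rule tendsto_eq_intros r v h E refl | use \<gamma>_pos in simp)+
  then have ev3: "\<forall>\<^sub>F N in sequentially. (K + E N)\<^sup>2 * ((2 * r N + h N + 2 * v N) * h N) / \<gamma> < e"
    using e by (rule order_tendstoD)
  have ev4: "\<forall>\<^sub>F N in sequentially. 2 * r N + h N - 2 * v N > 0"
    using order_tendstoD(1)[OF den, of 0] R by simp
  show ?thesis using ev1 ev2 ev3 ev4 eventually_gt_at_top[of "0::nat"]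
  proof eventually_elim
    case (elim N)
    let ?M = "lattice_radius R N"
    have N: "N \<ge> 1" "real N > 0" using elim by auto
    have rs: "real ?M = r N * N" "w N = v N * N" "1 = h N * N" using N by (auto simp: r_def v_def h_def)
    have q: "R \<le> real ?M / N" using lattice_radius_bounds(1)[OF R0] N by (simp add: pos_le_divide_eq)
    have \<eta>_N: "w N * (2 * K + (2 * real ?M + 1) * K / N) + (2 * real ?M + 1) * K / N = \<eta> N * N"
      unfolding \<eta>_def r_def v_def h_def using N by (simp add: field_simps)
    have den_N: "2 * real ?M + 1 - 2 * w N = (2 * r N + h N - 2 * v N) * N"
      unfolding r_def v_def h_def using N by (simp add: field_simps)
    have "\<eta> N \<le> E N * (2 * r N + h N - 2 * v N)"
      using elim(4) by (simp add: E_def abs_divide)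
    then have "w N * (2 * K + (2 * real ?M + 1) * K / N) + (2 * real ?M + 1) * K / N
        \<le> E N * (2 * real ?M + 1 - 2 * w N)"
      unfolding \<eta>_N den_N using N by (simp add: mult.assoc[symmetric] mult_right_mono)
    from corrected_test_function_exists[of N f f1 f2 f3 K ?M "w N", OF N(1) d K _ _ w _ this]
    obtain g where g: "\<And>x. x \<notin> {-(int ?M + 1)..int ?M + 1} \<Longrightarrow> g x = 0"
      "(\<Sum>x\<in>{-(int ?M + 1)..int ?M + 1}. \<bar>g x - f (x / N) / N\<bar>)
        \<le> (2 * real ?M + 3) / N * (2 * (w N * (2 * K + (2 * real ?M + 1) * K / N) + (2 * real ?M + 1) * K / N) / N)"
      "(\<Sum>x\<in>{-(int ?M + 1) - 1..int ?M + 1 + 1}. \<bar>disorder_laplacian \<xi> N g x - f2 (x / N) / (\<gamma> * N)\<bar>)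
        \<le> ((2 * real ?M + 5) * K / (real N)\<^sup>2 + 2 * E N) / \<gamma>"
      "dirichlet_form \<xi> N (int ?M + 1) g \<le> (K + E N)\<^sup>2 * (2 * real ?M + 1 + 2 * w N) / (\<gamma> * (real N)\<^sup>2)"
      using supp q by (auto simp: E_def)
    note g(2)
    also have "(2 * real ?M + 3) / N * (2 * (w N * (2 * K + (2 * real ?M + 1) * K / N) + (2 * real ?M + 1) * K / N) / N)
        = (2 * r N + 3 * h N) * (2 * \<eta> N)"
      unfolding \<eta>_N unfolding r_def h_def using N by (simp add: add_divide_distrib)
    also have "\<dots> \<le> e" using elim(1) by simp
    finally have g2: "(\<Sum>x\<in>{-(int ?M + 1)..int ?M + 1}. \<bar>g x - f (x / N) / N\<bar>) \<le> e" .
    note g(3)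
    also have "((2 * real ?M + 5) * K / (real N)\<^sup>2 + 2 * E N) / \<gamma>
        = ((2 * r N + 5 * h N) * K * h N + 2 * E N) / \<gamma>"
      unfolding r_def h_def using N by (simp add: field_simps power2_eq_square)
    also have "\<dots> \<le> e" using elim(2) by simp
    finally have g3: "(\<Sum>x\<in>{-(int ?M + 1) - 1..int ?M + 1 + 1}.
        \<bar>disorder_laplacian \<xi> N g x - f2 (x / N) / (\<gamma> * N)\<bar>) \<le> e" .
    note g(4)
    also have "(K + E N)\<^sup>2 * (2 * real ?M + 1 + 2 * w N) / (\<gamma> * (real N)\<^sup>2)
        = (K + E N)\<^sup>2 * ((2 * r N + h N + 2 * v N) * h N) / \<gamma>"
      unfolding r_def h_def v_def using N by (simp add: field_simps power2_eq_square)
    also have "\<dots> \<le> e" using elim(3) by simp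
    finally have g4: "dirichlet_form \<xi> N (int ?M + 1) g \<le> e" .
    show ?case using g(1) g2 g3 g4 by (intro exI[of _ g]) (simp add: Let_def)
  qed
qed

end


section \<open>One time step of the second moment\<close>

text \<open>\<open>F i\<close> plays the i-th derivative; four are needed because the error of the
  symmetric average is of order \<delta>^4 F''''. Only the bound on \<open>F 4\<close> is recorded:
  averaging preserves it, and bounds on lower derivatives enter only in terms that vanish as N
  grows.\<close>

definition jet :: "real \<Rightarrow> real \<Rightarrow> (nat \<Rightarrow> real \<Rightarrow> real) \<Rightarrow> bool" where
  "jet R M F \<longleftrightarrow> (\<forall>i<4. \<forall>u. (F i has_real_derivative F (Suc i) u) (at u)) \<and>
     continuous_on UNIV (F 4) \<and> (\<forall>u. \<bar>F 4 u\<bar> \<le> M) \<and> (\<forall>i\<le>4. \<forall>u. \<bar>u\<bar> \<ge> R \<longrightarrow> F i u = 0)"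

text \<open>The heat kernel of \<gamma>^-1 \<Delta> at time \<tau> has variance 2\<tau>/\<gamma>.
  Matching it with the variance \<delta>^2 of one symmetric jump of size \<delta> gives the time
  step \<tau> = \<gamma> \<delta>^2 / 2.\<close>

definition avg :: "real \<Rightarrow> (real \<Rightarrow> real) \<Rightarrow> real \<Rightarrow> real" where
  "avg \<delta> f u = (f (u + \<delta>) + f (u - \<delta>)) / 2"

lemma jet_deriv: "jet R M F \<Longrightarrow> i < 4 \<Longrightarrow> (F i has_real_derivative F (Suc i) u) (at u)"
  by (simp add: jet_def)

lemma jet_deriv_numeral:
  assumes "jet R M F"
  shows "(F 0 has_real_derivative F 1 u) (at u)" "(F 1 has_real_derivative F 2 u) (at u)"
    "(F 2 has_real_derivative F 3 u) (at u)" "(F 3 has_real_derivative F 4 u) (at u)"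
  using jet_deriv[OF assms, of 0] jet_deriv[OF assms, of 1] jet_deriv[OF assms, of 2]
    jet_deriv[OF assms, of 3] by (simp_all add: numeral_eq_Suc)

lemma jet_bound: "jet R M F \<Longrightarrow> \<bar>F 4 u\<bar> \<le> M"
  by (simp add: jet_def)

lemma jet_support: "jet R M F \<Longrightarrow> i \<le> 4 \<Longrightarrow> \<bar>u\<bar> \<ge> R \<Longrightarrow> F i u = 0"
  by (simp add: jet_def)

lemma jet_mono: "jet R M F \<Longrightarrow> R \<le> R' \<Longrightarrow> jet R' M F"
  by (auto simp: jet_def)

lemma jet_continuous:
  assumes "jet R M F" "i \<le> 4"
  shows "continuous_on UNIV (F i)"
proof (cases "i = 4")
  case False
  then show ?thesis
    using assms jet_deriv[OF assms(1), of i] by (auto intro!: DERIV_continuous_on)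
qed (use assms in \<open>simp add: jet_def\<close>)

lemma continuous_support_bounded:
  fixes f :: "real \<Rightarrow> real"
  assumes "continuous_on UNIV f" "\<And>u. \<bar>u\<bar> \<ge> R \<Longrightarrow> f u = 0"
  obtains K where "K \<ge> 0" "\<And>u. \<bar>f u\<bar> \<le> K"
proof -
  have "compact (f ` {-R..R})"
    by (intro compact_continuous_image continuous_on_subset[OF assms(1)]) auto
  then have "bounded (f ` {-R..R})" by (rule compact_imp_bounded)
  then obtain K where "\<forall>y\<in>f ` {-R..R}. norm y \<le> K"
    unfolding bounded_iff by blast
  then have K: "\<bar>f u\<bar> \<le> K" if "u \<in> {-R..R}" for u
    using that by simp
  have "\<bar>f u\<bar> \<le> \<bar>K\<bar>" for u
  proof (cases "\<bar>u\<bar> \<ge> R")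
    case False
    then have "u \<in> {-R..R}" by auto
    then show ?thesis using K[of u] by linarith
  qed (use assms(2) in simp)
  then show thesis by (intro that[of "\<bar>K\<bar>"]) auto
qed

lemma jet_all_bounded:
  assumes "jet R M F"
  obtains K where "K \<ge> 0" "\<And>i u. i \<le> 4 \<Longrightarrow> \<bar>F i u\<bar> \<le> K"
proof -
  have "\<exists>K\<ge>0. \<forall>u. \<bar>F i u\<bar> \<le> K" if i: "i \<le> 4" for i
  proof -
    obtain K where "K \<ge> 0" "\<And>u. \<bar>F i u\<bar> \<le> K"
      using continuous_support_bounded[OF jet_continuous[OF assms i] jet_support[OF assms i]] by metis
    then show ?thesis by blast
  qed
  then have "\<forall>i\<in>{..4}. \<exists>K\<ge>0. \<forall>u. \<bar>F i u\<bar> \<le> K" by simp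
  from bchoice[OF this] obtain K
    where K: "\<And>i. i \<le> 4 \<Longrightarrow> K i \<ge> 0" "\<And>i u. i \<le> 4 \<Longrightarrow> \<bar>F i u\<bar> \<le> K i" by auto
  have "\<bar>F i u\<bar> \<le> (\<Sum>j\<le>4. K j)" if "i \<le> 4" for i u
  proof -
    have "K i \<le> (\<Sum>j\<le>4. K j)" by (rule member_le_sum) (use K(1) that in auto)
    then show ?thesis using K(2)[OF that, of u] by linarith
  qed
  then show thesis using K by (intro that[of "\<Sum>j\<le>4. K j"]) (auto intro: sum_nonneg)
qed

lemma jet_avg:
  assumes "jet R M F" "\<delta> \<ge> 0"
  shows "jet (R + \<delta>) M (\<lambda>i. avg \<delta> (F i))"
  unfolding jet_def
proof (intro conjI allI impI)
  fix i u assume "i < (4::nat)"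
  then have d: "(F i has_real_derivative F (Suc i) v) (at v)" for v
    using assms(1) by (simp add: jet_def)
  have "((\<lambda>u. F i (u + \<delta>)) has_real_derivative F (Suc i) (u + \<delta>)) (at u)"
    "((\<lambda>u. F i (u - \<delta>)) has_real_derivative F (Suc i) (u - \<delta>)) (at u)"
    using d[of "u + \<delta>"] d[of "u - \<delta>"] DERIV_shift[of "F i" _ u \<delta>] DERIV_shift[of "F i" _ u "-\<delta>"]
    by simp_all
  then show "(avg \<delta> (F i) has_real_derivative avg \<delta> (F (Suc i)) u) (at u)"
    unfolding avg_def[abs_def] by (intro derivative_eq_intros) auto
next
  have c: "continuous_on UNIV (\<lambda>u. F 4 (h u))" if "continuous_on UNIV h" for h :: "real \<Rightarrow> real"
    using assms(1) that by (auto simp: jet_def intro: continuous_on_compose2[where t = UNIV])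
  show "continuous_on UNIV (avg \<delta> (F 4))"
    unfolding avg_def[abs_def] by (intro continuous_on_divide continuous_on_add c continuous_intros) auto
next
  fix u
  show "\<bar>avg \<delta> (F 4) u\<bar> \<le> M"
    using jet_bound[OF assms(1), of "u + \<delta>"] jet_bound[OF assms(1), of "u - \<delta>"]
    by (simp add: avg_def)
next
  fix i u assume "i \<le> (4::nat)" "R + \<delta> \<le> \<bar>u\<bar>"
  then show "avg \<delta> (F i) u = 0"
    using jet_support[OF assms(1), of i "u + \<delta>"] jet_support[OF assms(1), of i "u - \<delta>"] assms(2)
    by (auto simp: avg_def)
qed

text \<open>Odd Taylor terms cancel between the two shifts; the Lagrange remainders leave
  coefficients 1/24 and 1/2, rounded up to 1.\<close>

lemma avg_taylor:
  assumes "jet R M F" "\<delta> > 0"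
  shows "\<bar>avg \<delta> (F 0) u - F 0 u - \<delta>\<^sup>2 / 2 * F 2 u\<bar> \<le> M * \<delta> ^ 4"
    and "\<bar>avg \<delta> (F 2) u - F 2 u\<bar> \<le> M * \<delta>\<^sup>2"
proof -
  note d = jet_deriv[OF assms(1)] and b = jet_bound[OF assms(1)]
  have M: "M \<ge> 0" using b[of 0] by linarith
  have \<delta>_abs: "\<bar>\<delta> ^ 4\<bar> \<le> \<delta> ^ 4" "\<bar>\<delta>\<^sup>2\<bar> \<le> \<delta>\<^sup>2" by simp_all
  have "\<exists>t>u. t < u + \<delta> \<and> F 0 (u + \<delta>) = (\<Sum>m<4. F m u / fact m * (u + \<delta> - u) ^ m) + F 4 t / fact 4 * (u + \<delta> - u) ^ 4"
    using assms(2) by (intro Taylor_up[where a = u]) (auto simp: d)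
  then obtain t where t: "F 0 (u + \<delta>) = F 0 u + F 1 u * \<delta> + F 2 u / 2 * \<delta>\<^sup>2 + F 3 u / 6 * \<delta> ^ 3 + F 4 t / 24 * \<delta> ^ 4"
    by (auto simp: eval_nat_numeral lessThan_Suc)
  have "\<exists>t>u - \<delta>. t < u \<and> F 0 (u - \<delta>) = (\<Sum>m<4. F m u / fact m * (u - \<delta> - u) ^ m) + F 4 t / fact 4 * (u - \<delta> - u) ^ 4"
    using assms(2) by (intro Taylor_down[where b = u]) (auto simp: d)
  then obtain t' where t': "F 0 (u - \<delta>) = F 0 u - F 1 u * \<delta> + F 2 u / 2 * \<delta>\<^sup>2 - F 3 u / 6 * \<delta> ^ 3 + F 4 t' / 24 * \<delta> ^ 4"
    by (auto simp: eval_nat_numeral lessThan_Suc)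
  have eq: "avg \<delta> (F 0) u - F 0 u - \<delta>\<^sup>2 / 2 * F 2 u = (F 4 t + F 4 t') / 48 * \<delta> ^ 4"
    unfolding avg_def t t' by (simp add: algebra_simps add_divide_distrib)
  have "\<bar>(F 4 t + F 4 t') / 48\<bar> \<le> M" using b[of t] b[of t'] M by simp
  then show "\<bar>avg \<delta> (F 0) u - F 0 u - \<delta>\<^sup>2 / 2 * F 2 u\<bar> \<le> M * \<delta> ^ 4"
    unfolding eq abs_mult using M \<delta>_abs by (intro mult_mono) auto
  have "\<exists>t>u. t < u + \<delta> \<and> F 2 (u + \<delta>) = (\<Sum>m<2. F (m + 2) u / fact m * (u + \<delta> - u) ^ m) + F (2 + 2) t / fact 2 * (u + \<delta> - u) ^ 2"
    using assms(2) by (intro Taylor_up[where a = u and diff = "\<lambda>m. F (m + 2)"]) (auto simp: d numeral_2_eq_2)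
  then obtain t where t: "F 2 (u + \<delta>) = F 2 u + F 3 u * \<delta> + F 4 t / 2 * \<delta>\<^sup>2"
    by (auto simp: eval_nat_numeral lessThan_Suc)
  have "\<exists>t>u - \<delta>. t < u \<and> F 2 (u - \<delta>) = (\<Sum>m<2. F (m + 2) u / fact m * (u - \<delta> - u) ^ m) + F (2 + 2) t / fact 2 * (u - \<delta> - u) ^ 2"
    using assms(2) by (intro Taylor_down[where b = u and diff = "\<lambda>m. F (m + 2)"]) (auto simp: d numeral_2_eq_2)
  then obtain t' where t': "F 2 (u - \<delta>) = F 2 u - F 3 u * \<delta> + F 4 t' / 2 * \<delta>\<^sup>2"
    by (auto simp: eval_nat_numeral lessThan_Suc)
  have eq: "avg \<delta> (F 2) u - F 2 u = (F 4 t + F 4 t') / 4 * \<delta>\<^sup>2"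
    unfolding avg_def t t' by (simp add: algebra_simps add_divide_distrib)
  have "\<bar>(F 4 t + F 4 t') / 4\<bar> \<le> M" using b[of t] b[of t'] M by simp
  then show "\<bar>avg \<delta> (F 2) u - F 2 u\<bar> \<le> M * \<delta>\<^sup>2"
    unfolding eq abs_mult using M \<delta>_abs by (intro mult_mono) auto
qed

text \<open>The window radius \<open>R\<close> is separate from the test function, so that averages
  with growing supports share one window; \<open>z\<close> is free, so that one constant serves all
  times.\<close>

definition second_moment ::
    "(real \<Rightarrow> config) measure \<Rightarrow> nat \<Rightarrow> real \<Rightarrow> real \<Rightarrow> (real \<Rightarrow> real) \<Rightarrow> real \<Rightarrow> real" where
  "second_moment P N R s f z =
     (\<integral>\<omega>. (linear_statistic (int (lattice_radius R N) + 1) (\<lambda>x. f (x / N) / N) (\<omega> s) - z)\<^sup>2 \<partial>P)"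

lemma (in exclusion_process) second_moment_eq_mean:
  assumes "s \<ge> 0"
  shows "second_moment P N R s f z =
    mean (\<lambda>\<eta>. (linear_statistic (int (lattice_radius R N) + 1) (\<lambda>x. f (x / N) / N) \<eta> - z)\<^sup>2) s"
  unfolding second_moment_def using assms
  by (subst mean_eq)
    (auto simp: power2_eq_square intro!: cylinder_times cylinder_minus cylinder_linear_statistic cylinder_const)

lemma (in exclusion_process) mean_mono:
  assumes "s \<ge> 0" "cylinder f" "cylinder g" "\<And>\<eta>. f \<eta> \<le> g \<eta> + c"
  shows "mean f s \<le> mean g s + c"
proof -
  interpret M: prob_space "marginal s" by (rule prob_space_marginal) fact
  have "mean f s \<le> (LINT \<eta>|marginal s. g \<eta> + c)"
    unfolding mean_def using assms
    by (intro integral_mono Bochner_Integration.integrable_add integrable_cylinder) (auto simp: cylinder_const)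
  also have "\<dots> = mean g s + c"
    using integrable_cylinder[OF assms(1,3)] M.prob_space by (simp add: mean_def)
  finally show ?thesis .
qed

lemma square_perturbation:
  fixes a b :: real
  assumes "\<bar>a - b\<bar> \<le> e" "\<bar>a\<bar> \<le> C"
  shows "a\<^sup>2 \<le> b\<^sup>2 + e * (2 * C + e)" "b\<^sup>2 \<le> a\<^sup>2 + e * (2 * C + e)"
proof -
  have "\<bar>a + b\<bar> \<le> 2 * C + e" using assms by linarith
  then have "\<bar>(a - b) * (a + b)\<bar> \<le> e * (2 * C + e)"
    unfolding abs_mult using assms by (intro mult_mono) auto
  moreover have "(a - b) * (a + b) = a\<^sup>2 - b\<^sup>2" by (simp add: power2_eq_square algebra_simps)
  ultimately show "a\<^sup>2 \<le> b\<^sup>2 + e * (2 * C + e)" "b\<^sup>2 \<le> a\<^sup>2 + e * (2 * C + e)" by linarith+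
qed

lemma linear_statistic_diff_bound:
  "\<bar>linear_statistic n g \<eta> - linear_statistic n h \<eta>\<bar> \<le> (\<Sum>x\<in>{-n..n}. \<bar>g x - h x\<bar>)"
  using linear_statistic_bound[of n "\<lambda>x. 1 * g x + (-1) * h x" \<eta>] unfolding linear_statistic_add by simp

context bond_disorder
begin

text \<open>Residual of the averaging scheme in the backward heat equation: 3 M \<delta>^2 /
  \<gamma> per site (2M from the time difference quotient, M from comparing the two second
  derivatives), over at most (2R + 7) N sites of weight 1/N.\<close>

definition step_error :: "real \<Rightarrow> real \<Rightarrow> real \<Rightarrow> real" where
  "step_error R M \<delta> = (2 * R + 7) * (3 * M * \<delta>\<^sup>2 / \<gamma>)"

text \<open>The energy estimate is applied to corrected versions of the average of
  \<open>F 0\<close> at time \<open>s\<close> and of \<open>F 0\<close> at time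
  \<open>s + \<tau>\<close>: the test function moves backwards while the process moves forwards. The
  threshold on N depends neither on the process nor on \<open>s\<close>, which allows the step to be
  repeated.\<close>

lemma second_moment_step:
  assumes F: "jet R M F" and \<delta>: "\<delta> > 0" and R: "R > 0" "R + \<delta> \<le> R0" and e: "e > 0"
  defines "\<tau> \<equiv> \<gamma> * \<delta>\<^sup>2 / 2"
  shows "\<forall>\<^sub>F N in sequentially. \<forall>P S \<mu> s. exclusion_process P \<xi> N S \<mu> \<longrightarrow> s \<ge> 0 \<longrightarrow>
    second_moment P N R0 (s + \<tau>) (F 0) z
      \<le> exp \<tau> * (second_moment P N R0 s (avg \<delta> (F 0)) z + \<tau> * (step_error R0 M \<delta>)\<^sup>2) + e"
proof -
  define F' where "F' i = avg \<delta> (F i)" for i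
  have \<tau>: "\<tau> > 0" using \<delta> \<gamma>_pos by (simp add: \<tau>_def)
  have jF: "jet R0 M F" using F R \<delta> by (auto intro: jet_mono)
  have jF': "jet R0 M F'"
    unfolding F'_def[abs_def] by (rule jet_mono[OF jet_avg[OF F]]) (use \<delta> R in auto)
  obtain K1 where K1: "K1 \<ge> 0" "\<And>i u. i \<le> 4 \<Longrightarrow> \<bar>F i u\<bar> \<le> K1" using jet_all_bounded[OF jF] by blast
  obtain K2 where K2: "K2 \<ge> 0" "\<And>i u. i \<le> 4 \<Longrightarrow> \<bar>F' i u\<bar> \<le> K2" using jet_all_bounded[OF jF'] by blast
  define K where "K = K1 + K2"
  have K: "K \<ge> 0" "\<And>i u. i \<le> 4 \<Longrightarrow> \<bar>F i u\<bar> \<le> K" "\<And>i u. i \<le> 4 \<Longrightarrow> \<bar>F' i u\<bar> \<le> K"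
    using K1 K2 by (auto simp: K_def add_increasing add_increasing2)
  define C where "C = K * (2 * R0 + 5) + \<bar>z\<bar>"
  let ?E = "step_error R0 M \<delta>"
  \<comment> \<open>Total cost of replacing the test functions by corrected ones up to accuracy
    \<open>d\<close>. It vanishes with \<open>d\<close>, so \<open>d\<close> can be fixed before N
    is sent to infinity.\<close>
  define \<Phi> where "\<Phi> d = exp \<tau> * (d * (2 * C + d) + \<tau> * ((?E + d * (1 + 2 / \<tau>))\<^sup>2 - ?E\<^sup>2 + d)) + d * (2 * C + d)" for d
  have "(\<Phi> \<longlongrightarrow> 0) (at_right 0)"
    unfolding \<Phi>_def by (rule tendsto_eq_intros refl | simp)+
  then have "\<forall>\<^sub>F d in at_right 0. \<Phi> d < e" using e by (rule order_tendstoD)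
  then obtain d where d: "d > 0" "\<Phi> d < e"
    unfolding eventually_at_right_field using dense by blast
  have R0: "R0 > 0" using R \<delta> by simp
  have T: "\<forall>\<^sub>F N in sequentially. \<exists>g. let n = int (lattice_radius R0 N) + 1 in
    (\<forall>x. x \<notin> {-n..n} \<longrightarrow> g x = 0) \<and>
    (\<Sum>x\<in>{-n..n}. \<bar>g x - H 0 (x / N) / N\<bar>) \<le> d \<and>
    (\<Sum>x\<in>{-n-1..n+1}. \<bar>disorder_laplacian \<xi> N g x - H 2 (x / N) / (\<gamma> * N)\<bar>) \<le> d \<and>
    dirichlet_form \<xi> N n g \<le> d" if "jet R0 M H" "\<forall>i\<le>4. \<forall>u. \<bar>H i u\<bar> \<le> K" for H
    by (rule corrected_test_function[where ?f1.0 = "H 1" and ?f3.0 = "H 3" and K = K])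
      (use R0 d(1) jet_deriv_numeral[OF that(1)] jet_support[OF that(1)] that(2) in auto)
  have "\<forall>i\<le>4. \<forall>u. \<bar>F i u\<bar> \<le> K" "\<forall>i\<le>4. \<forall>u. \<bar>F' i u\<bar> \<le> K" using K by auto
  from T[OF jF this(1)] T[OF jF' this(2)] show ?thesis using eventually_gt_at_top[of "0::nat"]
  proof eventually_elim
    case (elim N)
    define n where "n = int (lattice_radius R0 N) + 1"
    define c1 where "c1 x = F 0 (real_of_int x / N) / N" for x
    define c0 where "c0 x = F' 0 (real_of_int x / N) / N" for x
    have N: "real N > 0" "N \<ge> 1" using elim by auto
    obtain g1 where g1: "\<And>x. x \<notin> {-n..n} \<Longrightarrow> g1 x = 0"
      "(\<Sum>x\<in>{-n..n}. \<bar>g1 x - c1 x\<bar>) \<le> d"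
      "(\<Sum>x\<in>{-n-1..n+1}. \<bar>disorder_laplacian \<xi> N g1 x - F 2 (x / N) / (\<gamma> * N)\<bar>) \<le> d"
      "dirichlet_form \<xi> N n g1 \<le> d"
      using elim(1) unfolding Let_def n_def[symmetric] by (elim exE conjE) (rule that; simp add: c1_def)
    obtain g0 where g0: "\<And>x. x \<notin> {-n..n} \<Longrightarrow> g0 x = 0"
      "(\<Sum>x\<in>{-n..n}. \<bar>g0 x - c0 x\<bar>) \<le> d"
      "(\<Sum>x\<in>{-n-1..n+1}. \<bar>disorder_laplacian \<xi> N g0 x - F' 2 (x / N) / (\<gamma> * N)\<bar>) \<le> d"
      "dirichlet_form \<xi> N n g0 \<le> d"
      using elim(2) unfolding Let_def n_def[symmetric] by (elim exE conjE) (rule that; simp add: c0_def)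
    have n: "R0 * N + 1 \<le> n" "n \<le> R0 * N + 2"
      using lattice_radius_bounds[of R0 N] R0 by (auto simp: n_def)
    have far: "c1 x = 0" "c0 x = 0" if "x \<notin> {-n..n}" for x
    proof -
      have "R0 * N \<le> \<bar>real_of_int x\<bar>" using that n(1) by auto
      then have "\<bar>real_of_int x / N\<bar> \<ge> R0" using N by (simp add: abs_divide pos_le_divide_eq)
      then show "c1 x = 0" "c0 x = 0"
        using jet_support[OF jF, of 0] jet_support[OF jF', of 0] by (auto simp: c1_def c0_def)
    qed
    have wide: "(\<Sum>x\<in>{-n-1..n+1}. \<bar>g x - c x\<bar>) = (\<Sum>x\<in>{-n..n}. \<bar>g x - c x\<bar>)"
      if "\<And>x. x \<notin> {-n..n} \<Longrightarrow> g x = 0 \<and> c x = (0::real)" for g c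
      by (rule sum.mono_neutral_right) (use that in auto)
    \<comment> \<open>\<open>H\<close> may be either second derivative because the energy estimate
      asks for the residual at both ends of the time step.\<close>
    have site: "\<bar>(c1 x - c0 x) / \<tau> + H / (\<gamma> * N)\<bar> \<le> 3 * M * \<delta>\<^sup>2 / \<gamma> / N"
      if H: "H = F 2 (x / N) \<or> H = F' 2 (x / N)" for x H
    proof -
      let ?u = "real_of_int x / N"
      have M: "M \<ge> 0" using jet_bound[OF jF, of 0] by linarith
      \<comment> \<open>Since \<tau> = \<gamma> \<delta>^2 / 2, the time difference quotient (c1 -
        c0)/\<tau> equals -X/(\<gamma> N), and the Taylor estimate compares X with the second
        derivative.\<close>
      define X where "X = (2 / \<delta>\<^sup>2) * (F' 0 ?u - F 0 ?u)"
      have "\<bar>H - F 2 ?u\<bar> \<le> M * \<delta>\<^sup>2"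
        using H avg_taylor(2)[OF jF \<delta>, of ?u] M by (auto simp: F'_def)
      moreover have "\<bar>X - F 2 ?u\<bar> \<le> 2 * (M * \<delta>\<^sup>2)"
      proof -
        have "X - F 2 ?u = (2 / \<delta>\<^sup>2) * (F' 0 ?u - F 0 ?u - \<delta>\<^sup>2 / 2 * F 2 ?u)"
          using \<delta> by (simp add: X_def field_simps)
        then have "\<bar>X - F 2 ?u\<bar> = (2 / \<delta>\<^sup>2) * \<bar>F' 0 ?u - F 0 ?u - \<delta>\<^sup>2 / 2 * F 2 ?u\<bar>"
          by (simp only: abs_mult) simp
        also have "\<dots> \<le> (2 / \<delta>\<^sup>2) * (M * \<delta> ^ 4)"
          using avg_taylor(1)[OF jF \<delta>, of ?u] by (intro mult_left_mono) (auto simp: F'_def)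
        also have "\<dots> = 2 * (M * \<delta>\<^sup>2)"
          using \<delta> by (simp add: power2_eq_square eval_nat_numeral)
        finally show ?thesis .
      qed
      ultimately have "\<bar>H - X\<bar> \<le> 3 * M * \<delta>\<^sup>2" by linarith
      moreover have "(c1 x - c0 x) / \<tau> + H / (\<gamma> * N) = (H - X) / (\<gamma> * N)"
        using \<delta> \<gamma>_pos N by (simp add: X_def c1_def c0_def \<tau>_def field_simps)
      ultimately show ?thesis
        using \<gamma>_pos N by (simp add: abs_divide abs_mult divide_right_mono)
    qed
    have small: "(\<Sum>x\<in>{-n-1..n+1}. \<bar>(g1 x - g0 x) / \<tau> + disorder_laplacian \<xi> N g x\<bar>) \<le> ?E + d * (1 + 2 / \<tau>)"
      if H: "\<And>x. H x = F 2 (x / N) \<or> H x = F' 2 (x / N)"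
        and g: "(\<Sum>x\<in>{-n-1..n+1}. \<bar>disorder_laplacian \<xi> N g x - H x / (\<gamma> * N)\<bar>) \<le> d" for g H
    proof -
      have "(\<Sum>x\<in>{-n-1..n+1}. \<bar>(g1 x - g0 x) / \<tau> + disorder_laplacian \<xi> N g x\<bar>)
          \<le> (\<Sum>x\<in>{-n-1..n+1}. \<bar>g1 x - c1 x\<bar> / \<tau> + \<bar>g0 x - c0 x\<bar> / \<tau>
              + \<bar>disorder_laplacian \<xi> N g x - H x / (\<gamma> * N)\<bar> + 3 * M * \<delta>\<^sup>2 / \<gamma> / N)"
      proof (rule sum_mono)
        fix x
        have "(g1 x - g0 x) / \<tau> + disorder_laplacian \<xi> N g x
          = (g1 x - c1 x) / \<tau> - (g0 x - c0 x) / \<tau> + (disorder_laplacian \<xi> N g x - H x / (\<gamma> * N))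
            + ((c1 x - c0 x) / \<tau> + H x / (\<gamma> * N))"
          by (simp add: diff_divide_distrib)
        moreover have "\<bar>(g1 x - c1 x) / \<tau>\<bar> = \<bar>g1 x - c1 x\<bar> / \<tau>" "\<bar>(g0 x - c0 x) / \<tau>\<bar> = \<bar>g0 x - c0 x\<bar> / \<tau>"
          using \<tau> by (simp_all add: abs_divide)
        ultimately show "\<bar>(g1 x - g0 x) / \<tau> + disorder_laplacian \<xi> N g x\<bar>
            \<le> \<bar>g1 x - c1 x\<bar> / \<tau> + \<bar>g0 x - c0 x\<bar> / \<tau>
              + \<bar>disorder_laplacian \<xi> N g x - H x / (\<gamma> * N)\<bar> + 3 * M * \<delta>\<^sup>2 / \<gamma> / N"
          using site[OF H[of x]] by linarith
      qed
      also have "\<dots> = (\<Sum>x\<in>{-n..n}. \<bar>g1 x - c1 x\<bar>) / \<tau> + (\<Sum>x\<in>{-n..n}. \<bar>g0 x - c0 x\<bar>) / \<tau>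
          + (\<Sum>x\<in>{-n-1..n+1}. \<bar>disorder_laplacian \<xi> N g x - H x / (\<gamma> * N)\<bar>)
          + (2 * n + 3) / N * (3 * M * \<delta>\<^sup>2 / \<gamma>)"
        using wide[of g1 c1] wide[of g0 c0] g1(1) g0(1) far n(1) R0
        by (simp add: sum.distrib sum_divide_distrib[symmetric] n_def)
      also have "\<dots> \<le> d / \<tau> + d / \<tau> + d + (2 * R0 + 7) * (3 * M * \<delta>\<^sup>2 / \<gamma>)"
      proof (intro add_mono divide_right_mono g1 g0 g mult_right_mono)
        \<comment> \<open>Here n \<le> R0 N + 2, and the constant 7 = 2 * 2 + 3 is absorbed by N
          \<ge> 1.\<close>
        have "2 * real_of_int n + 3 \<le> (2 * R0 + 7) * N"
          using n(2) N(2) by (simp add: algebra_simps)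
        then show "(2 * n + 3) / N \<le> 2 * R0 + 7" using N by (simp add: pos_divide_le_eq)
        show "0 \<le> 3 * M * \<delta>\<^sup>2 / \<gamma>" using jet_bound[OF jF, of 0] \<gamma>_pos by auto
      qed (use \<tau> in auto)
      finally show ?thesis by (simp add: step_error_def algebra_simps)
    qed
    have size: "\<bar>linear_statistic n c \<eta> - z\<bar> \<le> C" if c: "\<And>x. \<bar>c x\<bar> \<le> K / N" for c \<eta>
    proof -
      have "\<bar>linear_statistic n c \<eta>\<bar> \<le> (\<Sum>x\<in>{-n..n}. K / N)"
        by (intro order_trans[OF linear_statistic_bound] sum_mono c)
      also have "\<dots> = (2 * n + 1) * (K / N)" using n(1) R0 by (simp add: n_def)
      also have "\<dots> \<le> ((2 * R0 + 5) * N) * (K / N)"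
        using n(2) N K(1) by (intro mult_right_mono) (auto simp: algebra_simps)
      also have "\<dots> = K * (2 * R0 + 5)" using N by simp
      finally show ?thesis unfolding C_def by linarith
    qed
    have c_size: "\<bar>c1 x\<bar> \<le> K / N" "\<bar>c0 x\<bar> \<le> K / N" for x
      using K(2)[of 0] K(3)[of 0] N by (auto simp: c1_def c0_def abs_divide divide_right_mono)
    show ?case
    proof (intro allI impI)
      fix P S \<mu> s assume "exclusion_process P \<xi> N S \<mu>" and s: "s \<ge> (0::real)"
      then interpret exclusion_process P \<xi> N S \<mu> by simp
      let ?q = "\<lambda>g \<eta>. (linear_statistic n g \<eta> - z)\<^sup>2"
      have cyl: "cylinder (?q g)" for g
        unfolding power2_eq_square
        by (intro cylinder_times cylinder_minus cylinder_linear_statistic cylinder_const)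
      let ?r = "d * (2 * C + d)"
      have m1: "mean (?q c1) (s + \<tau>) \<le> mean (?q g1) (s + \<tau>) + ?r"
      proof (rule mean_mono)
        fix \<eta>
        have "\<bar>(linear_statistic n c1 \<eta> - z) - (linear_statistic n g1 \<eta> - z)\<bar> \<le> d"
          using order_trans[OF linear_statistic_diff_bound[of n g1 \<eta> c1] g1(2)] by linarith
        then show "?q c1 \<eta> \<le> ?q g1 \<eta> + ?r" using size[OF c_size(1)] by (rule square_perturbation)
      qed (use s \<tau> cyl in auto)
      have m0: "mean (?q g0) s \<le> mean (?q c0) s + ?r"
      proof (rule mean_mono)
        fix \<eta>
        have "\<bar>(linear_statistic n c0 \<eta> - z) - (linear_statistic n g0 \<eta> - z)\<bar> \<le> d"
          using order_trans[OF linear_statistic_diff_bound[of n g0 \<eta> c0] g0(2)] by linarith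
        then show "?q g0 \<eta> \<le> ?q c0 \<eta> + ?r" using size[OF c_size(2)] by (rule square_perturbation)
      qed (use s \<tau> cyl in auto)
      have "mean (?q g1) (s + \<tau>) \<le> exp \<tau> * (mean (?q g0) s + \<tau> * ((?E + d * (1 + 2 / \<tau>))\<^sup>2 + d))"
        using \<xi>_pos s \<tau> g0(1) g1(1) small[of "\<lambda>x. F' 2 (x / N)" g0, OF _ g0(3)]
          small[of "\<lambda>x. F 2 (x / N)" g1, OF _ g1(3)] g0(4) g1(4)
        by (intro energy_step) auto
      also have "\<dots> \<le> exp \<tau> * (mean (?q c0) s + ?r + \<tau> * ((?E + d * (1 + 2 / \<tau>))\<^sup>2 + d))"
        using m0 by (intro mult_left_mono) auto
      finally have "mean (?q c1) (s + \<tau>)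
          \<le> exp \<tau> * (mean (?q c0) s + ?r + \<tau> * ((?E + d * (1 + 2 / \<tau>))\<^sup>2 + d)) + ?r"
        using m1 by linarith
      also have "\<dots> = exp \<tau> * (mean (?q c0) s + \<tau> * ?E\<^sup>2) + \<Phi> d"
        unfolding \<Phi>_def by (simp add: algebra_simps)
      also have "\<dots> \<le> exp \<tau> * (mean (?q c0) s + \<tau> * ?E\<^sup>2) + e" using d(2) by simp
      finally show "second_moment P N R0 (s + \<tau>) (F 0) z
          \<le> exp \<tau> * (second_moment P N R0 s (avg \<delta> (F 0)) z + \<tau> * ?E\<^sup>2) + e"
        using s \<tau> by (simp add: second_moment_eq_mean n_def c1_def[abs_def] c0_def[abs_def] F'_def)
    qed
  qed
qed

text \<open>The induction generalises over \<open>F\<close>, \<open>R\<close> and \<open>e\<close>,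
  since one step passes to the average of \<open>F\<close> on a larger support. The target
  \<open>Z\<close> of the k-fold average stays the same along the recursion. Of the slack, e/2 is
  spent on the step and e/2/exp(\<tau>) is left to the induction hypothesis, whose error the step
  multiplies by exp(\<tau>).\<close>

lemma second_moment_iterate:
  assumes initial: "\<And>f e. continuous_on UNIV f \<Longrightarrow> (\<And>u. \<bar>u\<bar> \<ge> R0 \<Longrightarrow> f u = 0) \<Longrightarrow> e > 0 \<Longrightarrow>
      \<forall>\<^sub>F N in sequentially. \<forall>P S. exclusion_process P \<xi> N S (\<mu> N) \<longrightarrow> second_moment P N R0 0 f (Z f) \<le> e"
    and \<delta>: "\<delta> > 0"
  defines "\<tau> \<equiv> \<gamma> * \<delta>\<^sup>2 / 2"
  shows "jet R M F \<Longrightarrow> R > 0 \<Longrightarrow> R + real k * \<delta> \<le> R0 \<Longrightarrow> e > 0 \<Longrightarrow>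
    \<forall>\<^sub>F N in sequentially. \<forall>P S. exclusion_process P \<xi> N S (\<mu> N) \<longrightarrow>
      second_moment P N R0 (real k * \<tau>) (F 0) (Z ((avg \<delta> ^^ k) (F 0)))
        \<le> exp (real k * \<tau>) * (real k * \<tau> * (step_error R0 M \<delta>)\<^sup>2) + e"
proof (induction k arbitrary: F R e)
  case 0
  then show ?case
    using initial[of "F 0" e] jet_continuous[of R M F 0] jet_support[of R M F 0] by simp
next
  case (Suc k)
  let ?z = "Z ((avg \<delta> ^^ k) (avg \<delta> (F 0)))" and ?E = "(step_error R0 M \<delta>)\<^sup>2"
  have \<tau>: "\<tau> > 0" using \<delta> \<gamma>_pos by (simp add: \<tau>_def)
  have "R + \<delta> \<le> R0" using Suc.prems(3) \<delta> by (simp add: algebra_simps add_increasing2)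
      (smt (verit) mult_nonneg_nonneg of_nat_0_le_iff)
  then have step: "\<forall>\<^sub>F N in sequentially. \<forall>P S \<mu> s. exclusion_process P \<xi> N S \<mu> \<longrightarrow> s \<ge> 0 \<longrightarrow>
    second_moment P N R0 (s + \<tau>) (F 0) ?z
      \<le> exp \<tau> * (second_moment P N R0 s (avg \<delta> (F 0)) ?z + \<tau> * ?E) + e / 2"
    unfolding \<tau>_def using Suc.prems \<delta> by (intro second_moment_step) auto
  have IH: "\<forall>\<^sub>F N in sequentially. \<forall>P S. exclusion_process P \<xi> N S (\<mu> N) \<longrightarrow>
      second_moment P N R0 (real k * \<tau>) (avg \<delta> (F 0)) ?z
        \<le> exp (real k * \<tau>) * (real k * \<tau> * ?E) + e / 2 / exp \<tau>"
    using Suc.prems \<delta> jet_avg[of R M F \<delta>]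
    by (intro Suc.IH[where R = "R + \<delta>"]) (auto simp: algebra_simps)
  show ?case using step IH
  proof eventually_elim
    case (elim N)
    show ?case
    proof (intro allI impI)
      fix P S assume ex: "exclusion_process P \<xi> N S (\<mu> N)"
      have "second_moment P N R0 (real k * \<tau> + \<tau>) (F 0) ?z
          \<le> exp \<tau> * (second_moment P N R0 (real k * \<tau>) (avg \<delta> (F 0)) ?z + \<tau> * ?E) + e / 2"
        using elim(1) ex \<tau> by (meson less_imp_le mult_nonneg_nonneg of_nat_0_le_iff)
      also have "\<dots> \<le> exp \<tau> * (exp (real k * \<tau>) * (real k * \<tau> * ?E) + e / 2 / exp \<tau>
          + exp (real k * \<tau>) * (\<tau> * ?E)) + e / 2"
      proof (intro add_mono mult_left_mono order_refl)
        show "second_moment P N R0 (real k * \<tau>) (avg \<delta> (F 0)) ?z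
          \<le> exp (real k * \<tau>) * (real k * \<tau> * ?E) + e / 2 / exp \<tau>" using elim(2) ex by blast
        show "\<tau> * ?E \<le> exp (real k * \<tau>) * (\<tau> * ?E)"
          using mult_right_mono[of 1 "exp (real k * \<tau>)" "\<tau> * ?E"] \<tau> by simp
      qed auto
      also have "\<dots> = exp (real (Suc k) * \<tau>) * (real (Suc k) * \<tau> * ?E) + e"
        by (simp add: algebra_simps exp_add)
      finally show "second_moment P N R0 (real (Suc k) * \<tau>) (F 0) (Z ((avg \<delta> ^^ Suc k) (F 0)))
          \<le> exp (real (Suc k) * \<tau>) * (real (Suc k) * \<tau> * ?E) + e"
        by (simp add: funpow_Suc_right algebra_simps del: funpow.simps)
    qed
  qed
qed

end


section \<open>The law of large numbers at time zero\<close>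

text \<open>Outside a null set the limit holds everywhere; inside it every subset is measurable by
  completeness. For Riemann sums this supplies measurability of the integrand, of which only almost
  everywhere continuity is given.\<close>

lemma measurable_AE_limit_lebesgue:
  fixes s :: "nat \<Rightarrow> real \<Rightarrow> real" and h :: "real \<Rightarrow> real"
  assumes s: "\<And>n. s n \<in> borel_measurable lebesgue"
    and lim: "AE u in lebesgue. (\<lambda>n. s n u) \<longlonglongrightarrow> h u"
  shows "h \<in> borel_measurable lebesgue"
proof -
  obtain A where A: "{u. \<not> (\<lambda>n. s n u) \<longlonglongrightarrow> h u} \<subseteq> A" "A \<in> null_sets lebesgue"
    using lim unfolding eventually_ae_filter by auto
  have m0: "(\<lambda>u. h u * indicator (- A) u) \<in> borel_measurable lebesgue"
  proof (rule borel_measurable_LIMSEQ_metric)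
    show "(\<lambda>u. s n u * indicator (- A) u) \<in> borel_measurable lebesgue" for n
      using s A(2) by (intro borel_measurable_times borel_measurable_indicator) (auto simp: null_sets_def Compl_in_sets_lebesgue)
    show "(\<lambda>n. s n u * indicator (- A) u) \<longlonglongrightarrow> h u * indicator (- A) u" for u
      using A(1) by (cases "u \<in> A") auto
  qed
  have m: "{u. h u * indicator (- A) u \<in> B} \<in> sets lebesgue" if "B \<in> sets borel" for B
    using measurable_sets[OF m0 that] by (simp add: vimage_def)
  have "h -` B \<inter> space lebesgue \<in> sets lebesgue" if B: "B \<in> sets borel" for B
  proof -
    have 1: "{u\<in>A. h u \<in> B} \<in> sets lebesgue"
      by (rule null_setsD2[OF completion.complete2[OF _ A(2)]]) auto
    have 2: "{u. h u * indicator (- A) u \<in> B} - A \<in> sets lebesgue"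
      using m[OF B] A(2) by auto
    have "h -` B \<inter> space lebesgue = ({u. h u * indicator (- A) u \<in> B} - A) \<union> {u\<in>A. h u \<in> B}"
    proof (rule set_eqI)
      fix u show "u \<in> h -` B \<inter> space lebesgue \<longleftrightarrow> u \<in> ({u. h u * indicator (- A) u \<in> B} - A) \<union> {u\<in>A. h u \<in> B}"
        by (cases "u \<in> A") simp_all
    qed
    then show ?thesis using sets.Un[OF 2 1] by (simp only:)
  qed
  then show ?thesis by (intro measurableI) auto
qed

section \<open>Riemann sums of almost everywhere continuous functions\<close>

lemma floor_ratio_limit: "(\<lambda>N. real_of_int \<lfloor>real N * u\<rfloor> / real N) \<longlonglongrightarrow> u"
proof (rule tendsto_sandwich)
  show "\<forall>\<^sub>F N in sequentially. u - 1 / real N \<le> real_of_int \<lfloor>real N * u\<rfloor> / real N"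
    using eventually_gt_at_top[of "0::nat"]
  proof eventually_elim
    case (elim N)
    have "real N * u - 1 \<le> real_of_int \<lfloor>real N * u\<rfloor>" by linarith
    then have "(real N * u - 1) / real N \<le> real_of_int \<lfloor>real N * u\<rfloor> / real N" by (intro divide_right_mono) auto
    then show ?case using elim by (simp add: diff_divide_distrib)
  qed
  show "\<forall>\<^sub>F N in sequentially. real_of_int \<lfloor>real N * u\<rfloor> / real N \<le> u"
    using eventually_gt_at_top[of "0::nat"]
    by eventually_elim (simp add: pos_divide_le_eq mult.commute)
  show "(\<lambda>N. u - 1 / real N) \<longlonglongrightarrow> u"
    using tendsto_diff[OF tendsto_const lim_1_over_n, of u] by simp
qed simp

text \<open>The sum is the integral of the step function that samples \<open>h\<close> at \<lfloor>N
  u\<rfloor>/N. These samples converge wherever \<open>h\<close> is continuous, and dominated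
  convergence does the rest.\<close>

lemma riemann_sum_limit:
  fixes h :: "real \<Rightarrow> real"
  assumes cont: "AE u in lebesgue. isCont h u" and bd: "\<And>u. \<bar>h u\<bar> \<le> K"
    and supp: "\<And>u. \<bar>u\<bar> \<ge> R \<Longrightarrow> h u = 0" and R: "R > 0"
  shows "(\<lambda>N. \<Sum>x\<in>{-(int (lattice_radius R N) + 1)..int (lattice_radius R N) + 1}. h (x / N) / N) \<longlonglongrightarrow> (LINT u|lebesgue. h u)"
proof -
  define I where "I N = {-(int (lattice_radius R N) + 1)..int (lattice_radius R N) + 1}" for N
  \<comment> \<open>The value 0 at N = 0 matches the cells \<open>c 0 x\<close>, which are empty
    because division by zero yields 0.\<close>
  define s where "s N u = (if N = 0 then 0 else h (real_of_int \<lfloor>real N * u\<rfloor> / real N))" for N u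
  define c where "c N x = {real_of_int x / real N..<(real_of_int x + 1) / real N}" for N x
  have s_sum: "s N u = (\<Sum>x\<in>I N. h (x / N) * indicator (c N x) u)" for N u
  proof (cases "N = 0")
    case False
    then have N: "real N > 0" by simp
    have ind: "indicator (c N x) u = (if x = \<lfloor>real N * u\<rfloor> then 1 else (0::real))" for x
    proof -
      have "u \<in> c N x \<longleftrightarrow> real_of_int x \<le> real N * u \<and> real N * u < real_of_int x + 1"
        using N by (simp add: c_def pos_divide_le_eq pos_less_divide_eq mult.commute)
      also have "\<dots> \<longleftrightarrow> x = \<lfloor>real N * u\<rfloor>" by (auto simp: floor_unique)
      finally show ?thesis by (simp add: indicator_def)
    qed
    have "(\<Sum>x\<in>I N. h (x / N) * indicator (c N x) u)
        = (\<Sum>x\<in>I N. if x = \<lfloor>real N * u\<rfloor> then h (x / N) else 0)"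
      unfolding ind by (intro sum.cong) auto
    also have "\<dots> = (if \<lfloor>real N * u\<rfloor> \<in> I N then s N u else 0)"
      using False by (subst sum.delta) (auto simp: s_def I_def)
    also have "\<dots> = s N u"
    proof (cases "\<lfloor>real N * u\<rfloor> \<in> I N")
      case False
      have "R * N \<le> \<bar>real_of_int \<lfloor>real N * u\<rfloor>\<bar>"
        using False lattice_radius_bounds(1)[of R N] R by (auto simp: I_def)
      then have "h (real_of_int \<lfloor>real N * u\<rfloor> / real N) = 0"
        using N by (intro supp) (simp add: abs_divide pos_le_divide_eq)
      then show ?thesis by (simp add: s_def)
    qed simp
    finally show ?thesis by simp
  qed (simp add: s_def c_def)
  have s_meas: "s N \<in> borel_measurable lebesgue" for N
    unfolding s_sum[abs_def] c_def
    by (intro borel_measurable_sum borel_measurable_times borel_measurable_indicator) auto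
  have s_lim: "AE u in lebesgue. (\<lambda>N. s N u) \<longlonglongrightarrow> h u"
    using cont
  proof eventually_elim
    case (elim u)
    then have "(\<lambda>N. h (real_of_int \<lfloor>real N * u\<rfloor> / real N)) \<longlonglongrightarrow> h u"
      using floor_ratio_limit by (rule isCont_tendsto_compose)
    then show ?case
      by (rule Lim_transform_eventually) (use eventually_gt_at_top[of "0::nat"] in eventually_elim, simp add: s_def)
  qed
  have s_int: "(LINT u|lebesgue. s N u) = (\<Sum>x\<in>I N. h (x / N) / N)" for N
  proof (cases "N = 0")
    case False
    then have "measure lebesgue (c N x) = 1 / N" "c N x \<in> fmeasurable lebesgue" for x
      by (auto simp: c_def divide_right_mono diff_divide_distrib[symmetric] fmeasurable_def)
    moreover from this(2) have "integrable lebesgue (\<lambda>u. h (x / N) * indicator (c N x) u)" for x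
      by (intro integrable_mult_right lmeasurable_iff_integrable[THEN iffD1])
    ultimately show ?thesis
      unfolding s_sum by (subst Bochner_Integration.integral_sum) (auto simp: fmeasurable_def)
  qed (simp add: s_def)
  have "(\<lambda>N. LINT u|lebesgue. s N u) \<longlonglongrightarrow> (LINT u|lebesgue. h u)"
  proof (rule integral_dominated_convergence)
    show "h \<in> borel_measurable lebesgue" using s_meas s_lim by (rule measurable_AE_limit_lebesgue)
    \<comment> \<open>The sample point lies within 1/N \<le> 1 of u, so the step functions vanish
      beyond R + 1.\<close>
    show "integrable lebesgue (\<lambda>u. K * indicator {-(R+1)..R+1} u :: real)"
      by (intro integrable_mult_right lmeasurable_iff_integrable[THEN iffD1] lmeasurable_interval)
    show "AE u in lebesgue. norm (s N u) \<le> K * indicator {-(R+1)..R+1} u" for N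
    proof (rule AE_I2)
      fix u
      have K: "K \<ge> 0" using bd[of 0] by (meson abs_ge_zero order_trans)
      show "norm (s N u) \<le> K * indicator {-(R+1)..R+1} u"
      proof (cases "N = 0 \<or> u \<in> {-(R+1)..R+1}")
        case True then show ?thesis using bd K by (auto simp: s_def)
      next
        case False
        then have N: "real N \<ge> 1" and u: "\<bar>u\<bar> > R + 1" by auto
        have "R * N + 1 \<le> (R + 1) * N" using N by (simp add: algebra_simps)
        also have "\<dots> \<le> \<bar>real N * u\<bar>" using u N by (simp add: abs_mult mult.commute)
        finally have "R * N \<le> \<bar>real_of_int \<lfloor>real N * u\<rfloor>\<bar>" by linarith
        then have "s N u = 0"
          using N unfolding s_def by (auto intro!: supp simp: abs_divide pos_le_divide_eq)
        then show ?thesis using K by simp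
      qed
    qed
  qed (use s_meas s_lim in auto)
  then show ?thesis unfolding s_int I_def .
qed

text \<open>Everything follows from the probability that all sites of a finite set are occupied; for
  the set {x, y} the two cases arise because it has a single element when x = y.\<close>

lemma profile_measure_correlations:
  fixes N :: nat and x y :: int
  assumes \<rho>: "\<And>u. \<rho>0 u \<in> {0..1}"
  defines "q \<equiv> \<lambda>x. \<rho>0 (real_of_int x / real N)"
  shows "prob_space (profile_measure N \<rho>0)"
    and "sets (profile_measure N \<rho>0) = sets config_space"
    and "(LINT \<eta>|profile_measure N \<rho>0. of_bool (\<eta> x) * of_bool (\<eta> y))
      = (if x = y then q x else q x * q y)"
    and "(LINT \<eta>|profile_measure N \<rho>0. of_bool (\<eta> x)) = q x"
proof -
  let ?M = "\<lambda>x::int. measure_pmf (bernoulli_pmf (q x))"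
  have M: "profile_measure N \<rho>0 = Pi\<^sub>M UNIV ?M" by (simp add: profile_measure_def q_def)
  interpret product_prob_space ?M UNIV
    by unfold_locales
  show "prob_space (profile_measure N \<rho>0)" unfolding M by (rule P.prob_space_axioms)
  show sets: "sets (profile_measure N \<rho>0) = sets config_space"
    unfolding M config_space_def by (intro sets_PiM_cong) auto
  have q: "0 \<le> q x" "q x \<le> 1" for x using \<rho> by (auto simp: q_def)
  have J: "measure (profile_measure N \<rho>0) {\<eta>. \<forall>x\<in>J. \<eta> x} = (\<Prod>x\<in>J. q x)" if "finite J" for J
  proof -
    have "emeasure (Pi\<^sub>M UNIV ?M) {\<eta>\<in>space (Pi\<^sub>M UNIV ?M). \<forall>i\<in>J. \<eta> i \<in> {True}}
        = (\<Prod>i\<in>J. emeasure (?M i) {True})"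
      using that by (intro emeasure_PiM_Collect) auto
    also have "\<dots> = (\<Prod>i\<in>J. ennreal (q i))"
      using q by (simp add: emeasure_pmf_single)
    also have "\<dots> = ennreal (\<Prod>i\<in>J. q i)" using q by (intro prod_ennreal) auto
    finally show ?thesis
      unfolding M measure_def using q by (simp add: space_PiM prod_nonneg)
  qed
  have ev: "{\<eta>. \<forall>x\<in>J. \<eta> x} \<in> sets (profile_measure N \<rho>0)" if "finite J" for J
  proof -
    have "(\<Prod>x\<in>J. of_bool (\<eta> x)) = (of_bool (\<forall>x\<in>J. \<eta> x) :: real)" for \<eta> :: config
      using that by (induction J rule: finite_induct) auto
    then have "{\<eta>. \<forall>x\<in>J. \<eta> x} = (\<lambda>\<eta>. \<Prod>x\<in>J. of_bool (\<eta> x)) -` {1::real} \<inter> space config_space"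
      by (simp add: vimage_def)
    moreover have "(\<lambda>\<eta>. \<Prod>x\<in>J. of_bool (\<eta> x) :: real) \<in> borel_measurable config_space"
      by (intro borel_measurable_prod cylinder_measurable cylinder_site)
    ultimately show ?thesis unfolding sets using measurable_sets[of _ config_space borel "{1::real}"] by auto
  qed
  have E: "(LINT \<eta>|profile_measure N \<rho>0. of_bool (\<forall>x\<in>J. \<eta> x)) = (\<Prod>x\<in>J. q x)" if "finite J" for J
  proof -
    have "(LINT \<eta>|profile_measure N \<rho>0. of_bool (\<forall>x\<in>J. \<eta> x))
        = (LINT \<eta>|profile_measure N \<rho>0. indicator {\<eta>. \<forall>x\<in>J. \<eta> x} \<eta>)"
      by (intro Bochner_Integration.integral_cong) (auto simp: indicator_def)
    also have "\<dots> = measure (profile_measure N \<rho>0) {\<eta>. \<forall>x\<in>J. \<eta> x}"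
      using sets_eq_imp_space_eq[OF sets] by simp
    finally show ?thesis unfolding J[OF that] .
  qed
  show "(LINT \<eta>|profile_measure N \<rho>0. of_bool (\<eta> x)) = q x"
    using E[of "{x}"] by simp
  have "of_bool (\<eta> x) * of_bool (\<eta> y) = (of_bool (\<forall>z\<in>{x, y}. \<eta> z) :: real)" for \<eta> :: config
    by simp
  then have "(LINT \<eta>|profile_measure N \<rho>0. of_bool (\<eta> x) * of_bool (\<eta> y)) = (\<Prod>z\<in>{x, y}. q z)"
    using E[of "{x, y}"] by (simp only: finite.intros)
  then show "(LINT \<eta>|profile_measure N \<rho>0. of_bool (\<eta> x) * of_bool (\<eta> y))
      = (if x = y then q x else q x * q y)"
    by (cases "x = y") simp_all
qed

text \<open>Squared bias plus variance: by independence the off-diagonal terms assemble to the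
  square of the mean, and the diagonal leaves c^2 (q - q^2) \<le> c^2.\<close>

lemma profile_second_moment:
  assumes \<rho>: "\<And>u. \<rho>0 u \<in> {0..1}"
  shows "(LINT \<eta>|profile_measure N \<rho>0. (linear_statistic n c \<eta> - z)\<^sup>2)
    \<le> ((\<Sum>x\<in>{-n..n}. c x * \<rho>0 (x / N)) - z)\<^sup>2 + (\<Sum>x\<in>{-n..n}. (c x)\<^sup>2)"
proof -
  let ?q = "\<lambda>x::int. \<rho>0 (x / N)" and ?A = "{-n..n}" and ?e = "\<lambda>\<eta> x. of_bool (\<eta> x) :: real"
  let ?M = "profile_measure N \<rho>0"
  interpret M: prob_space ?M using \<rho> by (rule profile_measure_correlations)
  have i: "integrable ?M f" if c: "cylinder f" for f
  proof -
    obtain C where "\<And>\<eta>. \<bar>f \<eta>\<bar> \<le> C" using cylinder_bounded[OF c] by auto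
    moreover have "f \<in> borel_measurable ?M"
      using cylinder_measurable[OF c] measurable_cong_sets[OF profile_measure_correlations(2)[of \<rho>0 N, OF \<rho>] refl]
      by blast
    ultimately show ?thesis by (intro M.integrable_const_bound[where B = C]) auto
  qed
  note cyl = cylinder_times cylinder_const cylinder_site cylinder_sum
  have "(linear_statistic n c \<eta> - z)\<^sup>2
      = (\<Sum>x\<in>?A. \<Sum>y\<in>?A. c x * c y * (?e \<eta> x * ?e \<eta> y)) - 2 * z * (\<Sum>x\<in>?A. c x * ?e \<eta> x) + z\<^sup>2" for \<eta>
  proof -
    have "(\<Sum>x\<in>?A. c x * ?e \<eta> x) * (\<Sum>x\<in>?A. c x * ?e \<eta> x)
        = (\<Sum>x\<in>?A. \<Sum>y\<in>?A. c x * c y * (?e \<eta> x * ?e \<eta> y))"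
      unfolding sum_product by (intro sum.cong refl) (simp only: ac_simps)
    moreover have "(a - z)\<^sup>2 = a * a - 2 * z * a + z\<^sup>2" for a
      by (simp add: power2_eq_square algebra_simps)
    ultimately show ?thesis unfolding linear_statistic_def by presburger
  qed
  then have "(LINT \<eta>|?M. (linear_statistic n c \<eta> - z)\<^sup>2)
      = (\<Sum>x\<in>?A. \<Sum>y\<in>?A. c x * c y * (LINT \<eta>|?M. ?e \<eta> x * ?e \<eta> y))
        - 2 * z * (\<Sum>x\<in>?A. c x * (LINT \<eta>|?M. ?e \<eta> x)) + z\<^sup>2"
    by (simp add: i cyl M.prob_space del: sum_mult_of_bool_eq sum_of_bool_mult_eq)
  also have "\<dots> = (\<Sum>x\<in>?A. \<Sum>y\<in>?A. (c x * ?q x) * (c y * ?q y) + (if y = x then (c x)\<^sup>2 * (?q x - (?q x)\<^sup>2) else 0))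
        - 2 * z * (\<Sum>x\<in>?A. c x * ?q x) + z\<^sup>2"
    unfolding profile_measure_correlations(3,4)[of \<rho>0 N, OF \<rho>]
    by (intro arg_cong2[where f = "(+)"] arg_cong2[where f = "(-)"] sum.cong refl)
      (auto simp: power2_eq_square algebra_simps)
  also have "\<dots> = ((\<Sum>x\<in>?A. c x * ?q x) - z)\<^sup>2 + (\<Sum>x\<in>?A. (c x)\<^sup>2 * (?q x - (?q x)\<^sup>2))"
  proof -
    have "(\<Sum>x\<in>?A. \<Sum>y\<in>?A. (c x * ?q x) * (c y * ?q y) + (if y = x then (c x)\<^sup>2 * (?q x - (?q x)\<^sup>2) else 0))
        = (\<Sum>x\<in>?A. c x * ?q x) * (\<Sum>y\<in>?A. c y * ?q y) + (\<Sum>x\<in>?A. (c x)\<^sup>2 * (?q x - (?q x)\<^sup>2))"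
      unfolding sum.distrib sum_product by (simp add: sum.delta)
    moreover have "a * a + b - 2 * z * a + z\<^sup>2 = (a - z)\<^sup>2 + b" for a b :: real
      by (simp add: power2_eq_square algebra_simps)
    ultimately show ?thesis by presburger
  qed
  also have "(\<Sum>x\<in>?A. (c x)\<^sup>2 * (?q x - (?q x)\<^sup>2)) \<le> (\<Sum>x\<in>?A. (c x)\<^sup>2 * 1)"
  proof (intro sum_mono mult_left_mono)
    fix x
    have "0 \<le> ?q x" "?q x \<le> 1" using \<rho>[of "x / N"] by auto
    then show "?q x - (?q x)\<^sup>2 \<le> 1" by (smt (verit) zero_le_power2)
  qed auto
  finally show ?thesis by simp
qed

lemma (in exclusion_process) marginal_0: "marginal 0 = \<mu>"
  using law unfolding markov_law_def marginal_def by blast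

text \<open>The bias is a Riemann sum of the product of \<open>f\<close> with the profile and tends
  to 0 by almost everywhere continuity; the variance is at most (2L + 3)(K/N)^2, with L the lattice
  radius, hence O(1/N).\<close>

lemma initial_second_moment:
  assumes \<rho>: "\<And>u. \<rho>0 u \<in> {0..1}" and \<rho>_cont: "AE u in lebesgue. isCont \<rho>0 u"
    and f: "continuous_on UNIV f" "\<And>u. \<bar>u\<bar> \<ge> R \<Longrightarrow> f u = 0" and R: "R > 0" and e: "e > 0"
  shows "\<forall>\<^sub>F N in sequentially. \<forall>P S. exclusion_process P \<xi> N S (profile_measure N \<rho>0) \<longrightarrow>
    second_moment P N R 0 f (pairing \<rho>0 f) \<le> e"
proof -
  obtain K where K: "K \<ge> 0" "\<And>u. \<bar>f u\<bar> \<le> K" using continuous_support_bounded[OF f] by blast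
  let ?z = "pairing \<rho>0 f" and ?n = "\<lambda>N. int (lattice_radius R N) + 1"
  have "(\<lambda>N. \<Sum>x\<in>{-?n N..?n N}. (f (x / N) * \<rho>0 (x / N)) / N) \<longlonglongrightarrow> (LINT u|lebesgue. f u * \<rho>0 u)"
  proof (rule riemann_sum_limit)
    have "isCont f u" for u using f(1) by (simp add: continuous_on_eq_continuous_at)
    then show "AE u in lebesgue. isCont (\<lambda>u. f u * \<rho>0 u) u"
      using \<rho>_cont by (auto elim!: eventually_mono intro!: continuous_intros)
    show "\<bar>f u * \<rho>0 u\<bar> \<le> K * 1" for u
      unfolding abs_mult using K \<rho>[of u] by (intro mult_mono) auto
  qed (use f R in auto)
  then have "(\<lambda>N. ((\<Sum>x\<in>{-?n N..?n N}. (f (x / N) * \<rho>0 (x / N)) / N) - ?z)\<^sup>2) \<longlonglongrightarrow> (?z - ?z)\<^sup>2"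
    unfolding pairing_def by (intro tendsto_intros)
  moreover have "(\<lambda>N. (2 * (real (lattice_radius R N) / N) + 3 * (1 / N)) * (K\<^sup>2 * (1 / N))) \<longlonglongrightarrow> (2 * R + 3 * 0) * (K\<^sup>2 * 0)"
    using R by (intro tendsto_intros lattice_radius_ratio lim_1_over_n) auto
  ultimately have "(\<lambda>N. ((\<Sum>x\<in>{-?n N..?n N}. (f (x / N) * \<rho>0 (x / N)) / N) - ?z)\<^sup>2
      + (2 * (real (lattice_radius R N) / N) + 3 * (1 / N)) * (K\<^sup>2 * (1 / N))) \<longlonglongrightarrow> (?z - ?z)\<^sup>2 + (2 * R + 3 * 0) * (K\<^sup>2 * 0)"
    by (rule tendsto_add)
  then have "(\<lambda>N. ((\<Sum>x\<in>{-?n N..?n N}. (f (x / N) * \<rho>0 (x / N)) / N) - ?z)\<^sup>2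
      + (2 * (real (lattice_radius R N) / N) + 3 * (1 / N)) * (K\<^sup>2 * (1 / N))) \<longlonglongrightarrow> 0" by simp
  then have "\<forall>\<^sub>F N in sequentially. ((\<Sum>x\<in>{-?n N..?n N}. (f (x / N) * \<rho>0 (x / N)) / N) - ?z)\<^sup>2
      + (2 * (real (lattice_radius R N) / N) + 3 * (1 / N)) * (K\<^sup>2 * (1 / N)) < e"
    using e by (rule order_tendstoD)
  then show ?thesis using eventually_gt_at_top[of "0::nat"]
  proof eventually_elim
    case (elim N)
    show ?case
    proof (intro allI impI)
      fix P S assume "exclusion_process P \<xi> N S (profile_measure N \<rho>0)"
      then interpret exclusion_process P \<xi> N S "profile_measure N \<rho>0" .
      have "second_moment P N R 0 f ?z
          = (LINT \<eta>|profile_measure N \<rho>0. (linear_statistic (?n N) (\<lambda>x. f (x / N) / N) \<eta> - ?z)\<^sup>2)"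
        by (simp add: second_moment_eq_mean mean_def marginal_0)
      also have "\<dots> \<le> ((\<Sum>x\<in>{-?n N..?n N}. f (x / N) / N * \<rho>0 (x / N)) - ?z)\<^sup>2
          + (\<Sum>x\<in>{-?n N..?n N}. (f (x / N) / N)\<^sup>2)"
        using \<rho> by (rule profile_second_moment)
      also have "(\<Sum>x\<in>{-?n N..?n N}. (f (x / N) / N)\<^sup>2) \<le> (\<Sum>x\<in>{-?n N..?n N}. (K / N)\<^sup>2)"
        using K by (intro sum_mono power2_le_iff_abs_le[THEN iffD2]) (auto simp: abs_divide divide_right_mono)
      also have "\<dots> = (2 * (real (lattice_radius R N) / N) + 3 * (1 / N)) * (K\<^sup>2 * (1 / N))"
        using elim(2) by (simp add: power2_eq_square field_simps)
      finally show "second_moment P N R 0 f ?z \<le> e" using elim(1) by (simp add: mult.commute)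
    qed
  qed
qed


section \<open>The heat equation along the averaging scheme\<close>

lemma continuous_support_integrable:
  fixes H r :: "real \<Rightarrow> real"
  assumes H: "continuous_on UNIV H" "\<And>u. \<bar>u\<bar> \<ge> R \<Longrightarrow> H u = 0"
    and r: "r \<in> borel_measurable lebesgue" "\<And>u. r u \<in> {0..1}"
  shows "integrable lebesgue (\<lambda>u. H u * r u)"
proof -
  obtain K where K: "K \<ge> 0" "\<And>u. \<bar>H u\<bar> \<le> K" using continuous_support_bounded[OF H] by blast
  have "H \<in> borel_measurable borel" using H(1) by (rule borel_measurable_continuous_onI)
  then have "H \<in> borel_measurable lebesgue" by (intro measurable_completion) simp
  then have m: "(\<lambda>u. H u * r u) \<in> borel_measurable lebesgue" using r(1) by (intro borel_measurable_times)
  show ?thesis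
  proof (rule Bochner_Integration.integrable_bound)
    show "integrable lebesgue (\<lambda>u. K * indicator {-R..R} u :: real)"
      by (intro integrable_mult_right lmeasurable_iff_integrable[THEN iffD1] lmeasurable_interval)
    show "AE u in lebesgue. norm (H u * r u) \<le> norm (K * indicator {-R..R} u :: real)"
    proof (rule AE_I2)
      fix u
      show "norm (H u * r u) \<le> norm (K * indicator {-R..R} u :: real)"
      proof (cases "\<bar>u\<bar> \<ge> R")
        case True then show ?thesis using H(2) by simp
      next
        case False
        then have "u \<in> {-R..R}" by auto
        moreover have "\<bar>H u\<bar> * \<bar>r u\<bar> \<le> K * 1" using K r(2)[of u] by (intro mult_mono) auto
        ultimately show ?thesis using K(1) by (simp add: abs_mult)
      qed
    qed
  qed (use m in simp)
qed

lemma pairing_bound: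
  assumes H: "\<And>u. \<bar>u\<bar> \<ge> R \<Longrightarrow> H u = 0" "\<And>u. \<bar>H u\<bar> \<le> B"
    and r: "\<And>u. r u \<in> {0..1}" and R: "R \<ge> 0"
  shows "\<bar>pairing r H\<bar> \<le> 2 * R * B"
proof -
  have B: "B \<ge> 0" using H(2)[of 0] by (meson abs_ge_zero order_trans)
  have "\<bar>pairing r H\<bar> \<le> (LINT u|lebesgue. \<bar>H u * r u\<bar>)"
    unfolding pairing_def by (rule integral_abs_bound)
  also have "\<dots> \<le> (LINT u|lebesgue. B * indicator {-R..R} u)"
  proof (rule integral_mono_AE')
    show "integrable lebesgue (\<lambda>u. B * indicator {-R..R} u :: real)"
      by (intro integrable_mult_right lmeasurable_iff_integrable[THEN iffD1] lmeasurable_interval)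
    show "AE u in lebesgue. \<bar>H u * r u\<bar> \<le> B * indicator {-R..R} u"
    proof (rule AE_I2)
      fix u
      show "\<bar>H u * r u\<bar> \<le> B * indicator {-R..R} u"
      proof (cases "\<bar>u\<bar> \<ge> R")
        case True then show ?thesis using H(1) B by simp
      next
        case False
        then have "u \<in> {-R..R}" by auto
        moreover have "\<bar>H u\<bar> * \<bar>r u\<bar> \<le> B * 1" using H(2)[of u] B r[of u] by (intro mult_mono) auto
        ultimately show ?thesis by (simp add: abs_mult)
      qed
    qed
  qed (use B in auto)
  also have "\<dots> = 2 * R * B" using R by simp
  finally show ?thesis .
qed

lemma support_imp_compactly_supported:
  assumes "\<And>u. \<bar>u\<bar> \<ge> R \<Longrightarrow> G u = 0"
  shows "compactly_supported G"
proof -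
  have "{u. G u \<noteq> 0} \<subseteq> {-R..R}"
  proof
    fix u assume "u \<in> {u. G u \<noteq> 0}"
    then have "\<not> \<bar>u\<bar> \<ge> R" using assms by auto
    then show "u \<in> {-R..R}" by auto
  qed
  then have "bounded {u. G u \<noteq> 0}" by (rule bounded_subset[OF bounded_closed_interval])
  then show ?thesis by (simp add: compactly_supported_def)
qed

section \<open>Weak solutions: increments in time and comparison with the averaging scheme\<close>

locale heat_solution =
  fixes \<gamma> :: real and \<rho>0 :: "real \<Rightarrow> real" and \<rho> :: "real \<Rightarrow> real \<Rightarrow> real"
  assumes \<gamma>_pos: "\<gamma> > 0" and weak: "weak_heat_solution \<gamma> \<rho>0 \<rho>"
begin

lemma \<rho>_range: "t \<ge> 0 \<Longrightarrow> \<rho> t u \<in> {0..1}"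
  and \<rho>_measurable: "t \<ge> 0 \<Longrightarrow> \<rho> t \<in> borel_measurable lebesgue"
  using weak unfolding weak_heat_solution_def by auto

lemma pairing_add:
  assumes "t \<ge> 0" "continuous_on UNIV G" "\<And>u. \<bar>u\<bar> \<ge> R \<Longrightarrow> G u = 0"
    "continuous_on UNIV H" "\<And>u. \<bar>u\<bar> \<ge> R \<Longrightarrow> H u = 0"
  shows "pairing (\<rho> t) (\<lambda>u. a * G u + b * H u) = a * pairing (\<rho> t) G + b * pairing (\<rho> t) H"
proof -
  have "integrable lebesgue (\<lambda>u. G u * \<rho> t u)" "integrable lebesgue (\<lambda>u. H u * \<rho> t u)"
    using assms \<rho>_range \<rho>_measurable by (auto intro!: continuous_support_integrable[where R = R])
  then have "(LINT u|lebesgue. a * (G u * \<rho> t u) + b * (H u * \<rho> t u)) = a * pairing (\<rho> t) G + b * pairing (\<rho> t) H"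
    by (simp add: pairing_def)
  then show ?thesis by (simp add: pairing_def algebra_simps)
qed

lemma weak_identity:
  assumes "\<And>u. (G has_real_derivative G' u) (at u)" "\<And>u. (G' has_real_derivative G'' u) (at u)"
    "continuous_on UNIV G''" "\<And>u. \<bar>u\<bar> \<ge> R \<Longrightarrow> G u = 0" "t \<ge> 0"
  shows "set_integrable lebesgue {0..t} (\<lambda>s. pairing (\<rho> s) (\<lambda>u. inverse \<gamma> * G'' u))"
    and "pairing (\<rho> t) G = pairing \<rho>0 G + (LINT s:{0..t}|lebesgue. pairing (\<rho> s) (\<lambda>u. inverse \<gamma> * G'' u))"
  using weak assms support_imp_compactly_supported[of R G] unfolding weak_heat_solution_def by blast+

text \<open>At time 0 the identity integrates over a single point. Thus \<open>\<rho> 0\<close> and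
  \<open>\<rho>0\<close> agree against smooth test functions, although they may differ as
  functions.\<close>

lemma weak_initial:
  assumes "\<And>u. (G has_real_derivative G' u) (at u)" "\<And>u. (G' has_real_derivative G'' u) (at u)"
    "continuous_on UNIV G''" "\<And>u. \<bar>u\<bar> \<ge> R \<Longrightarrow> G u = 0"
  shows "pairing (\<rho> 0) G = pairing \<rho>0 G"
proof -
  have "(LINT s:{0..0}|lebesgue. pairing (\<rho> s) (\<lambda>u. inverse \<gamma> * G'' u)) = 0"
    unfolding set_lebesgue_integral_def
  proof (rule integral_eq_zero_AE)
    have "{0::real} \<in> null_sets lebesgue" by (intro null_sets_completionI finite_imp_null_set_lborel) simp
    then have "AE s in lebesgue. s \<notin> {0::real}" by (rule AE_not_in)
    then show "AE s in lebesgue. indicat_real {0..0} s *\<^sub>R pairing (\<rho> s) (\<lambda>u. inverse \<gamma> * G'' u) = 0"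
      by eventually_elim simp
  qed
  moreover have "pairing (\<rho> 0) G
      = pairing \<rho>0 G + (LINT s:{0..0}|lebesgue. pairing (\<rho> s) (\<lambda>u. inverse \<gamma> * G'' u))"
    using assms by (intro weak_identity(2)) auto
  ultimately show ?thesis by simp
qed

text \<open>With \<open>c = 0\<close> this is a Lipschitz bound in time; with \<open>c\<close> the
  integrand at time \<open>s\<close> it is the error of an explicit Euler step. Both uses occur in
  \<open>heat_step\<close>.\<close>

lemma weak_increment:
  assumes G: "\<And>u. (G has_real_derivative G' u) (at u)" "\<And>u. (G' has_real_derivative G'' u) (at u)"
    "continuous_on UNIV G''" "\<And>u. \<bar>u\<bar> \<ge> R \<Longrightarrow> G u = 0"
    and st: "0 \<le> s" "s \<le> t"
    and C: "\<And>r. s \<le> r \<Longrightarrow> r \<le> t \<Longrightarrow> \<bar>pairing (\<rho> r) (\<lambda>u. inverse \<gamma> * G'' u) - c\<bar> \<le> C"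
  shows "\<bar>pairing (\<rho> t) G - pairing (\<rho> s) G - (t - s) * c\<bar> \<le> (t - s) * C"
proof -
  define p where "p r = pairing (\<rho> r) (\<lambda>u. inverse \<gamma> * G'' u)" for r
  have p_int: "set_integrable lebesgue {0..t} p" "set_integrable lebesgue {0..s} p"
    unfolding p_def using weak_identity(1)[OF G] st by auto
  have p_int': "set_integrable lebesgue {s<..t} p"
    using p_int(1) by (rule set_integrable_subset) (use st in auto)
  have split: "{0..t} = {0..s} \<union> {s<..t}" using st by auto
  have "pairing (\<rho> t) G - pairing (\<rho> s) G = (LINT r:{0..t}|lebesgue. p r) - (LINT r:{0..s}|lebesgue. p r)"
    unfolding p_def using weak_identity(2)[OF G] st by simp
  also have "\<dots> = (LINT r:{s<..t}|lebesgue. p r)"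
    unfolding split using p_int(2) p_int' by (subst set_integral_Un) auto
  finally have inc: "pairing (\<rho> t) G - pairing (\<rho> s) G = (LINT r:{s<..t}|lebesgue. p r)" .
  have const: "set_integrable lebesgue {s<..t} (\<lambda>_. a)" "(LINT r:{s<..t}|lebesgue. a) = (t - s) * a" for a :: real
    using st by (auto simp: set_integrable_def set_lebesgue_integral_def)
  have p_bounds: "c - C \<le> p r" "p r \<le> c + C" if "r \<in> {s<..t}" for r
    using C[of r] that unfolding p_def abs_le_iff by auto
  have "(LINT r:{s<..t}|lebesgue. p r) \<le> (LINT r:{s<..t}|lebesgue. c + C)"
    using p_bounds by (intro set_integral_mono p_int' const) auto
  moreover have "(LINT r:{s<..t}|lebesgue. c - C) \<le> (LINT r:{s<..t}|lebesgue. p r)"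
    using p_bounds by (intro set_integral_mono p_int' const) auto
  ultimately show ?thesis unfolding inc const by (simp add: abs_le_iff algebra_simps)
qed

text \<open>The pairing with F'' is Lipschitz in time because F'''' is bounded, so the Euler step
  errs by R0 M \<delta>^4 / 2; replacing f + \<tau> \<gamma>^-1 f'' by the average costs 2 R0 M
  \<delta>^4. The sum is rounded up to 3 R0 M \<delta>^4.\<close>

lemma heat_step:
  assumes F: "jet R M F" and \<delta>: "\<delta> > 0" and R: "R > 0" "R + \<delta> \<le> R0" and s: "s \<ge> 0"
  defines "\<tau> \<equiv> \<gamma> * \<delta>\<^sup>2 / 2"
  shows "\<bar>pairing (\<rho> (s + \<tau>)) (F 0) - pairing (\<rho> s) (avg \<delta> (F 0))\<bar> \<le> 3 * R0 * M * \<delta> ^ 4"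
proof -
  have \<tau>: "\<tau> > 0" using \<delta> \<gamma>_pos by (simp add: \<tau>_def)
  have jF: "jet R0 M F" using F R \<delta> by (auto intro: jet_mono)
  have R0: "R0 \<ge> 0" using R \<delta> by simp
  have M: "M \<ge> 0" using jet_bound[OF F, of 0] by linarith
  note d = jet_deriv_numeral[OF jF] and c = jet_continuous[OF jF] and z = jet_support[OF jF]
  have scale: "pairing (\<rho> r) (\<lambda>u. inverse \<gamma> * G u) = pairing (\<rho> r) G / \<gamma>" for r G
    by (simp add: pairing_def field_simps)
  have lip: "\<bar>pairing (\<rho> r) (F 2) - pairing (\<rho> s) (F 2)\<bar> \<le> \<tau> * (2 * R0 * M / \<gamma>)" if r: "s \<le> r" "r \<le> s + \<tau>" for r
  proof -
    have "\<bar>pairing (\<rho> r) (F 2) - pairing (\<rho> s) (F 2) - (r - s) * 0\<bar> \<le> (r - s) * (2 * R0 * M / \<gamma>)"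
    proof (rule weak_increment[where G = "F 2" and G' = "F 3" and G'' = "F 4" and R = R0])
      fix v assume "s \<le> v" "v \<le> r"
      then have "\<bar>pairing (\<rho> v) (F 4)\<bar> \<le> 2 * R0 * M"
        using s z[of 4] jet_bound[OF jF] \<rho>_range[of v] R0 by (intro pairing_bound) auto
      then show "\<bar>pairing (\<rho> v) (\<lambda>u. inverse \<gamma> * F 4 u) - 0\<bar> \<le> 2 * R0 * M / \<gamma>"
        unfolding scale using \<gamma>_pos by (simp add: abs_divide divide_right_mono)
    qed (use d c[of 4] z[of 2] s r in auto)
    also have "\<dots> \<le> \<tau> * (2 * R0 * M / \<gamma>)"
      using r R0 M \<gamma>_pos by (intro mult_right_mono) auto
    finally show ?thesis by simp
  qed
  have 1: "\<bar>pairing (\<rho> (s + \<tau>)) (F 0) - pairing (\<rho> s) (F 0) - (s + \<tau> - s) * (pairing (\<rho> s) (F 2) / \<gamma>)\<bar>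
      \<le> (s + \<tau> - s) * (\<tau> * (2 * R0 * M / \<gamma>) / \<gamma>)"
  proof (rule weak_increment[where G' = "F 1" and G'' = "F 2" and R = R0])
    fix r assume "s \<le> r" "r \<le> s + \<tau>"
    then show "\<bar>pairing (\<rho> r) (\<lambda>u. inverse \<gamma> * F 2 u) - pairing (\<rho> s) (F 2) / \<gamma>\<bar> \<le> \<tau> * (2 * R0 * M / \<gamma>) / \<gamma>"
      unfolding scale diff_divide_distrib[symmetric] abs_divide
      using lip[of r] \<gamma>_pos by (simp add: divide_right_mono del: times_divide_eq_right)
  qed (use d c[of 2] z[of 0] s \<tau> in auto)
  let ?A = "avg \<delta> (F 0)"
  have jA: "jet R0 M (\<lambda>i. avg \<delta> (F i))" by (rule jet_mono[OF jet_avg[OF F]]) (use \<delta> R in auto)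
  have A: "continuous_on UNIV ?A" "\<And>u. \<bar>u\<bar> \<ge> R0 \<Longrightarrow> ?A u = 0"
    using jet_continuous[OF jA, of 0] jet_support[OF jA, of 0] by auto
  have "\<bar>pairing (\<rho> s) (\<lambda>u. 1 * ?A u + (-1) * (1 * F 0 u + \<delta>\<^sup>2 / 2 * F 2 u))\<bar> \<le> 2 * R0 * (M * \<delta> ^ 4)"
  proof (rule pairing_bound)
    show "\<bar>1 * ?A u + (-1) * (1 * F 0 u + \<delta>\<^sup>2 / 2 * F 2 u)\<bar> \<le> M * \<delta> ^ 4" for u
      using avg_taylor(1)[OF F \<delta>, of u] by (simp add: algebra_simps)
  qed (use A(2) z[of 0] z[of 2] \<rho>_range[OF s] R0 in auto)
  moreover have "pairing (\<rho> s) (\<lambda>u. 1 * ?A u + (-1) * (1 * F 0 u + \<delta>\<^sup>2 / 2 * F 2 u))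
      = 1 * pairing (\<rho> s) ?A + (-1) * pairing (\<rho> s) (\<lambda>u. 1 * F 0 u + \<delta>\<^sup>2 / 2 * F 2 u)"
    using s A c[of 0] c[of 2] z[of 0] z[of 2]
    by (intro pairing_add[where R = R0]) (auto intro!: continuous_intros)
  moreover have "pairing (\<rho> s) (\<lambda>u. 1 * F 0 u + \<delta>\<^sup>2 / 2 * F 2 u) = 1 * pairing (\<rho> s) (F 0) + \<delta>\<^sup>2 / 2 * pairing (\<rho> s) (F 2)"
    using s c[of 0] c[of 2] z[of 0] z[of 2] by (intro pairing_add[where R = R0]) auto
  ultimately have 2: "\<bar>pairing (\<rho> s) ?A - (pairing (\<rho> s) (F 0) + \<delta>\<^sup>2 / 2 * pairing (\<rho> s) (F 2))\<bar> \<le> 2 * R0 * M * \<delta> ^ 4"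
    by simp
  have "\<tau> * (pairing (\<rho> s) (F 2) / \<gamma>) = \<delta>\<^sup>2 / 2 * pairing (\<rho> s) (F 2)"
    using \<gamma>_pos by (simp add: \<tau>_def)
  moreover have "\<tau> * (\<tau> * (2 * R0 * M / \<gamma>) / \<gamma>) = R0 * M * \<delta> ^ 4 / 2"
    using \<gamma>_pos by (simp add: \<tau>_def power2_eq_square eval_nat_numeral)
  moreover have "R0 * M * \<delta> ^ 4 \<ge> 0" using R0 M by simp
  moreover have "s + \<tau> - s = \<tau>" by simp
  ultimately show ?thesis using 1 2 by (simp only:)
qed

text \<open>The recursion runs as for the particle system and ends at the same number, the pairing
  of the initial profile with the k-fold average; this is what makes the two comparable.\<close>

lemma heat_iterate:
  assumes \<delta>: "\<delta> > 0"
  defines "\<tau> \<equiv> \<gamma> * \<delta>\<^sup>2 / 2"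
  shows "jet R M F \<Longrightarrow> R > 0 \<Longrightarrow> R + real k * \<delta> \<le> R0 \<Longrightarrow>
    \<bar>pairing (\<rho> (real k * \<tau>)) (F 0) - pairing \<rho>0 ((avg \<delta> ^^ k) (F 0))\<bar> \<le> real k * (3 * R0 * M * \<delta> ^ 4)"
proof (induction k arbitrary: F R)
  case 0
  have "pairing (\<rho> 0) (F 0) = pairing \<rho>0 (F 0)"
    using jet_deriv_numeral[OF 0(1)] jet_continuous[OF 0(1), of 2] jet_support[OF 0(1), of 0]
    by (intro weak_initial) auto
  then show ?case by simp
next
  case (Suc k)
  have \<tau>: "\<tau> > 0" using \<delta> \<gamma>_pos by (simp add: \<tau>_def)
  have "real k * \<delta> \<ge> 0" using \<delta> by simp
  then have R: "R + \<delta> \<le> R0" "R + \<delta> + real k * \<delta> \<le> R0"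
    using Suc.prems(3) by (auto simp: algebra_simps)
  have 1: "\<bar>pairing (\<rho> (real k * \<tau> + \<tau>)) (F 0) - pairing (\<rho> (real k * \<tau>)) (avg \<delta> (F 0))\<bar> \<le> 3 * R0 * M * \<delta> ^ 4"
    unfolding \<tau>_def using Suc.prems R \<delta> \<tau> by (intro heat_step) (auto simp: \<tau>_def)
  have 2: "\<bar>pairing (\<rho> (real k * \<tau>)) (avg \<delta> (F 0)) - pairing \<rho>0 ((avg \<delta> ^^ k) (avg \<delta> (F 0)))\<bar>
      \<le> real k * (3 * R0 * M * \<delta> ^ 4)"
    using Suc.prems R \<delta> jet_avg[of R M F \<delta>] by (intro Suc.IH[where R = "R + \<delta>"]) auto
  have time: "real (Suc k) * \<tau> = real k * \<tau> + \<tau>" by (simp add: algebra_simps)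
  have "real (Suc k) * (3 * R0 * M * \<delta> ^ 4) = real k * (3 * R0 * M * \<delta> ^ 4) + 3 * R0 * M * \<delta> ^ 4"
    by (simp add: algebra_simps)
  then show ?case unfolding time funpow_Suc_right o_def using 1 2 by linarith
qed

end


section \<open>Smooth approximation and conclusion\<close>

text \<open>Induction on the number of derivatives by Steklov means: the mean of F over
  [u, u + \<kappa>], written through an antiderivative, gains one derivative, and its derivatives
  are difference quotients of the old ones. The new averaging moves values by at most e/2 and the
  support by at most r/2; the other halves go to the induction hypothesis.\<close>

lemma smooth_approximation:
  fixes G :: "real \<Rightarrow> real"
  assumes G: "continuous_on UNIV G" "\<And>u. \<bar>u\<bar> \<ge> R \<Longrightarrow> G u = 0"
  shows "e > 0 \<Longrightarrow> r > 0 \<Longrightarrow> \<exists>F. (\<forall>i<k. \<forall>u. (F i has_real_derivative F (Suc i) u) (at u)) \<and>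
    continuous_on UNIV (F k) \<and> (\<forall>i\<le>k. \<forall>u. \<bar>u\<bar> \<ge> R + r \<longrightarrow> F i u = 0) \<and> (\<forall>u. \<bar>F 0 u - G u\<bar> \<le> e)"
proof (induction k arbitrary: e r)
  case 0
  then show ?case using G by (intro exI[of _ "\<lambda>_. G"]) auto
next
  case (Suc k)
  have half: "e / 2 > 0" "r / 2 > 0" using Suc.prems by simp_all
  obtain F where F': "\<forall>i<k. \<forall>u. (F i has_real_derivative F (Suc i) u) (at u)" "continuous_on UNIV (F k)"
    "\<forall>i\<le>k. \<forall>u. \<bar>u\<bar> \<ge> R + r / 2 \<longrightarrow> F i u = 0" "\<forall>u. \<bar>F 0 u - G u\<bar> \<le> e / 2"
    using Suc.IH[OF half] by (elim exE conjE) (rule that)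
  have F: "\<And>i u. i < k \<Longrightarrow> (F i has_real_derivative F (Suc i) u) (at u)" "continuous_on UNIV (F k)"
    "\<And>i u. i \<le> k \<Longrightarrow> \<bar>u\<bar> \<ge> R + r / 2 \<Longrightarrow> F i u = 0" "\<And>u. \<bar>F 0 u - G u\<bar> \<le> e / 2"
    using F' by blast+
  have cont: "continuous_on UNIV (F 0)"
  proof (cases "k = 0")
    case False then show ?thesis using F(1)[of 0] by (auto intro!: DERIV_continuous_on)
  qed (use F(2) in simp)
  obtain b where b: "b > 0" "\<And>x y. \<bar>y - x\<bar> < b \<Longrightarrow> \<bar>F 0 y - F 0 x\<bar> \<le> e / 2"
  proof -
    let ?I = "{-(R + r / 2 + 1)..R + r / 2 + 1}"
    have "uniformly_continuous_on ?I (F 0)"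
      by (intro compact_uniformly_continuous continuous_on_subset[OF cont]) auto
    then obtain c where c: "c > 0" "\<And>x y. x \<in> ?I \<Longrightarrow> y \<in> ?I \<Longrightarrow> \<bar>y - x\<bar> < c \<Longrightarrow> \<bar>F 0 y - F 0 x\<bar> < e / 2"
      using Suc.prems(1) unfolding uniformly_continuous_on_def dist_real_def by (metis half_gt_zero)
    \<comment> \<open>If one of the points leaves the compact interval, the other is within distance
      1 and both lie where \<open>F 0\<close> vanishes; this is the role of the 1 in the
      minimum.\<close>
    have "\<bar>F 0 y - F 0 x\<bar> \<le> e / 2" if "\<bar>y - x\<bar> < min c 1" for x y
    proof (cases "x \<in> ?I \<and> y \<in> ?I")
      case True then show ?thesis using c(2)[of x y] that by simp
    next
      case False
      then have "\<bar>x\<bar> \<ge> R + r / 2" "\<bar>y\<bar> \<ge> R + r / 2" using that by auto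
      then show ?thesis using F(3)[of 0] Suc.prems(1) by simp
    qed
    then show thesis using c(1) by (intro that[of "min c 1"]) auto
  qed
  define \<kappa> where "\<kappa> = min (b / 2) (r / 2)"
  have \<kappa>: "\<kappa> > 0" "\<kappa> < b" "\<kappa> \<le> r / 2" using b(1) Suc.prems(2) by (auto simp: \<kappa>_def)
  have "\<And>x. isCont (F 0) x" using cont by (simp add: continuous_on_eq_continuous_at)
  then obtain \<Phi> where \<Phi>: "\<And>u. (\<Phi> has_real_derivative F 0 u) (at u)"
    using einterval_antiderivative[of "-\<infinity>" \<infinity> "F 0"]
    by (auto simp: has_real_derivative_iff_has_vector_derivative)
  define F' where "F' i u = (case i of 0 \<Rightarrow> (\<Phi> (u + \<kappa>) - \<Phi> u) / \<kappa> | Suc j \<Rightarrow> (F j (u + \<kappa>) - F j u) / \<kappa>)" for i u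
  \<comment> \<open>A mean over the interval is a value of \<open>F 0\<close> at a nearby point,
    which yields both the closeness and the support bound.\<close>
  have intermediate: "\<exists>v. u < v \<and> v < u + \<kappa> \<and> F' 0 u = F 0 v" for u
    using MVT2[of u "u + \<kappa>" \<Phi> "F 0"] \<Phi> \<kappa>(1) by (auto simp: F'_def)
  have quotient: "((\<lambda>u. (f (u + \<kappa>) - f u) / \<kappa>) has_real_derivative (f' (u + \<kappa>) - f' u) / \<kappa>) (at u)"
    if "\<And>u. (f has_real_derivative f' u) (at u)" for f f' u
  proof -
    have "((\<lambda>u. f (u + \<kappa>)) has_real_derivative f' (u + \<kappa>)) (at u)"
      using that[of "u + \<kappa>"] DERIV_shift by blast
    then show ?thesis using that[of u] \<kappa>(1) by (intro DERIV_cdivide DERIV_diff)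
  qed
  show ?case
  proof (intro exI[of _ F'] conjI allI impI)
    fix i u assume "i < Suc k"
    then show "(F' i has_real_derivative F' (Suc i) u) (at u)"
    proof (cases i)
      case 0 then show ?thesis using quotient[OF \<Phi>] by (simp add: F'_def[abs_def])
    next
      case (Suc j)
      then show ?thesis using quotient[OF F(1)[of j]] \<open>i < Suc k\<close> by (simp add: F'_def[abs_def])
    qed
  next
    have "continuous_on UNIV (\<lambda>u. F k (u + \<kappa>))"
      by (rule continuous_on_compose2[OF F(2)]) (auto intro!: continuous_intros)
    then show "continuous_on UNIV (F' (Suc k))"
      unfolding F'_def using F(2) \<kappa>(1) by (auto intro!: continuous_intros)
  next
    fix i u assume i: "i \<le> Suc k" and u: "R + r \<le> \<bar>u\<bar>"
    show "F' i u = 0"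
    proof (cases i)
      case 0
      obtain v where "u < v" "v < u + \<kappa>" "F' 0 u = F 0 v" using intermediate[of u] by auto
      moreover from this have "\<bar>v\<bar> \<ge> R + r / 2" using u \<kappa> by auto
      ultimately show ?thesis using F(3)[of 0 v] 0 by simp
    next
      case (Suc j)
      have "\<bar>u + \<kappa>\<bar> \<ge> R + r / 2" "\<bar>u\<bar> \<ge> R + r / 2" using u \<kappa> Suc.prems(2) by auto
      then show ?thesis using F(3)[of j] Suc i by (simp add: F'_def)
    qed
  next
    fix u
    obtain v where "u < v" "v < u + \<kappa>" "F' 0 u = F 0 v" using intermediate[of u] by auto
    then have "\<bar>F' 0 u - F 0 u\<bar> \<le> e / 2" using b(2)[of v u] \<kappa>(2) by auto
    then show "\<bar>F' 0 u - G u\<bar> \<le> e" using F(4)[of u] by linarith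
  qed
qed

lemma jet_approximation:
  fixes G :: "real \<Rightarrow> real"
  assumes "continuous_on UNIV G" "\<And>u. \<bar>u\<bar> \<ge> R \<Longrightarrow> G u = 0" "e > 0"
  obtains M F where "jet (R + 1) M F" "\<And>u. \<bar>F 0 u - G u\<bar> \<le> e"
proof -
  have "\<exists>F. (\<forall>i<4. \<forall>u. (F i has_real_derivative F (Suc i) u) (at u)) \<and>
    continuous_on UNIV (F 4) \<and> (\<forall>i\<le>4. \<forall>u. \<bar>u\<bar> \<ge> R + 1 \<longrightarrow> F i u = 0) \<and> (\<forall>u. \<bar>F 0 u - G u\<bar> \<le> e)"
    using assms by (intro smooth_approximation) auto
  then obtain F where F: "\<forall>i<4. \<forall>u. (F i has_real_derivative F (Suc i) u) (at u)" "continuous_on UNIV (F 4)"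
      "\<forall>i\<le>4. \<forall>u. \<bar>u\<bar> \<ge> R + 1 \<longrightarrow> F i u = 0" "\<forall>u. \<bar>F 0 u - G u\<bar> \<le> e"
    by (elim exE conjE) (rule that)
  have vanish: "F 4 u = 0" if "\<bar>u\<bar> \<ge> R + 1" for u using F(3) that by simp
  obtain M where "M \<ge> 0" "\<And>u. \<bar>F 4 u\<bar> \<le> M"
    using continuous_support_bounded[OF F(2) vanish] by blast
  then have "jet (R + 1) M F" using F(1-3) unfolding jet_def by blast
  then show thesis using F(4) by (blast intro: that)
qed

text \<open>With d = sqrt(2t/(\<gamma> k)) the k steps fill the time t exactly and k d^2 is
  constant. The support radius R + k d grows only like 1/d, so the accumulated heat error and the
  step error are both O(d).\<close>

lemma (in bond_disorder) time_step_exists: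
  assumes R: "R > 0" and t: "t \<ge> 0" and e: "e > 0"
  obtains k :: nat and d :: real where "d > 0" "real k * (\<gamma> * d\<^sup>2 / 2) = t"
    "real k * (3 * (R + real k * d) * M * d ^ 4) < e"
    "exp t * (t * (step_error (R + real k * d) M d)\<^sup>2) < e"
proof (cases "t = 0")
  case True
  \<comment> \<open>At t = 0 no step is made; d = 1 is an arbitrary positive value.\<close>
  then show thesis using e by (intro that[of 1 0]) auto
next
  case False
  then have t: "t > 0" using t by simp
  define d where "d j = sqrt (2 * t / \<gamma> * (1 / real (Suc j)))" for j
  have d_sq: "real (Suc j) * (d j)\<^sup>2 = 2 * t / \<gamma>" and d_pos: "d j > 0" for j
    using t \<gamma>_pos by (simp_all add: d_def)
  have "(\<lambda>j. 2 * t / \<gamma> * (1 / real (Suc j))) \<longlonglongrightarrow> 2 * t / \<gamma> * 0"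
    by (intro tendsto_intros LIMSEQ_Suc[OF lim_1_over_n])
  then have d0: "d \<longlonglongrightarrow> 0" unfolding d_def[abs_def] using tendsto_real_sqrt by fastforce
  let ?c = "2 * t / \<gamma>"
  \<comment> \<open>This product controls both errors: the growing radius is compensated by one
    factor d^2, and what is left still tends to 0.\<close>
  have rad: "(R + real (Suc j) * d j) * (d j)\<^sup>2 = R * (d j)\<^sup>2 + ?c * d j" for j
    unfolding d_sq[of j, symmetric] by (simp add: algebra_simps power2_eq_square)
  have 1: "real (Suc j) * (3 * (R + real (Suc j) * d j) * M * d j ^ 4)
      = 3 * M * ?c * (R * (d j)\<^sup>2 + ?c * d j)" for j
  proof -
    have "real (Suc j) * (3 * (R + real (Suc j) * d j) * M * d j ^ 4)
        = 3 * M * (real (Suc j) * (d j)\<^sup>2) * ((R + real (Suc j) * d j) * (d j)\<^sup>2)"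
      by (simp only: power2_eq_square power4_eq_xxxx ac_simps)
    then show ?thesis unfolding d_sq rad .
  qed
  have 2: "step_error (R + real (Suc j) * d j) M (d j)
      = (2 * (R * (d j)\<^sup>2 + ?c * d j) + 7 * (d j)\<^sup>2) * (3 * M / \<gamma>)" for j
    unfolding step_error_def rad[symmetric] by (simp add: algebra_simps)
  have "(\<lambda>j. 3 * M * ?c * (R * (d j)\<^sup>2 + ?c * d j)) \<longlonglongrightarrow> 3 * M * ?c * (R * 0\<^sup>2 + ?c * 0)"
    by (intro tendsto_intros d0)
  then have ev1: "\<forall>\<^sub>F j in sequentially. 3 * M * ?c * (R * (d j)\<^sup>2 + ?c * d j) < e"
    using e by (intro order_tendstoD(2)) auto
  have "(\<lambda>j. exp t * (t * ((2 * (R * (d j)\<^sup>2 + ?c * d j) + 7 * (d j)\<^sup>2) * (3 * M / \<gamma>))\<^sup>2))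
      \<longlonglongrightarrow> exp t * (t * ((2 * (R * 0\<^sup>2 + ?c * 0) + 7 * 0\<^sup>2) * (3 * M / \<gamma>))\<^sup>2)"
    by (intro tendsto_intros d0)
  then have ev2: "\<forall>\<^sub>F j in sequentially.
      exp t * (t * ((2 * (R * (d j)\<^sup>2 + ?c * d j) + 7 * (d j)\<^sup>2) * (3 * M / \<gamma>))\<^sup>2) < e"
    using e by (intro order_tendstoD(2)) auto
  obtain j where j: "3 * M * ?c * (R * (d j)\<^sup>2 + ?c * d j) < e"
    "exp t * (t * ((2 * (R * (d j)\<^sup>2 + ?c * d j) + 7 * (d j)\<^sup>2) * (3 * M / \<gamma>))\<^sup>2) < e"
    using eventually_happens[OF eventually_conj[OF ev1 ev2]] by auto
  show thesis
  proof (rule that[of "d j" "Suc j"])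
    have "real (Suc j) * (\<gamma> * (d j)\<^sup>2 / 2) = \<gamma> / 2 * (real (Suc j) * (d j)\<^sup>2)" by simp
    then show "real (Suc j) * (\<gamma> * (d j)\<^sup>2 / 2) = t" unfolding d_sq using \<gamma>_pos by simp
  qed (use j d_pos in \<open>simp_all only: 1 2\<close>)
qed

section \<open>From the empirical measure to linear statistics, and the conclusion\<close>

lemma lattice_radius_mono: "R \<le> R' \<Longrightarrow> lattice_radius R N \<le> lattice_radius R' N"
  unfolding lattice_radius_def by (intro nat_mono ceiling_mono mult_right_mono) auto

lemma lattice_outside:
  assumes "R \<ge> 0" "N \<ge> 1" "x \<notin> {-(int (lattice_radius R N) + 1)..int (lattice_radius R N) + 1}"
  shows "\<bar>real_of_int x / real N\<bar> \<ge> R"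
proof -
  have "R * N \<le> \<bar>real_of_int x\<bar>"
    using assms(3) lattice_radius_bounds(1)[OF assms(1), of N] by auto
  then show ?thesis using assms(2) by (simp add: abs_divide pos_le_divide_eq)
qed

lemma empirical_integral_linear_statistic:
  assumes N: "N \<ge> 1" and G: "continuous_on UNIV G" "\<And>u. \<bar>u\<bar> \<ge> R \<Longrightarrow> G u = 0" and R: "R \<ge> 0"
  shows "(LINT u|empirical_measure N \<eta>. G u)
    = linear_statistic (int (lattice_radius R N) + 1) (\<lambda>x. G (x / N) / N) \<eta>"
proof -
  let ?n = "int (lattice_radius R N) + 1"
  have "(\<Sum>\<^sub>\<infinity>x\<in>UNIV. G (real_of_int x / real N) * of_bool (\<eta> x))
      = (\<Sum>\<^sub>\<infinity>x\<in>{-?n..?n}. G (real_of_int x / real N) * of_bool (\<eta> x))"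
    by (rule infsum_cong_neutral) (use lattice_outside[OF R N] G(2) in auto)
  also have "\<dots> = (\<Sum>x\<in>{-?n..?n}. G (real_of_int x / real N) * of_bool (\<eta> x))"
    by (rule infsum_finite) simp
  finally show ?thesis
    using integral_empirical_measure[OF N G(1) support_imp_compactly_supported[OF G(2)], of R]
    by (simp add: linear_statistic_def sum_divide_distrib del: sum_mult_of_bool_eq)
qed

theorem theorem2p1:
  fixes \<xi> :: "int \<Rightarrow> real" and \<gamma> :: real
    and \<rho>0 :: "real \<Rightarrow> real" and \<rho> :: "real \<Rightarrow> real \<Rightarrow> real"
    and P :: "nat \<Rightarrow> (real \<Rightarrow> config) measure"
    and G :: "real \<Rightarrow> real" and t \<delta> :: real
  assumes "\<forall>x. \<xi> x > 0"
    and "\<gamma> > 0"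
    and "(\<lambda>K::nat. (1 / real K) * (\<Sum>x = 1..int K. inverse (\<xi> x))) \<longlonglongrightarrow> \<gamma>"
    and "(\<lambda>K::nat. (1 / real K) * (\<Sum>x = - int K..-1. inverse (\<xi> x))) \<longlonglongrightarrow> \<gamma>"
    and "\<forall>u. \<rho>0 u \<in> {0..1}"
    and "AE u in lebesgue. isCont \<rho>0 u"
    and "\<forall>N\<ge>1. exclusion_law \<xi> N (profile_measure N \<rho>0) (P N)"
    and "weak_heat_solution \<gamma> \<rho>0 \<rho>"
    and "continuous_on UNIV G"
    and "compactly_supported G"
    and "t \<ge> 0"
    and "\<delta> > 0"
  shows "(\<lambda>N. measure (P N) {\<omega> \<in> space (P N).
            \<bar>(LINT u|empirical_measure N (\<omega> t). G u) - pairing (\<rho> t) G\<bar> > \<delta>})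
         \<longlonglongrightarrow> 0"
proof -
  interpret bond_disorder \<xi> \<gamma> using assms(1-4) by unfold_locales auto
  interpret heat: heat_solution \<gamma> \<rho>0 \<rho> using assms(2,8) by unfold_locales auto
  have \<rho>0: "\<rho>0 u \<in> {0..1}" for u using assms(5) by blast
  obtain R where R: "R > 0" "\<And>u. \<bar>u\<bar> \<ge> R \<Longrightarrow> G u = 0"
  proof -
    have "bounded {u. G u \<noteq> 0}"
      using assms(10) unfolding compactly_supported_def
      by (meson bounded_subset closure_subset compact_imp_bounded)
    then obtain B where "\<And>u. G u \<noteq> 0 \<Longrightarrow> \<bar>u\<bar> \<le> B" unfolding bounded_iff by auto
    then show thesis by (intro that[of "\<bar>B\<bar> + 1"]) force+
  qed
  \<comment> \<open>A uniform error of this size costs at most \<delta>/8 in a linear statistic over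
    at most (2R + 7) N sites of weight 1/N, and at most \<delta>/8 in the pairing.\<close>
  define e1 where "e1 = \<delta> / (8 * (2 * R + 7))"
  have e1: "e1 > 0" "(2 * R + 7) * e1 = \<delta> / 8"
  proof -
    show "e1 > 0" using R(1) assms(12) by (simp add: e1_def add_pos_pos)
    have cancel: "X * (\<delta> / (8 * X)) = \<delta> / 8" if "X > 0" for X using that by simp
    show "(2 * R + 7) * e1 = \<delta> / 8" unfolding e1_def by (rule cancel) (use R(1) in simp)
  qed
  obtain M F where F: "jet (R + 1) M F" "\<And>u. \<bar>F 0 u - G u\<bar> \<le> e1"
    using jet_approximation[OF assms(9) R(2) e1(1)] by blast
  have F0: "continuous_on UNIV (F 0)" "\<And>u. \<bar>u\<bar> \<ge> R + 1 \<Longrightarrow> F 0 u = 0"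
    using jet_continuous[OF F(1), of 0] jet_support[OF F(1), of 0] by auto
  show ?thesis
  proof (rule LIMSEQ_I)
    fix \<epsilon> :: real assume \<epsilon>: "\<epsilon> > 0"
    \<comment> \<open>Chosen so that the Chebyshev bound 2\<eta> / (\<delta>/2)^2 equals
      \<epsilon>/2.\<close>
    define \<eta> where "\<eta> = \<epsilon> * (\<delta> / 2)\<^sup>2 / 4"
    have \<eta>: "\<eta> > 0" using \<epsilon> assms(12) by (simp add: \<eta>_def)
    have pos: "R + 1 > 0" "t \<ge> 0" "min \<eta> (\<delta> / 8) > 0" using R(1) assms(11,12) \<eta> by auto
    obtain k d where d: "d > 0" "real k * (\<gamma> * d\<^sup>2 / 2) = t"
      "real k * (3 * (R + 1 + real k * d) * M * d ^ 4) < min \<eta> (\<delta> / 8)"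
      "exp t * (t * (step_error (R + 1 + real k * d) M d)\<^sup>2) < min \<eta> (\<delta> / 8)"
      by (rule time_step_exists[OF pos])
    \<comment> \<open>Large enough for the supports of all k averages, so that one window serves
      every time step.\<close>
    define R0 where "R0 = R + 1 + real k * d"
    define z where "z = pairing \<rho>0 ((avg d ^^ k) (F 0))"
    have kd: "real k * d \<ge> 0" using d(1) by simp
    have heat_error: "\<bar>pairing (\<rho> t) (F 0) - z\<bar> \<le> \<delta> / 8"
      using heat.heat_iterate[OF d(1) F(1), of k R0] R(1) d(2,3) unfolding z_def R0_def by simp
    have approx: "\<bar>pairing (\<rho> t) G - pairing (\<rho> t) (F 0)\<bar> \<le> \<delta> / 8"
    proof -
      have "\<bar>pairing (\<rho> t) (\<lambda>u. 1 * G u + (-1) * F 0 u)\<bar> \<le> 2 * (R + 1) * e1"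
        using R F0 F(2) heat.\<rho>_range[OF assms(11)]
        by (intro pairing_bound) (auto simp: abs_minus_commute)
      moreover have "pairing (\<rho> t) (\<lambda>u. 1 * G u + (-1) * F 0 u) = 1 * pairing (\<rho> t) G + (-1) * pairing (\<rho> t) (F 0)"
        using assms(9,11) F0 R by (intro heat.pairing_add[where R = "R + 1"]) auto
      moreover have "2 * (R + 1) * e1 \<le> (2 * R + 7) * e1" using e1(1) by (intro mult_right_mono) auto
      ultimately show ?thesis using e1(2) by simp
    qed
    have "\<forall>\<^sub>F N in sequentially. \<forall>P' S. exclusion_process P' \<xi> N S (profile_measure N \<rho>0) \<longrightarrow>
        second_moment P' N R0 (real k * (\<gamma> * d\<^sup>2 / 2)) (F 0) (pairing \<rho>0 ((avg d ^^ k) (F 0)))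
          \<le> exp (real k * (\<gamma> * d\<^sup>2 / 2)) * (real k * (\<gamma> * d\<^sup>2 / 2) * (step_error R0 M d)\<^sup>2) + \<eta>"
    proof (rule second_moment_iterate[where R = "R + 1" and M = M and F = F and \<mu> = "\<lambda>N. profile_measure N \<rho>0"])
      fix f :: "real \<Rightarrow> real" and e :: real
      assume "continuous_on UNIV f" "\<And>u. R0 \<le> \<bar>u\<bar> \<Longrightarrow> f u = 0" "e > 0"
      then show "\<forall>\<^sub>F N in sequentially. \<forall>P' S. exclusion_process P' \<xi> N S (profile_measure N \<rho>0) \<longrightarrow>
          second_moment P' N R0 0 f (pairing \<rho>0 f) \<le> e"
        using \<rho>0 assms(6) R(1) kd by (intro initial_second_moment) (auto simp: R0_def)
    qed (use d(1) F(1) R(1) \<eta> in \<open>auto simp: R0_def\<close>)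
    \<comment> \<open>One \<open>\<eta>\<close> is the accumulated scheme error fixed by the choice
      of \<open>d\<close>, the other the slack that vanishes with N.\<close>
    then have "\<forall>\<^sub>F N in sequentially. \<forall>P' S. exclusion_process P' \<xi> N S (profile_measure N \<rho>0) \<longrightarrow>
        second_moment P' N R0 t (F 0) z \<le> 2 * \<eta>"
      by (rule eventually_mono) (use d(2,4) in \<open>fastforce simp: R0_def z_def\<close>)
    then have "\<forall>\<^sub>F N in sequentially. norm (measure (P N) {\<omega> \<in> space (P N).
            \<bar>(LINT u|empirical_measure N (\<omega> t). G u) - pairing (\<rho> t) G\<bar> > \<delta>} - 0) < \<epsilon>"
      using eventually_gt_at_top[of "0::nat"]
    proof eventually_elim
      case (elim N)
      then have N: "N \<ge> 1" by simp
      obtain S where S: "markov_semigroup S" "generator_on_cylinders S (exclusion_generator \<xi> N)"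
        "markov_law S (profile_measure N \<rho>0) (P N)"
        using assms(7) N unfolding exclusion_law_def by blast
      interpret proc: exclusion_process "P N" \<xi> N S "profile_measure N \<rho>0"
        using S by (intro exclusion_process.intro exclusion_process_axioms.intro) (auto simp: markov_law_def)
      let ?n = "int (lattice_radius (R + 1) N) + 1" and ?m = "int (lattice_radius R0 N) + 1"
      let ?X = "\<lambda>\<omega>. linear_statistic ?m (\<lambda>x. F 0 (x / N) / N) (\<omega> t) - z"
      have close: "\<bar>(LINT u|empirical_measure N \<zeta>. G u) - linear_statistic ?m (\<lambda>x. F 0 (x / N) / N) \<zeta>\<bar> \<le> \<delta> / 8" for \<zeta>
      proof -
        have "(LINT u|empirical_measure N \<zeta>. G u) = linear_statistic ?n (\<lambda>x. G (x / N) / N) \<zeta>"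
          using N assms(9) R by (intro empirical_integral_linear_statistic) auto
        moreover have "linear_statistic ?n (\<lambda>x. F 0 (x / N) / N) \<zeta> = linear_statistic ?m (\<lambda>x. F 0 (x / N) / N) \<zeta>"
        proof (rule linear_statistic_wider)
          show "F 0 (x / N) / N = 0" if "x \<notin> {-?n..?n}" for x
            using lattice_outside[OF _ N that] F0(2) R(1) by simp
          show "?n \<le> ?m" using lattice_radius_mono[of "R + 1" R0 N] kd by (simp add: R0_def)
        qed
        moreover have "\<bar>linear_statistic ?n (\<lambda>x. G (x / N) / N) \<zeta> - linear_statistic ?n (\<lambda>x. F 0 (x / N) / N) \<zeta>\<bar> \<le> \<delta> / 8"
        proof -
          have "\<bar>linear_statistic ?n (\<lambda>x. G (x / N) / N) \<zeta> - linear_statistic ?n (\<lambda>x. F 0 (x / N) / N) \<zeta>\<bar>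
              \<le> (\<Sum>x\<in>{-?n..?n}. \<bar>G (x / N) / N - F 0 (x / N) / N\<bar>)"
            by (rule linear_statistic_diff_bound)
          also have "\<dots> \<le> (\<Sum>x\<in>{-?n..?n}. e1 / N)"
            using F(2) by (intro sum_mono)
              (simp add: diff_divide_distrib[symmetric] abs_divide divide_right_mono abs_minus_commute)
          also have "\<dots> = (2 * real (lattice_radius (R + 1) N) + 3) * (e1 / N)" by simp
          also have "\<dots> \<le> ((2 * R + 7) * N) * (e1 / N)"
          proof (intro mult_right_mono)
            show "2 * real (lattice_radius (R + 1) N) + 3 \<le> (2 * R + 7) * N"
              using lattice_radius_bounds(2)[of "R + 1" N] R(1) N by (simp add: algebra_simps)
          qed (use e1 in auto)
          also have "\<dots> = \<delta> / 8" using N e1(2) by simp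
          finally show ?thesis .
        qed
        ultimately show ?thesis by simp
      qed
      have cylX: "cylinder (\<lambda>\<eta>. (linear_statistic ?m (\<lambda>x. F 0 (x / N) / N) \<eta> - z)\<^sup>2)"
        unfolding power2_eq_square
        by (intro cylinder_times cylinder_minus cylinder_linear_statistic cylinder_const)
      have measX: "?X \<in> borel_measurable (P N)"
        using measurable_compose[OF proc.measurable_eval[OF assms(11)] cylinder_measurable]
        by (intro borel_measurable_diff) (auto intro: cylinder_linear_statistic)
      have intX: "integrable (P N) (\<lambda>\<omega>. (?X \<omega>)\<^sup>2)"
      proof -
        obtain C where "\<And>\<eta>. \<bar>(linear_statistic ?m (\<lambda>x. F 0 (x / N) / N) \<eta> - z)\<^sup>2\<bar> \<le> C"
          using cylinder_bounded[OF cylX] by blast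
        then show ?thesis using measX by (intro proc.integrable_const_bound[where B = C]) auto
      qed
      have "measure (P N) {\<omega> \<in> space (P N). \<bar>(LINT u|empirical_measure N (\<omega> t). G u) - pairing (\<rho> t) G\<bar> > \<delta>}
          \<le> measure (P N) {\<omega> \<in> space (P N). \<bar>?X \<omega>\<bar> \<ge> \<delta> / 2}"
      proof (rule proc.finite_measure_mono)
        show "{\<omega> \<in> space (P N). \<bar>?X \<omega>\<bar> \<ge> \<delta> / 2} \<in> sets (P N)"
          using measX by (intro borel_measurable_le borel_measurable_abs) auto
        show "{\<omega> \<in> space (P N). \<bar>(LINT u|empirical_measure N (\<omega> t). G u) - pairing (\<rho> t) G\<bar> > \<delta>}
            \<subseteq> {\<omega> \<in> space (P N). \<bar>?X \<omega>\<bar> \<ge> \<delta> / 2}"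
        proof (safe)
          fix \<omega> assume "\<delta> < \<bar>(LINT u|empirical_measure N (\<omega> t). G u) - pairing (\<rho> t) G\<bar>"
          \<comment> \<open>The three errors of \<delta>/8 (test function on the lattice, test
            function in the pairing, averaging scheme for the heat equation) leave 5\<delta>/8, more
            than \<delta>/2.\<close>
          then show "\<bar>?X \<omega>\<bar> \<ge> \<delta> / 2" using close[of "\<omega> t"] approx heat_error assms(12) by linarith
        qed
      qed
      also have "\<dots> \<le> (\<integral>\<omega>. (?X \<omega>)\<^sup>2 \<partial>P N) / (\<delta> / 2)\<^sup>2"
        using measX intX assms(12) by (intro proc.second_moment_method) auto
      also have "(\<integral>\<omega>. (?X \<omega>)\<^sup>2 \<partial>P N) \<le> 2 * \<eta>"
        using elim(1) proc.exclusion_process_axioms unfolding second_moment_def by blast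
      also have "2 * \<eta> / (\<delta> / 2)\<^sup>2 = \<epsilon> / 2"
        using assms(12) by (simp add: \<eta>_def)
      finally show ?case using \<epsilon> by (simp add: divide_right_mono)
    qed
    then show "\<exists>no. \<forall>N\<ge>no. norm (measure (P N) {\<omega> \<in> space (P N).
            \<bar>(LINT u|empirical_measure N (\<omega> t). G u) - pairing (\<rho> t) G\<bar> > \<delta>} - 0) < \<epsilon>"
      by (simp add: eventually_sequentially)
  qed
qed

end
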